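(* Let $n$ be a cube-free positive integer. If $f_{cf,sol}(n)$ is the number of solvable groups of order $n$ up to isomorphism, then $$f_{cf,sol}(n) \leq n^{2\mu(n)}.$$
   Context: A positive integer is cube-free if it is not divisible by the cube of any prime. For a positive integer $n$, $\mu(n)$ denotes the highest power (exponent) to which any prime divides $n$. *)

theory Defs
  imports "HOL-Algebra.Solvable_Groups" "HOL-Computational_Algebra.Primes"
begin

definition cube_free :: "nat \<Rightarrow> bool"
  where "cube_free n \<longleftrightarrow> (\<forall>p. prime p \<longrightarrow> \<not> p ^ 3 dvd n)"

text \<open>
  The largest exponent with which a prime occurs in \<open>n\<close>. Primes not dividing \<open>n\<close> contribute the
  exponent \<open>0\<close>, so that the set is never empty and the value at \<open>1\<close> is \<open>0\<close>. The set is
  finite for \<open>n > 0\<close>.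
\<close>
definition max_prime_exponent :: "nat \<Rightarrow> nat"
  where "max_prime_exponent n = Max {multiplicity p n | p. prime p}"

text \<open>
  Groups of finite order are represented by groups whose elements are natural numbers; by
  \<open>solvable_group_of_order_iso\<close> below, this loses no isomorphism class.
\<close>
definition solvable_groups_of_order :: "nat \<Rightarrow> nat monoid set"
  where "solvable_groups_of_order n =
    {G. group G \<and> finite (carrier G) \<and> order G = n \<and> solvable G}"

definition group_iso_rel :: "nat monoid set \<Rightarrow> (nat monoid \<times> nat monoid) set"
  where "group_iso_rel S = {(G, H). G \<in> S \<and> H \<in> S \<and> G \<cong> H}"

text \<open>
  This is a cardinality of a finite set, by \<open>finite_solvable_groups_of_order_classes\<close> below.
\<close>
definition num_solvable_groups :: "nat \<Rightarrow> nat"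
  where "num_solvable_groups n =
    card (solvable_groups_of_order n // group_iso_rel (solvable_groups_of_order n))"

lemma finite_multiplicities:
  assumes "n > (0::nat)"
  shows "finite {multiplicity p n | p. prime p}"
proof -
  have "multiplicity p n \<le> n" if "prime p" for p
  proof -
    have "p ^ multiplicity p n \<le> n"
      using assms by (intro dvd_imp_le multiplicity_dvd)
    moreover have "multiplicity p n < p ^ multiplicity p n"
      using prime_gt_1_nat[OF that] by (simp add: power_gt_expt)
    ultimately show ?thesis by linarith
  qed
  then have "{multiplicity p n | p. prime p} \<subseteq> {..n}" by auto
  then show ?thesis using finite_subset by blast
qed

lemma equiv_group_iso_rel:
  "equiv (solvable_groups_of_order n) (group_iso_rel (solvable_groups_of_order n))"
proof (rule equivI)
  show "sym (group_iso_rel (solvable_groups_of_order n))"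
    unfolding sym_def group_iso_rel_def solvable_groups_of_order_def
    using group.iso_sym by blast
  show "trans (group_iso_rel (solvable_groups_of_order n))"
    unfolding trans_def group_iso_rel_def using iso_trans by blast
qed (auto simp: refl_on_def group_iso_rel_def)

text \<open>
  Every finite solvable group, over whatever type, is isomorphic to one of those being counted,
  and even to one with carrier \<open>{..<n}\<close>.
\<close>
lemma solvable_group_of_order_iso:
  fixes G :: "('a, 'b) monoid_scheme"
  assumes "group G" "finite (carrier G)" "order G = n" "solvable G"
  shows "\<exists>H \<in> solvable_groups_of_order n. carrier H = {..<n} \<and> G \<cong> H"
proof -
  interpret G: group G by fact
  obtain h where h: "bij_betw h (carrier G) {..<n}"
    using finite_same_card_bij[of "carrier G" "{..<n}"] assms(2,3) by (auto simp: order_def)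
  define k where "k = inv_into (carrier G) h"
  have k: "k (h x) = x" if "x \<in> carrier G" for x
    using h that by (simp add: k_def bij_betw_def)
  have h_mem: "h x \<in> {..<n}" if "x \<in> carrier G" for x
    using h that by (auto simp: bij_betw_def)
  have hk: "\<exists>x\<in>carrier G. i = h x" if "i \<in> {..<n}" for i
    using h that by (auto simp: bij_betw_def)
  define H :: "nat monoid" where
    "H = \<lparr>carrier = {..<n}, monoid.mult = (\<lambda>i j. h (k i \<otimes>\<^bsub>G\<^esub> k j)), one = h \<one>\<^bsub>G\<^esub>\<rparr>"
  have H [simp]: "carrier H = {..<n}" "i \<otimes>\<^bsub>H\<^esub> j = h (k i \<otimes>\<^bsub>G\<^esub> k j)" "\<one>\<^bsub>H\<^esub> = h \<one>\<^bsub>G\<^esub>" for i j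
    by (simp_all add: H_def)
  have "group H"
  proof (rule groupI)
    fix i j l assume ijl: "i \<in> carrier H" "j \<in> carrier H" "l \<in> carrier H"
    then obtain x y z where "x \<in> carrier G" "y \<in> carrier G" "z \<in> carrier G" "i = h x" "j = h y" "l = h z"
      using hk unfolding H(1) by metis
    then show "i \<otimes>\<^bsub>H\<^esub> j \<otimes>\<^bsub>H\<^esub> l = i \<otimes>\<^bsub>H\<^esub> (j \<otimes>\<^bsub>H\<^esub> l)"
      by (simp add: k G.m_assoc)
  next
    fix i j assume "i \<in> carrier H" "j \<in> carrier H"
    then obtain x y where "x \<in> carrier G" "y \<in> carrier G" "i = h x" "j = h y"
      using hk unfolding H(1) by metis
    then show "i \<otimes>\<^bsub>H\<^esub> j \<in> carrier H"
      using h_mem[of "x \<otimes>\<^bsub>G\<^esub> y"] by (simp add: k)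
  next
    show "\<one>\<^bsub>H\<^esub> \<in> carrier H" using h_mem[of "\<one>\<^bsub>G\<^esub>"] by simp
  next
    fix i assume "i \<in> carrier H"
    then obtain x where x: "x \<in> carrier G" "i = h x"
      using hk unfolding H(1) by metis
    then show "\<one>\<^bsub>H\<^esub> \<otimes>\<^bsub>H\<^esub> i = i" by (simp add: k)
    have "h (inv\<^bsub>G\<^esub> x) \<in> carrier H" using h_mem[of "inv\<^bsub>G\<^esub> x"] x by simp
    moreover have "h (inv\<^bsub>G\<^esub> x) \<otimes>\<^bsub>H\<^esub> i = \<one>\<^bsub>H\<^esub>" using x by (simp add: k)
    ultimately show "\<exists>j\<in>carrier H. j \<otimes>\<^bsub>H\<^esub> i = \<one>\<^bsub>H\<^esub>" by blast
  qed
  moreover have iso: "h \<in> iso G H"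
    using h h_mem by (auto simp: iso_def hom_def k)
  ultimately have "group_hom G H h"
    by (simp add: group_hom_def group_hom_axioms_def iso_def assms(1))
  then have "solvable H"
    using group_hom.surj_hom_imp_solvable[of G H h] h assms(4) by (simp add: bij_betw_def)
  with \<open>group H\<close> have "H \<in> solvable_groups_of_order n"
    by (simp add: solvable_groups_of_order_def order_def)
  moreover have "G \<cong> H" using iso by (rule is_isoI)
  ultimately show ?thesis using H(1) by blast
qed

lemma finite_solvable_groups_of_order_classes:
  "finite (solvable_groups_of_order n // group_iso_rel (solvable_groups_of_order n))"
proof -
  let ?S = "solvable_groups_of_order n"
  let ?R = "group_iso_rel ?S"
  have "\<exists>H. H \<in> ?S \<and> carrier H = {..<n} \<and> c = ?R `` {H}" if c: "c \<in> ?S // ?R" for c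
  proof -
    obtain G where G: "G \<in> ?S" "c = ?R `` {G}" using c by (auto elim: quotientE)
    then obtain H where H: "H \<in> ?S" "carrier H = {..<n}" "G \<cong> H"
      using solvable_group_of_order_iso[of G n] by (auto simp: solvable_groups_of_order_def)
    then have "(G, H) \<in> ?R" using G by (simp add: group_iso_rel_def)
    then show ?thesis
      using equiv_class_eq[OF equiv_group_iso_rel] G H by blast
  qed
  then obtain rep where rep: "\<And>c. c \<in> ?S // ?R \<Longrightarrow>
      rep c \<in> ?S \<and> carrier (rep c) = {..<n} \<and> c = ?R `` {rep c}"
    by metis
  define tab where "tab c = {(i, j, i \<otimes>\<^bsub>rep c\<^esub> j) | i j. i < n \<and> j < n}" for c
  have "inj_on tab (?S // ?R)"
  proof (rule inj_onI)
    fix c d assume c: "c \<in> ?S // ?R" and d: "d \<in> ?S // ?R" and eq: "tab c = tab d"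
    have mult: "i \<otimes>\<^bsub>rep c\<^esub> j = i \<otimes>\<^bsub>rep d\<^esub> j" if "i < n" "j < n" for i j
    proof -
      have "(i, j, i \<otimes>\<^bsub>rep c\<^esub> j) \<in> tab d"
        using that unfolding eq[symmetric] by (auto simp: tab_def)
      then show ?thesis by (auto simp: tab_def)
    qed
    have "id \<in> iso (rep c) (rep d)"
      using rep[OF c] rep[OF d] mult by (simp add: iso_def hom_def)
    then have "(rep c, rep d) \<in> ?R"
      using rep[OF c] rep[OF d] by (auto simp: group_iso_rel_def is_iso_def)
    then show "c = d"
      using equiv_class_eq[OF equiv_group_iso_rel] rep[OF c] rep[OF d] by metis
  qed
  moreover have "tab ` (?S // ?R) \<subseteq> Pow ({..<n} \<times> {..<n} \<times> {..<n})"
  proof -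
    have "i \<otimes>\<^bsub>rep c\<^esub> j < n" if c: "c \<in> ?S // ?R" and "i < n" "j < n" for c i j
    proof -
      have "group (rep c)" using rep[OF c] by (simp add: solvable_groups_of_order_def)
      then interpret group "rep c" .
      show ?thesis using m_closed[of i j] rep[OF c] that(2,3) by simp
    qed
    then show ?thesis by (auto simp: tab_def)
  qed
  ultimately show ?thesis
    by (meson finite_Pow_iff finite_SigmaI finite_lessThan finite_subset finite_imageD)
qed

end

theory Submission
  imports Defs "HOL-Algebra.Sylow" "HOL-Algebra.Group_Action" "HOL-Algebra.Elementary_Groups"
    "HOL-Algebra.Multiplicative_Group" "HOL-Number_Theory.Cong"
begin

text \<open>
  A solvable group \<open>G\<close> of cube-free order \<open>n\<close> has a normal Sylow \<open>p\<close>-subgroup \<open>P\<close> for the largest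
  prime \<open>p\<close> dividing \<open>n\<close>, except that for \<open>n \<in> {12, 36}\<close> it may have a normal Sylow
  \<open>2\<close>-subgroup instead. Since \<open>P\<close> is abelian, it has a complement \<open>Q\<close>, and \<open>G\<close> is determined by \<open>P\<close>,
  \<open>Q\<close> and the action \<open>Q \<rightarrow> Aut P\<close> up to conjugation in \<open>Aut P\<close>. By induction on \<open>n\<close> it remains to
  bound the number of such actions by \<open>p\<^sup>2\<close> if \<open>P\<close> has order \<open>p\<close>, and by \<open>p\<^sup>8\<close> for both \<open>P\<close> of
  order \<open>p\<^sup>2\<close> together, and to check the exceptional orders numerically.

  As the Sylow subgroups of \<open>Q\<close> are \<open>2\<close>-generated, there are at most \<open>|A|\<^sup>2\<close> homomorphisms from \<open>Q\<close>
  to an abelian group \<open>A\<close>; this settles cyclic \<open>P\<close>. Let \<open>P\<close> be elementary abelian of order \<open>p\<^sup>2\<close>.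
  Orbits of actions are counted by Burnside's lemma, where centralizers of non-scalar elements are
  abelian. A non-abelian image \<open>H\<close> of \<open>Q\<close> in \<open>Aut P\<close> has an abelian normal subgroup that is not
  central, because \<open>|H|\<close> is cube-free. It contains a non-scalar \<open>t\<close>, and by Cayley-Hamilton \<open>t\<close> has
  at most two conjugates under \<open>H\<close>. Hence \<open>Q\<close> has a subgroup of index at most \<open>2\<close> that acts
  through the abelian centralizer of \<open>t\<close>.
\<close>

section \<open>Finite groups and fixed points of \<open>p\<close>-groups\<close>

text \<open>The exceptional orders come from one coincidence: if a p-subgroup fails to centralize a
  normal subgroup of order q or q^2 with q < p, then p divides q^2 - 1, hence p = q + 1 and so q =
  2, p = 3, as in the alternating group of degree 4. The obstacle in the count is elementary abelian
  \<open>P\<close>. The available estimate for the number of all actions is about 4 |Aut P| p^6, far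
  above the allowed p^8 = (p^2)^4, so orbits must be counted. In Burnside's sum the at most p - 1
  scalars fix every action, and all other automorphisms fix at most (p^2 - 1)^2 of them; division by
  |Aut P| leaves the leading term 4 (p - 1) (p^2 - 1)^3. Here 4 bounds the homomorphisms from
  \<open>Q\<close> to a group of order 2, whose kernels are the subgroups of index at most 2; the
  cube is a square for the action of such a kernel times one factor for the image of an element
  outside it. From p = 4 on this term is at most p^8 - p^7. The induction runs with a fixed
  exponent, because the largest prime exponent may drop when \<open>P\<close> is split off.\<close>

lemma (in group) card_subgroup_dvd:
  assumes "subgroup H G"
  shows "card H dvd order G"
  using lagrange[OF assms] by (metis dvd_triv_right)

lemma (in group) card_subgroup_dvd_card:
  assumes "subgroup H G" "subgroup K G" "H \<subseteq> K"
  shows "card H dvd card K"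
proof -
  have "group (G\<lparr>carrier := K\<rparr>)" using assms(2) by (rule subgroup_imp_group)
  moreover have "subgroup H (G\<lparr>carrier := K\<rparr>)" using subgroup_incl[OF assms] .
  ultimately show ?thesis using group.card_subgroup_dvd[of "G\<lparr>carrier := K\<rparr>" H]
    by (simp add: order_def)
qed

lemma (in group) subgroup_pow_card:
  assumes "subgroup H G" "finite H" "x \<in> H"
  shows "x [^] card H = \<one>"
proof -
  have "group (G\<lparr>carrier := H\<rparr>)" using assms(1) by (rule subgroup_imp_group)
  then have "x [^]\<^bsub>G\<lparr>carrier := H\<rparr>\<^esub> order (G\<lparr>carrier := H\<rparr>) = \<one>"
    using group.pow_order_eq_1[of "G\<lparr>carrier := H\<rparr>" x] assms by simp
  then show ?thesis by (simp add: order_def nat_pow_consistent[symmetric])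
qed

lemma (in group) pow_coprime_eq_one:
  assumes "x \<in> carrier G" "x [^] (a::nat) = \<one>" "x [^] (b::nat) = \<one>" "coprime a b"
  shows "x = \<one>"
proof -
  have "ord x dvd a" "ord x dvd b" using assms pow_eq_id by auto
  then have "ord x = 1" using assms(4) by (metis coprime_def nat_dvd_1_iff_1)
  then show ?thesis using ord_eq_1 assms(1) by blast
qed

lemma (in group) subgroups_coprime_Int:
  assumes "subgroup H G" "subgroup K G" "finite (carrier G)" "coprime (card H) (card K)"
  shows "H \<inter> K = {\<one>}"
proof -
  have "x = \<one>" if "x \<in> H \<inter> K" for x
    using pow_coprime_eq_one[of x "card H" "card K"] subgroup_pow_card[of _ x] that assms
    by (meson IntD1 IntD2 finite_subset subgroup.mem_carrier subgroup.subset)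
  then show ?thesis using assms by (auto dest: subgroup.one_closed)
qed

lemma (in group) cauchy:
  assumes "finite (carrier G)" "prime p" "p dvd order G"
  obtains x where "x \<in> carrier G" "x \<noteq> \<one>" "x [^] p = \<one>"
proof -
  obtain m where "order G = p ^ 1 * m" using assms(3) by auto
  then obtain H where H: "subgroup H G" "card H = p ^ 1"
    using sylow_thm[OF assms(2) is_group _ assms(1)] by blast
  have "\<exists>x\<in>H. x \<noteq> \<one>"
  proof (rule ccontr)
    assume "\<not> ?thesis"
    then have "H \<subseteq> {\<one>}" by auto
    then have "card H \<le> card {\<one>}" by (intro card_mono) auto
    then show False using H(2) prime_gt_1_nat[OF assms(2)] by simp
  qed
  then obtain x where "x \<in> H" "x \<noteq> \<one>" by blast
  moreover have "finite H" using H assms(1) by (meson finite_subset subgroup.subset)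
  ultimately show ?thesis using that subgroup_pow_card[OF H(1)] H subgroup.mem_carrier[OF H(1)]
    by auto
qed

text \<open>By Cauchy's theorem a prime divisor q of the order yields an element of order q, and
  this element is killed by the power p^k; so q = p.\<close>

lemma (in group) card_exponent_p_power:
  assumes "finite (carrier G)" "prime p" "\<And>x. x \<in> carrier G \<Longrightarrow> x [^] (p ^ k) = \<one>"
  shows "\<exists>j. order G = p ^ j"
proof -
  have "q = p" if q: "prime q" "q dvd order G" for q
  proof (rule ccontr)
    assume "q \<noteq> p"
    obtain x where x: "x \<in> carrier G" "x \<noteq> \<one>" "x [^] q = \<one>" using cauchy[OF assms(1) q] .
    have "coprime q (p ^ k)" using \<open>q \<noteq> p\<close> q(1) assms(2) by (simp add: primes_coprime)
    then show False using pow_coprime_eq_one[OF x(1,3) assms(3)[OF x(1)]] x(2) by blast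
  qed
  note q = this
  have "order G \<noteq> 0" "\<not> is_unit p"
    using assms(1,2) order_gt_0_iff_finite by auto
  then obtain y where y: "order G = p ^ multiplicity p (order G) * y" "\<not> p dvd y"
    by (rule multiplicity_decompose'[of "order G" p])
  have "y = 1"
  proof (rule ccontr)
    assume "y \<noteq> 1"
    then obtain r where r: "prime r" "r dvd y" using prime_factor_nat by blast
    then have "r dvd order G" by (subst y(1)) simp
    then show False using q[OF r(1)] r(2) y(2) by simp
  qed
  then have "order G = p ^ multiplicity p (order G)" using y(1) by simp
  then show ?thesis by blast
qed

text \<open>On \<open>E\<close>, the map \<open>f (inv g)\<close> inverts \<open>f g\<close>, so
  bijectivity comes for free. The restriction is there because \<open>BijGroup E\<close> consists of
  extensional functions.\<close>

lemma group_actionI: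
  assumes G: "group G"
    and closed: "\<And>g x. g \<in> carrier G \<Longrightarrow> x \<in> E \<Longrightarrow> f g x \<in> E"
    and one: "\<And>x. x \<in> E \<Longrightarrow> f \<one>\<^bsub>G\<^esub> x = x"
    and mult: "\<And>g h x. g \<in> carrier G \<Longrightarrow> h \<in> carrier G \<Longrightarrow> x \<in> E \<Longrightarrow> f (g \<otimes>\<^bsub>G\<^esub> h) x = f g (f h x)"
  shows "group_action G E (\<lambda>g. restrict (f g) E)"
proof -
  interpret G: group G by fact
  have bij: "restrict (f g) E \<in> Bij E" if g: "g \<in> carrier G" for g
  proof -
    have "bij_betw (f g) E E"
    proof (rule bij_betwI[where g = "f (inv\<^bsub>G\<^esub> g)"])
      show "f (inv\<^bsub>G\<^esub> g) (f g x) = x" if "x \<in> E" for x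
        using mult[of "inv\<^bsub>G\<^esub> g" g x] one[OF that] that g by simp
      show "f g (f (inv\<^bsub>G\<^esub> g) x) = x" if "x \<in> E" for x
        using mult[of g "inv\<^bsub>G\<^esub> g" x] one[OF that] that g by simp
    qed (use closed g in auto)
    then show ?thesis by (auto simp: Bij_def bij_betw_def inj_on_def)
  qed
  have "(\<lambda>g. restrict (f g) E) \<in> hom G (BijGroup E)"
  proof (rule homI)
    fix g h assume gh: "g \<in> carrier G" "h \<in> carrier G"
    show "restrict (f (g \<otimes>\<^bsub>G\<^esub> h)) E = restrict (f g) E \<otimes>\<^bsub>BijGroup E\<^esub> restrict (f h) E"
      using gh bij closed mult by (auto simp: BijGroup_def compose_def fun_eq_iff)
  qed (use bij in \<open>simp add: BijGroup_def\<close>)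
  then show ?thesis
    by (simp add: group_action_def group_hom_def group_hom_axioms_def G group_BijGroup)
qed

text \<open>Orbit sizes divide p^a, so p divides the size of every orbit with more than one point,
  and the remaining orbits are the fixed points.\<close>

lemma (in group_action) card_fixed_points_mod:
  assumes "finite E" "prime p" "order G = p ^ a"
  shows "[card {x \<in> E. \<forall>g\<in>carrier G. \<phi> g x = x} = card E] (mod p)"
proof -
  interpret G: group G using group_hom group_hom.axioms(1) by auto
  let ?F = "{x \<in> E. \<forall>g\<in>carrier G. \<phi> g x = x}"
  let ?O = "orbits G E \<phi>"
  have fin: "finite ?O" using assms(1) by (auto simp: orbits_def)
  have "finite (carrier G)" using assms(2,3) G.order_gt_0_iff_finite prime_gt_0_nat by simp
  have sub: "orbit G \<phi> x \<subseteq> E" if "x \<in> E" for x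
    using that element_image by (auto simp: orbit_def)
  have fixed: "orbit G \<phi> x = {x}" if "x \<in> ?F" for x
    using that orbit_refl[of x] by (auto simp: orbit_def)
  have one: "card b = 1 \<longleftrightarrow> b \<in> (\<lambda>x. {x}) ` ?F" if b: "b \<in> ?O" for b
  proof
    assume "card b = 1"
    obtain x where x: "x \<in> E" "b = orbit G \<phi> x" using b by (auto simp: orbits_def)
    then have "b = {x}" using orbit_refl[OF x(1)] \<open>card b = 1\<close>
      by (metis card_1_singletonE singletonD)
    moreover have "x \<in> ?F"
      using x \<open>b = {x}\<close> by (force simp: orbit_def)
    ultimately show "b \<in> (\<lambda>x. {x}) ` ?F" by blast
  qed auto
  have img: "(\<lambda>x. {x}) ` ?F \<subseteq> ?O" using fixed by (force simp: orbits_def)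
  have "card E = (\<Sum>b\<in>?O. card b)"
    using disjoint_sum[OF assms(1), of "\<lambda>_. 1::nat"] by simp
  also have "\<dots> = (\<Sum>b\<in>(\<lambda>x. {x}) ` ?F. card b) + (\<Sum>b\<in>?O - (\<lambda>x. {x}) ` ?F. card b)"
    using sum.subset_diff[OF img fin] by (simp add: add.commute)
  also have "(\<Sum>b\<in>(\<lambda>x. {x}) ` ?F. card b) = card ?F"
    by (subst sum.reindex) (auto simp: inj_on_def)
  finally have E: "card E = card ?F + (\<Sum>b\<in>?O - (\<lambda>x. {x}) ` ?F. card b)" .
  have "p dvd (\<Sum>b\<in>?O - (\<lambda>x. {x}) ` ?F. card b)"
  proof (rule dvd_sum)
    fix b assume b: "b \<in> ?O - (\<lambda>x. {x}) ` ?F"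
    then obtain x where x: "x \<in> E" "b = orbit G \<phi> x" by (auto simp: orbits_def)
    have "card b dvd p ^ a" using orbit_stabilizer_theorem[OF x(1)] x(2) assms(3)
      by (metis dvd_triv_left)
    then obtain i where "card b = p ^ i" using divides_primepow_nat[OF assms(2)] by blast
    moreover have "card b \<noteq> 1" using one b by blast
    ultimately show "p dvd card b" by (cases i) auto
  qed
  then show ?thesis using E by (auto simp: cong_def elim!: dvdE)
qed

text \<open>For \<open>S = carrier G\<close> this is the centre, for a singleton the centralizer of
  an element.\<close>

definition (in group) centralizer :: "'a set \<Rightarrow> 'a set"
  where "centralizer S = {g \<in> carrier G. \<forall>s\<in>S. g \<otimes> s = s \<otimes> g}"

lemma (in group) centralizer_subgroup:
  assumes "S \<subseteq> carrier G"
  shows "subgroup (centralizer S) G"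
proof (rule subgroupI)
  fix a assume a: "a \<in> centralizer S"
  have "inv a \<otimes> s = s \<otimes> inv a" if "s \<in> S" for s
  proof -
    have s: "s \<in> carrier G" "a \<in> carrier G" "a \<otimes> s = s \<otimes> a" using that a assms
      by (auto simp: centralizer_def)
    have "inv a \<otimes> s = inv a \<otimes> (s \<otimes> a) \<otimes> inv a" using s(1,2) by (simp add: m_assoc)
    also have "\<dots> = inv a \<otimes> (a \<otimes> s) \<otimes> inv a" using s(3) by simp
    also have "\<dots> = s \<otimes> inv a" using s(1,2) by (simp add: m_assoc[symmetric])
    finally show ?thesis .
  qed
  then show "inv a \<in> centralizer S" using a by (auto simp: centralizer_def)
next
  fix a b assume ab: "a \<in> centralizer S" "b \<in> centralizer S"
  have "a \<otimes> b \<otimes> s = s \<otimes> (a \<otimes> b)" if "s \<in> S" for s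
    using that ab assms by (smt (verit) centralizer_def mem_Collect_eq m_assoc subsetD)
  then show "a \<otimes> b \<in> centralizer S" using ab by (auto simp: centralizer_def)
qed (use assms in \<open>auto simp: centralizer_def subset_iff intro!: exI[of _ \<one>]\<close>)

lemma (in group) subgroup_conj_action:
  assumes "subgroup P G" "subgroup N G" "\<And>g x. g \<in> P \<Longrightarrow> x \<in> N \<Longrightarrow> g \<otimes> x \<otimes> inv g \<in> N"
  shows "group_action (G\<lparr>carrier := P\<rparr>) N (\<lambda>g. \<lambda>x\<in>N. g \<otimes> x \<otimes> inv g)"
proof (rule group_actionI)
  show "group (G\<lparr>carrier := P\<rparr>)" using assms(1) by (rule subgroup_imp_group)
  fix g h x assume "g \<in> carrier (G\<lparr>carrier := P\<rparr>)" "h \<in> carrier (G\<lparr>carrier := P\<rparr>)" "x \<in> N"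
  then have "g \<in> carrier G" "h \<in> carrier G" "x \<in> carrier G"
    using subgroup.mem_carrier assms by auto
  then show "g \<otimes>\<^bsub>G\<lparr>carrier := P\<rparr>\<^esub> h \<otimes> x \<otimes> inv (g \<otimes>\<^bsub>G\<lparr>carrier := P\<rparr>\<^esub> h)
      = g \<otimes> (h \<otimes> x \<otimes> inv h) \<otimes> inv g"
    by (simp add: m_assoc inv_mult_group)
qed (use assms subgroup.mem_carrier[OF assms(2)] in auto)

lemma (in group) conj_eq_iff_commute:
  assumes "g \<in> carrier G" "x \<in> carrier G" "y \<in> carrier G"
  shows "g \<otimes> x \<otimes> inv g = y \<longleftrightarrow> g \<otimes> x = y \<otimes> g"
  using assms inv_solve_right' by (metis m_closed)

text \<open>\<open>N \<inter> centralizer P\<close> is the fixed point set of \<open>P\<close>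
  acting on \<open>N\<close> by conjugation. With \<open>P\<close> and \<open>N\<close> the whole
  p-group this gives a nontrivial centre; with \<open>N\<close> a normal q-group it controls how a
  p-group can act on it.\<close>

lemma (in group) card_centralizer_cong:
  assumes "finite (carrier G)" "subgroup P G" "subgroup N G" "prime p" "card P = p ^ a"
    and "\<And>g x. g \<in> P \<Longrightarrow> x \<in> N \<Longrightarrow> g \<otimes> x \<otimes> inv g \<in> N"
  shows "[card (N \<inter> centralizer P) = card N] (mod p)"
proof -
  interpret A: group_action "G\<lparr>carrier := P\<rparr>" N "\<lambda>g. \<lambda>x\<in>N. g \<otimes> x \<otimes> inv g"
    using subgroup_conj_action assms by blast
  have "N \<inter> centralizer P = {x \<in> N. \<forall>g\<in>P. g \<otimes> x \<otimes> inv g = x}"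
    using subgroup.mem_carrier[OF assms(2)] subgroup.mem_carrier[OF assms(3)]
    by (auto simp: centralizer_def conj_eq_iff_commute)
  moreover have "{x \<in> N. \<forall>g\<in>carrier (G\<lparr>carrier := P\<rparr>). (\<lambda>x\<in>N. g \<otimes> x \<otimes> inv g) x = x}
      = {x \<in> N. \<forall>g\<in>P. g \<otimes> x \<otimes> inv g = x}" by auto
  moreover have "finite N" using assms(1,3) by (meson finite_subset subgroup.subset)
  ultimately show ?thesis
    using A.card_fixed_points_mod[OF _ assms(4)] assms(5) by (simp add: order_def)
qed

text \<open>If x and y did not commute, the centralizer of x would lie strictly between the centre
  and the group. Being a proper divisor of p^2, its order is at most p, but p already divides the
  order of the centre.\<close>

lemma (in group) order_prime_square_comm:
  assumes "prime p" "order G = p ^ 2" "x \<in> carrier G" "y \<in> carrier G"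
  shows "x \<otimes> y = y \<otimes> x"
proof (rule ccontr)
  assume neq: "x \<otimes> y \<noteq> y \<otimes> x"
  let ?Z = "centralizer (carrier G)"
  let ?C = "centralizer {x}"
  have fin: "finite (carrier G)" using assms(1,2) order_gt_0_iff_finite prime_gt_0_nat by simp
  have "[card (carrier G \<inter> ?Z) = card (carrier G)] (mod p)"
    using card_centralizer_cong[OF fin subgroup_self subgroup_self assms(1)] assms(2)
    by (simp add: order_def)
  moreover have "carrier G \<inter> ?Z = ?Z" by (auto simp: centralizer_def)
  ultimately have "[card ?Z = p ^ 2] (mod p)" using assms(2) by (simp add: order_def)
  then have pZ: "p dvd card ?Z" by (simp add: cong_def mod_eq_0_iff_dvd)
  have Z: "subgroup ?Z G" and C: "subgroup ?C G" using centralizer_subgroup assms(3) by auto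
  have sub: "?Z \<subset> ?C" using neq assms(3,4) by (auto simp: centralizer_def)
  have "y \<notin> ?C" using neq by (auto simp: centralizer_def)
  then have sub2: "?C \<subset> carrier G" using assms(4) by (auto simp: centralizer_def)
  have lt: "card ?Z < card ?C" "card ?C < p ^ 2"
    using psubset_card_mono[OF fin sub2] psubset_card_mono[OF _ sub] finite_subset[OF _ fin] sub2
      assms(2)
    by (auto simp: order_def)
  have "card ?C dvd p ^ 2" using card_subgroup_dvd[OF C] assms(2) by simp
  then obtain i where i: "i \<le> 2" "card ?C = p ^ i" using divides_primepow_nat[OF assms(1)] by blast
  have "p > 1" using prime_gt_1_nat[OF assms(1)] .
  have "i < 2" using lt(2) i(2) \<open>p > 1\<close> by (metis power_less_imp_less_exp)
  then have "card ?C \<le> p" using i(2) \<open>p > 1\<close> by (cases i) (auto simp: less_2_cases_iff)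
  moreover have "card ?Z > 0" using subgroup.finite_imp_card_positive[OF Z fin] .
  ultimately show False using lt(1) dvd_imp_le[OF pZ] by linarith
qed

section \<open>Homomorphisms to abelian groups\<close>

text \<open>Extensionality identifies homomorphisms that agree on \<open>carrier Q\<close>; without
  it the set could not be counted.\<close>

definition homs :: "('a, 'c) monoid_scheme \<Rightarrow> ('b, 'd) monoid_scheme \<Rightarrow> ('a \<Rightarrow> 'b) set"
  where "homs Q A = hom Q A \<inter> extensional (carrier Q)"

lemma homsD:
  assumes "\<phi> \<in> homs Q A"
  shows "\<phi> \<in> hom Q A" "\<phi> \<in> extensional (carrier Q)" "x \<in> carrier Q \<Longrightarrow> \<phi> x \<in> carrier A"
    "x \<in> carrier Q \<Longrightarrow> y \<in> carrier Q \<Longrightarrow> \<phi> (x \<otimes>\<^bsub>Q\<^esub> y) = \<phi> x \<otimes>\<^bsub>A\<^esub> \<phi> y"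
  using assms by (auto simp: homs_def hom_def)

lemma homs_group_hom:
  assumes "\<phi> \<in> homs Q A" "group Q" "group A"
  shows "group_hom Q A \<phi>"
  using assms by (simp add: group_hom_def group_hom_axioms_def homs_def)

lemma finite_homs:
  assumes "finite (carrier Q)" "finite (carrier A)"
  shows "finite (homs Q A)"
proof (rule finite_subset)
  show "homs Q A \<subseteq> carrier Q \<rightarrow>\<^sub>E carrier A"
    by (auto simp: homs_def hom_def PiE_def)
  show "finite (carrier Q \<rightarrow>\<^sub>E carrier A)" using assms by (intro finite_PiE) auto
qed

lemma cube_free_multiplicity_le:
  assumes "cube_free n" "n > 0" "prime p"
  shows "multiplicity p n \<le> 2"
proof (rule ccontr)
  assume "\<not> ?thesis"
  then have "p ^ 3 dvd n" by (intro multiplicity_dvd') simp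
  then show False using assms by (auto simp: cube_free_def)
qed

lemma cube_free_dvd: "cube_free n \<Longrightarrow> m dvd n \<Longrightarrow> cube_free m"
  using dvd_trans by (auto simp: cube_free_def)

lemma (in group) exists_sylow:
  assumes "finite (carrier G)" "prime p"
  obtains P where "subgroup P G" "card P = p ^ multiplicity p (order G)"
proof -
  have "order G = p ^ multiplicity p (order G) * (order G div p ^ multiplicity p (order G))"
    using multiplicity_dvd[of p "order G"] by simp
  then show ?thesis using sylow_thm[OF assms(2) is_group _ assms(1)] that by blast
qed

text \<open>Take x nontrivial and y outside the subgroup generated by x. A subgroup of
  \<open>P\<close> containing both is strictly larger than a nontrivial subgroup, so its order is at
  least p^2, which is the most that \<open>P\<close> can have. Generation is phrased through
  subgroups because it is applied to equalizers of homomorphisms.\<close>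

lemma (in group) two_generated:
  assumes "finite (carrier G)" "prime p" "subgroup P G" "card P = p ^ a" "a \<le> 2"
  obtains x y where "x \<in> P" "y \<in> P" "\<And>H. subgroup H G \<Longrightarrow> H \<subseteq> P \<Longrightarrow> x \<in> H \<Longrightarrow> y \<in> H \<Longrightarrow> H = P"
proof -
  have fP: "finite P" using assms(1,3) by (meson finite_subset subgroup.subset)
  have p1: "p > 1" using prime_gt_1_nat[OF assms(2)] .
  have power: "\<exists>i\<le>a. card H = p ^ i" if "subgroup H G" "H \<subseteq> P" for H
    using card_subgroup_dvd_card[OF that(1) assms(3) that(2)] divides_primepow_nat[OF assms(2)]
      assms(4) by metis
  have one: "\<one> \<in> P" using assms(3) by (rule subgroup.one_closed)
  show ?thesis
  proof (cases "P = {\<one>}")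
    case True
    then show ?thesis using that[of \<one> \<one>] by auto
  next
    case False
    then obtain x where x: "x \<in> P" "x \<noteq> \<one>" using one by blast
    define C where "C = generate G {x}"
    have xG: "x \<in> carrier G" using x(1) assms(3) by (rule subgroup.mem_carrier[rotated])
    have C: "subgroup C G" unfolding C_def using xG by (intro generate_is_subgroup) auto
    have CH: "C \<subseteq> H" if "subgroup H G" "x \<in> H" for H
      unfolding C_def using that by (intro generate_subgroup_incl) auto
    have xC: "x \<in> C" unfolding C_def by (simp add: generate.incl)
    have CP: "C \<subseteq> P" using CH[OF assms(3) x(1)] .
    show ?thesis
    proof (cases "C = P")
      case True
      then show ?thesis using that[of x x] x(1) CH by blast
    next
      case False
      then obtain y where y: "y \<in> P" "y \<notin> C" using CP by blast
      have "H = P" if H: "subgroup H G" "H \<subseteq> P" "x \<in> H" "y \<in> H" for H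
      proof -
        have fin: "finite H" "finite C" using finite_subset[OF _ fP] H(2) CP by auto
        obtain i where i: "card C = p ^ i" using power[OF C CP] by blast
        obtain j where j: "j \<le> a" "card H = p ^ j" using power[OF H(1,2)] by blast
        have "C \<subset> H" using CH[OF H(1,3)] y(2) H(4) by blast
        then have "p ^ i < p ^ j" using psubset_card_mono[OF fin(1)] i j(2) by metis
        then have "i < j" using p1 by (simp add: power_strict_increasing_iff)
        moreover have "i \<noteq> 0"
        proof
          assume "i = 0"
          then have "card C = 1" using i by simp
          then obtain c where "C = {c}" by (rule card_1_singletonE)
          then show False using xC subgroup.one_closed[OF C] x(2) by auto
        qed
        ultimately have "j = a" using j(1) assms(5) by linarith
        then show ?thesis using card_subset_eq[OF fP H(2)] j(2) assms(4) by simp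
      qed
      then show ?thesis using that[OF x(1) y(1)] by blast
    qed
  qed
qed

lemma prod_prime_powers_dvd:
  fixes f :: "nat \<Rightarrow> nat"
  assumes "finite S" "\<And>p. p \<in> S \<Longrightarrow> prime p" "\<And>p. p \<in> S \<Longrightarrow> p ^ f p dvd n"
  shows "(\<Prod>p\<in>S. p ^ f p) dvd n"
  using assms
proof (induction S rule: finite_induct)
  case (insert p S)
  have "coprime (p ^ f p) (\<Prod>q\<in>S. q ^ f q)"
  proof (rule prod_coprime_right)
    fix q assume "q \<in> S"
    then have "coprime p q" using insert by (intro primes_coprime) auto
    then show "coprime (p ^ f p) (q ^ f q)" by simp
  qed
  then show ?case using insert by (simp add: divides_mult)
qed simp

lemma (in comm_group) subgroup_pow_eq_one: "subgroup {a \<in> carrier G. a [^] (k::nat) = \<one>} G"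
  by (rule subgroupI) (auto simp: nat_pow_distrib nat_pow_inv intro!: exI[of _ \<one>])

text \<open>The elements killed by p^k form a subgroup, whose order is a power of p because its
  exponent is. For different primes these orders are coprime, so their product still divides
  \<open>order G\<close>.\<close>

lemma (in comm_group) card_torsion:
  assumes "finite (carrier G)" "prime p"
  obtains j where "card {a \<in> carrier G. a [^] (p ^ k) = \<one>} = p ^ j" "p ^ j dvd order G"
proof -
  let ?T = "{a \<in> carrier G. a [^] (p ^ k) = \<one>}"
  have T: "subgroup ?T G" by (rule subgroup_pow_eq_one)
  have "group (G\<lparr>carrier := ?T\<rparr>)" using T by (rule subgroup_imp_group)
  then have "\<exists>j. order (G\<lparr>carrier := ?T\<rparr>) = p ^ j"
    using assms
    by (intro group.card_exponent_p_power[of _ p k]) (auto simp: nat_pow_consistent[symmetric])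
  then obtain j where "card ?T = p ^ j" by (auto simp: order_def)
  then show ?thesis using that card_subgroup_dvd[OF T] by metis
qed

text \<open>A homomorphism is determined by its values on two generators of one Sylow subgroup for
  each prime p. These values lie in the p-torsion \<open>T p\<close> of \<open>A\<close>, and the
  product of the \<open>card (T p)\<close> divides \<open>order A\<close>; the two generators
  account for the square.\<close>

lemma card_homs_comm_le:
  assumes Q: "group Q" "finite (carrier Q)" "cube_free (order Q)"
    and A: "comm_group A" "finite (carrier A)"
  shows "card (homs Q A) \<le> order A ^ 2"
proof -
  interpret Q: group Q by fact
  interpret A: comm_group A by fact
  define S where "S = prime_factors (order Q)"
  have n0: "order Q > 0" using Q(2) Q.order_gt_0_iff_finite by simp
  have fS: "finite S" and pS: "prime p" if "p \<in> S" for p using that by (auto simp: S_def)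
  have fS: "finite S" by (simp add: S_def)
  \<comment> \<open>Subgroup and generators are packed into a triple \<open>t = (P, x, y)\<close>,
    so that a single choice over the primes suffices.\<close>
  have "\<exists>t. subgroup (fst t) Q \<and> card (fst t) = p ^ multiplicity p (order Q) \<and>
      fst (snd t) \<in> fst t \<and> snd (snd t) \<in> fst t \<and> (\<forall>H. subgroup H Q \<longrightarrow> H \<subseteq> fst t \<longrightarrow>
        fst (snd t) \<in> H \<longrightarrow> snd (snd t) \<in> H \<longrightarrow> H = fst t)" if p: "p \<in> S" for p
  proof -
    obtain P where P: "subgroup P Q" "card P = p ^ multiplicity p (order Q)"
      using Q.exists_sylow[OF Q(2) pS[OF p]] .
    obtain x y where "x \<in> P" "y \<in> P" "\<And>H. subgroup H Q \<Longrightarrow> H \<subseteq> P \<Longrightarrow> x \<in> H \<Longrightarrow> y \<in> H \<Longrightarrow> H = P"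
      by (rule Q.two_generated[OF Q(2) pS[OF p] P cube_free_multiplicity_le[OF Q(3) n0 pS[OF p]]])
        blast
    then show ?thesis using P by (intro exI[of _ "(P, x, y)"]) auto
  qed
  then have "\<exists>t. \<forall>p\<in>S. subgroup (fst (t p)) Q \<and> card (fst (t p)) = p ^ multiplicity p (order Q) \<and>
      fst (snd (t p)) \<in> fst (t p) \<and> snd (snd (t p)) \<in> fst (t p) \<and> (\<forall>H. subgroup H Q \<longrightarrow> H \<subseteq> fst (t p)
          \<longrightarrow>
        fst (snd (t p)) \<in> H \<longrightarrow> snd (snd (t p)) \<in> H \<longrightarrow> H = fst (t p))"
    by (intro bchoice) blast
  then obtain t where t: "\<And>p. p \<in> S \<Longrightarrow> subgroup (fst (t p)) Q \<and> card (fst (t p))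
      = p ^ multiplicity p (order Q) \<and>
      fst (snd (t p)) \<in> fst (t p) \<and> snd (snd (t p)) \<in> fst (t p) \<and> (\<forall>H. subgroup H Q \<longrightarrow> H \<subseteq> fst (t p)
          \<longrightarrow>
        fst (snd (t p)) \<in> H \<longrightarrow> snd (snd (t p)) \<in> H \<longrightarrow> H = fst (t p))"
    by blast
  define P x y where "P p = fst (t p)" and "x p = fst (snd (t p))" and "y p = snd (snd (t p))" for p
  have P: "subgroup (P p) Q" "card (P p) = p ^ multiplicity p (order Q)" "x p \<in> P p" "y p \<in> P p"
    "\<And>H. subgroup H Q \<Longrightarrow> H \<subseteq> P p \<Longrightarrow> x p \<in> H \<Longrightarrow> y p \<in> H \<Longrightarrow> H = P p" if "p \<in> S" for p
    using t[OF that] unfolding P_def x_def y_def by blast+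
  define T where "T p = {a \<in> carrier A. a [^]\<^bsub>A\<^esub> (p ^ multiplicity p (order Q)) = \<one>\<^bsub>A\<^esub>}" for p
  define enc where "enc \<phi> = (\<lambda>p\<in>S. (\<phi> (x p), \<phi> (y p)))" for \<phi> :: "'a \<Rightarrow> 'c"
  have "inj_on enc (homs Q A)"
  proof (rule inj_onI)
    fix \<phi> \<psi> assume h: "\<phi> \<in> homs Q A" "\<psi> \<in> homs Q A" "enc \<phi> = enc \<psi>"
    interpret f: group_hom Q A \<phi> using homs_group_hom[OF h(1)] Q.is_group A.is_group by blast
    interpret g: group_hom Q A \<psi> using homs_group_hom[OF h(2)] Q.is_group A.is_group by blast
    \<comment> \<open>The equalizer contains a Sylow subgroup for every prime, so its order is
      divisible by \<open>order Q\<close>.\<close>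
    let ?K = "{q \<in> carrier Q. \<phi> q = \<psi> q}"
    have K: "subgroup ?K Q" by (rule Q.subgroupI) (auto intro!: exI[of _ "\<one>\<^bsub>Q\<^esub>"])
    have "order Q dvd card ?K"
    proof (rule multiplicity_le_imp_dvd)
      show "order Q \<noteq> 0" using n0 by simp
      fix p :: nat assume p: "prime p"
      show "multiplicity p (order Q) \<le> multiplicity p (card ?K)"
      proof (cases "p \<in> S")
        case True
        have "(\<phi> (x p), \<phi> (y p)) = (\<psi> (x p), \<psi> (y p))"
          using True fun_cong[OF h(3), of p] by (simp add: enc_def)
        then have "?K \<inter> P p = P p"
          using P(1,3,4)[OF True] subgroup.mem_carrier[OF P(1)[OF True]]
          by (intro P(5)[OF True] Q.subgroups_Inter_pair K) auto
        then have "card (P p) dvd card ?K"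
          using Q.card_subgroup_dvd_card[OF P(1)[OF True] K] by blast
        moreover have "card ?K \<noteq> 0" using subgroup.finite_imp_card_positive[OF K Q(2)] by simp
        ultimately show ?thesis using P(2)[OF True] p by (intro multiplicity_geI) auto
      next
        case False
        then have "multiplicity p (order Q) = 0"
          using p n0 by (auto simp: S_def prime_factors_dvd not_dvd_imp_multiplicity_0)
        then show ?thesis by simp
      qed
    qed
    then have "order Q \<le> card ?K"
      using subgroup.finite_imp_card_positive[OF K Q(2)] by (intro dvd_imp_le)
    then have "?K = carrier Q" using Q(2) by (intro card_seteq) (auto simp: order_def)
    then have "\<phi> q = \<psi> q" if "q \<in> carrier Q" for q using that by blast
    then show "\<phi> = \<psi>" using homsD(2)[OF h(1)] homsD(2)[OF h(2)] by (intro extensionalityI)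
  qed
  moreover have "enc ` homs Q A \<subseteq> (\<Pi>\<^sub>E p\<in>S. T p \<times> T p)"
  proof (rule image_subsetI)
    fix \<phi> assume h: "\<phi> \<in> homs Q A"
    interpret f: group_hom Q A \<phi> using homs_group_hom[OF h] Q.is_group A.is_group by blast
    have "\<phi> z \<in> T p" if "p \<in> S" "z \<in> P p" for z p
    proof -
      have z: "z \<in> carrier Q" using subgroup.mem_carrier[OF P(1)] that by blast
      have "finite (P p)" using P(1)[OF that(1)] Q(2) by (meson finite_subset subgroup.subset)
      then have "z [^]\<^bsub>Q\<^esub> card (P p) = \<one>\<^bsub>Q\<^esub>" using Q.subgroup_pow_card[OF P(1)] that by blast
      then have "\<phi> z [^]\<^bsub>A\<^esub> card (P p) = \<one>\<^bsub>A\<^esub>" using f.hom_nat_pow[OF z] f.hom_one by metis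
      then show ?thesis using z P(2)[OF that(1)] by (simp add: T_def)
    qed
    then show "enc \<phi> \<in> (\<Pi>\<^sub>E p\<in>S. T p \<times> T p)" using P(3,4) by (auto simp: enc_def)
  qed
  moreover have fin: "finite (\<Pi>\<^sub>E p\<in>S. T p \<times> T p)"
    using fS A(2) by (intro finite_PiE) (auto simp: T_def)
  ultimately have "card (homs Q A) \<le> card (\<Pi>\<^sub>E p\<in>S. T p \<times> T p)"
    by (rule card_inj_on_le)
  also have "\<dots> = (\<Prod>p\<in>S. card (T p)) ^ 2"
    using fS by (simp add: card_PiE card_cartesian_product power2_eq_square prod.distrib)
  also have "\<dots> \<le> order A ^ 2"
  proof -
    have "\<exists>j. card (T p) = p ^ j \<and> p ^ j dvd order A" if "p \<in> S" for p
      using A.card_torsion[OF A(2) pS[OF that]] unfolding T_def by metis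
    then obtain j where j: "\<And>p. p \<in> S \<Longrightarrow> card (T p) = p ^ j p" "\<And>p. p \<in> S \<Longrightarrow> p ^ j p dvd order A"
      by metis
    have "(\<Prod>p\<in>S. card (T p)) dvd order A"
      using prod_prime_powers_dvd[OF fS pS j(2)] j(1) by simp
    moreover have "order A > 0" using A(2) A.order_gt_0_iff_finite by simp
    ultimately show ?thesis by (simp add: dvd_imp_le power_mono)
  qed
  finally show ?thesis .
qed

section \<open>Complements of abelian normal Hall subgroups\<close>

lemma (in group) inv_mult_cancel [simp]:
  assumes "x \<in> carrier G" "y \<in> carrier G"
  shows "inv x \<otimes> (x \<otimes> y) = y" "x \<otimes> (inv x \<otimes> y) = y"
  using assms by (simp_all flip: m_assoc)

text \<open>Needed for conjugation acting on a product over a transversal. In a monoid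
  \<open>hom\<close> does not include preservation of the unit, hence the assumption on
  \<open>c \<one>\<close>.\<close>

lemma (in comm_monoid) finprod_endo:
  assumes "c \<in> hom G G" "c \<one> = \<one>" "f \<in> R \<rightarrow> carrier G"
  shows "c (finprod G f R) = finprod G (\<lambda>r. c (f r)) R"
  using assms(3)
proof (induction R rule: infinite_finite_induct)
  case (insert r R)
  then have f: "f \<in> R \<rightarrow> carrier G" "f r \<in> carrier G" by auto
  then have "(\<lambda>r. c (f r)) \<in> R \<rightarrow> carrier G" "c (f r) \<in> carrier G"
    using hom_in_carrier[OF assms(1)] by auto
  then show ?case using insert f hom_mult[OF assms(1)] by simp
qed (use assms in auto)

lemma (in group) card_set_mult_trivial_Int:
  assumes H: "subgroup H G" and K: "subgroup K G" and HK: "H \<inter> K = {\<one>}"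
  shows "card (H <#> K) = card H * card K"
proof -
  have "inj_on (\<lambda>(x, k). x \<otimes> k) (H \<times> K)"
  proof (rule inj_onI, clarsimp)
    fix x k y l assume a: "x \<in> H" "k \<in> K" "y \<in> H" "l \<in> K" "x \<otimes> k = y \<otimes> l"
    have c: "x \<in> carrier G" "k \<in> carrier G" "y \<in> carrier G" "l \<in> carrier G"
      using a subgroup.mem_carrier[OF H] subgroup.mem_carrier[OF K] by auto
    have "inv y \<otimes> x = inv y \<otimes> (x \<otimes> k) \<otimes> inv k" using c by (simp add: m_assoc)
    also have "\<dots> = l \<otimes> inv k" using c a(5) by (simp add: m_assoc)
    finally have e: "inv y \<otimes> x = l \<otimes> inv k" .
    moreover have "inv y \<otimes> x \<in> H" "l \<otimes> inv k \<in> K"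
      using a subgroup.m_closed[OF K] subgroup.m_inv_closed[OF K]
        subgroup.m_closed[OF H] subgroup.m_inv_closed[OF H] by auto
    ultimately have "inv y \<otimes> x = \<one>" "l \<otimes> inv k = \<one>" using HK by auto
    then show "x = y \<and> k = l" using c by (metis inv_equality inv_inv inv_closed)
  qed
  moreover have "H <#> K = (\<lambda>(x, k). x \<otimes> k) ` (H \<times> K)" by (auto simp: set_mult_def)
  ultimately show ?thesis by (simp add: card_image card_cartesian_product)
qed

text \<open>
  With a transversal \<open>R\<close> of \<open>P\<close> and \<open>g r \<in> P (g \<bullet> r)\<close>, the map \<open>d g = \<Prod>\<^sub>r g r (g \<bullet> r)\<^sup>-\<^sup>1\<close> is a
  crossed homomorphism \<open>G \<rightarrow> P\<close> that raises the elements of \<open>P\<close> to the power \<open>[G : P]\<close>; its zero set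
  is a complement.
\<close>
lemma (in group) abelian_normal_complement:
  assumes P: "P \<lhd> G" and fin: "finite (carrier G)"
    and comm: "\<And>x y. x \<in> P \<Longrightarrow> y \<in> P \<Longrightarrow> x \<otimes> y = y \<otimes> x"
    and ord: "order G = card P * m" and cop: "coprime (card P) m"
  obtains K where "subgroup K G" "card K = m" "P \<inter> K = {\<one>}" "carrier G = P <#> K"
proof -
  interpret P: normal P G by fact
  let ?A = "G\<lparr>carrier := P\<rparr>"
  interpret A: group ?A using P.subgroup_axioms by (rule subgroup_imp_group)
  interpret A: comm_group ?A by (rule A.group_comm_groupI) (use comm in auto)
  have finP: "finite P" using fin P.subset finite_subset by blast
  have cP: "card P > 0" using P.finite_imp_card_positive[OF fin] .
  \<comment> \<open>The choice depends only on the coset \<open>P #> g\<close>, so all its elements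
    share one representative.\<close>
  define rep where "rep g = (SOME h. h \<in> P #> g)" for g
  define R where "R = rep ` carrier G"
  have rep_in: "rep g \<in> P #> g" if "g \<in> carrier G" for g
    unfolding rep_def using rcos_self[OF that P.subgroup_axioms] by (rule someI)
  have rep_closed [simp]: "rep g \<in> carrier G" if "g \<in> carrier G" for g
    using rep_in[OF that] r_coset_subset_G[OF P.subset that] by blast
  have coset_rep: "P #> rep g = P #> g" if "g \<in> carrier G" for g
    using repr_independence[OF rep_in[OF that] that P.subgroup_axioms] by simp
  have rep_mult: "rep (x \<otimes> g) = rep g" if "x \<in> P" "g \<in> carrier G" for x g
  proof -
    have "P #> (x \<otimes> g) = P #> g"
      using repr_independence[of "x \<otimes> g" P g] that P.subgroup_axioms rcosI[of x P g] P.subset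
      by auto
    then show ?thesis by (simp add: rep_def)
  qed
  have diff: "g \<otimes> inv (rep g) \<in> P" if "g \<in> carrier G" for g
  proof -
    have "g \<in> P #> rep g" using coset_rep[OF that] rcos_self[OF that P.subgroup_axioms] by simp
    then show ?thesis using P.rcos_module that by simp
  qed
  \<comment> \<open>The products \<open>g \<otimes> h\<close> and \<open>g \<otimes> rep h\<close>
    differ by a left factor that is a \<open>g\<close>-conjugate of an element of \<open>P\<close>;
    this is where normality makes \<open>G\<close> act on representatives.\<close>
  have rep_rep: "rep (g \<otimes> rep h) = rep (g \<otimes> h)" if "g \<in> carrier G" "h \<in> carrier G" for g h
  proof -
    have "g \<otimes> (h \<otimes> inv (rep h)) \<otimes> inv g \<in> P" using P.inv_op_closed2 that diff by simp
    then have "rep (g \<otimes> (h \<otimes> inv (rep h)) \<otimes> inv g \<otimes> (g \<otimes> rep h)) = rep (g \<otimes> rep h)"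
      using rep_mult that by simp
    then show ?thesis using that by (simp add: m_assoc)
  qed
  have RG: "r \<in> carrier G" if "r \<in> R" for r using that by (auto simp: R_def)
  have rep_R: "rep r = r" if "r \<in> R" for r
    using that rep_rep[of \<one>] by (auto simp: R_def)
  have finR: "finite R" using fin by (simp add: R_def)
  have cardR: "card R = m"
  proof -
    have "bij_betw (\<lambda>g. P #> g) R (rcosets P)"
    proof (rule bij_betwI')
      fix r s assume "r \<in> R" "s \<in> R"
      then show "(P #> r = P #> s) = (r = s)" using rep_R by (metis rep_def)
    next
      fix X assume "X \<in> rcosets P"
      then obtain g where "g \<in> carrier G" "X = P #> g" by (auto simp: RCOSETS_def)
      then show "\<exists>r\<in>R. X = P #> r" using coset_rep by (auto simp: R_def)
    qed (use RG rcosetsI P.subset in auto)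
    then have "card R = card (rcosets P)" by (rule bij_betw_same_card)
    then show ?thesis using lagrange[OF P.subgroup_axioms] ord cP
      by (metis mult.commute mult_cancel1 not_gr_zero)
  qed
  have bij: "bij_betw (\<lambda>r. rep (h \<otimes> r)) R R" if h: "h \<in> carrier G" for h
  proof (rule bij_betwI[where g = "\<lambda>r. rep (inv h \<otimes> r)"])
    show "rep (inv h \<otimes> rep (h \<otimes> r)) = r" if "r \<in> R" for r
      using rep_rep[of "inv h" "h \<otimes> r"] h RG[OF that] rep_R[OF that] by simp
    show "rep (h \<otimes> rep (inv h \<otimes> r)) = r" if "r \<in> R" for r
      using rep_rep[of h "inv h \<otimes> r"] h RG[OF that] rep_R[OF that] by simp
  qed (use h RG in \<open>auto simp: R_def\<close>)
  define t where "t g r = g \<otimes> r \<otimes> inv (rep (g \<otimes> r))" for g r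
  define d where "d g = finprod ?A (t g) R" for g
  have tP: "t g r \<in> P" if "g \<in> carrier G" "r \<in> carrier G" for g r
    using diff[of "g \<otimes> r"] that by (simp add: t_def)
  have dP: "d g \<in> P" if "g \<in> carrier G" for g
    using A.finprod_closed[of "t g" R] tP[OF that] RG by (auto simp: d_def)
  have d_mult: "d (g \<otimes> h) = (g \<otimes> d h \<otimes> inv g) \<otimes> d g" if g: "g \<in> carrier G"
    and h: "h \<in> carrier G" for g h
  proof -
    \<comment> \<open>Telescoping through the intermediate representative
      \<open>rep (h \<otimes> r)\<close>. In the product over \<open>R\<close> the second factor
      runs through all of \<open>d g\<close>, because \<open>r\<close> to
      \<open>rep (h \<otimes> r)\<close> permutes \<open>R\<close>.\<close>
    have "t (g \<otimes> h) r = (g \<otimes> t h r \<otimes> inv g) \<otimes> t g (rep (h \<otimes> r))" if "r \<in> R" for r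
      using g h RG[OF that] rep_rep[OF g, of "h \<otimes> r"] by (simp add: t_def m_assoc)
    then have "d (g \<otimes> h) = finprod ?A (\<lambda>r. (g \<otimes> t h r \<otimes> inv g) \<otimes> t g (rep (h \<otimes> r))) R"
      unfolding d_def using g h RG tP P.inv_op_closed2 by (intro A.finprod_cong') auto
    also have "\<dots> = finprod ?A (\<lambda>r. g \<otimes> t h r \<otimes> inv g) R \<otimes> finprod ?A (\<lambda>r. t g (rep (h \<otimes> r))) R"
      using A.finprod_multf[of "\<lambda>r. g \<otimes> t h r \<otimes> inv g" R
        "\<lambda>r. t g (rep (h \<otimes> r))"] g h RG tP P.inv_op_closed2
      by auto
    also have "finprod ?A (\<lambda>r. g \<otimes> t h r \<otimes> inv g) R = g \<otimes> d h \<otimes> inv g"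
      unfolding d_def
    proof (rule A.finprod_endo[symmetric, where c = "\<lambda>x. g \<otimes> x \<otimes> inv g"])
      show "(\<lambda>x. g \<otimes> x \<otimes> inv g) \<in> hom ?A ?A"
        using g P.inv_op_closed2 P.mem_carrier by (auto simp: hom_def m_assoc)
    qed (use g h RG tP in auto)
    also have "finprod ?A (\<lambda>r. t g (rep (h \<otimes> r))) R = d g"
      unfolding d_def using A.finprod_reindex[of "t g" "\<lambda>r. rep (h \<otimes> r)" R] bij[OF h] tP[OF g] RG
      by (auto simp: bij_betw_def)
    finally show ?thesis .
  qed
  have d_P: "d x = x [^] m" if x: "x \<in> P" for x
  proof -
    have "t x r = x" if "r \<in> R" for r
      using x RG[OF that] rep_mult[OF x RG[OF that]] rep_R[OF that] P.mem_carrier[OF x]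
      by (simp add: t_def m_assoc)
    then have "d x = finprod ?A (\<lambda>_. x) R" unfolding d_def using x by (intro A.finprod_cong') auto
    then show ?thesis using A.finprod_const[of x R] x cardR
      by (simp add: nat_pow_consistent[symmetric])
  qed
  define K where "K = {g \<in> carrier G. d g = \<one>}"
  have K: "subgroup K G"
  proof (rule subgroupI)
    have "\<one> \<in> K" using d_P[OF P.one_closed] by (simp add: K_def)
    then show "K \<noteq> {}" by auto
    show "inv a \<in> K" if "a \<in> K" for a
    proof -
      have a: "a \<in> carrier G" "d a = \<one>" using that by (auto simp: K_def)
      have "d (inv a \<otimes> a) = \<one>" using a d_P[OF P.one_closed] by simp
      moreover have "inv a \<otimes> \<one> \<otimes> inv (inv a) = \<one>" using a by simp
      ultimately have "\<one> \<otimes> d (inv a) = \<one>" using d_mult[of "inv a" a] a by (metis inv_closed)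
      then show ?thesis using a dP[of "inv a"] P.mem_carrier by (simp add: K_def)
    qed
    show "a \<otimes> b \<in> K" if "a \<in> K" "b \<in> K" for a b
      using d_mult[of a b] that by (simp add: K_def)
  qed (auto simp: K_def)
  have PK: "P \<inter> K = {\<one>}"
  proof -
    have "x = \<one>" if "x \<in> P \<inter> K" for x
    proof -
      have x: "x \<in> P" "x \<in> carrier G" "d x = \<one>" using that by (auto simp: K_def)
      have "x [^] m = \<one>" using d_P[OF x(1)] x(3) by simp
      with pow_coprime_eq_one[OF x(2) subgroup_pow_card[OF P.subgroup_axioms finP x(1)]] cop
      show ?thesis by blast
    qed
    then show ?thesis using subgroup.one_closed[OF K] P.one_closed by blast
  qed
  have G: "carrier G = P <#> K"
  proof
    show "carrier G \<subseteq> P <#> K"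
    proof
      fix g assume g: "g \<in> carrier G"
      obtain k where k: "[m * k = 1] (mod card P)"
        using cong_solve_coprime_nat[of m "card P"] cop by (auto simp: coprime_commute)
      \<comment> \<open>Since k inverts m modulo the order of \<open>P\<close>, the value
        \<open>d x = x [^] m\<close> is the inverse of \<open>d g\<close>. As \<open>P\<close> is
        abelian, \<open>d (x \<otimes> g) = d x \<otimes> d g\<close>, so \<open>x\<close> moves
        \<open>g\<close> into \<open>K\<close>.\<close>
      define x where "x = inv (d g) [^] k"
      have dg: "d g \<in> P" "inv (d g) \<in> P" using dP[OF g] by auto
      have x: "x \<in> P" unfolding x_def using A.nat_pow_closed[of "inv (d g)" k] dg
        by (simp add: nat_pow_consistent[symmetric])
      have "ord (inv (d g)) dvd card P"
        using subgroup_pow_card[OF P.subgroup_axioms finP dg(2)] pow_eq_id dg P.mem_carrier by blast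
      then have "[k * m = 1] (mod ord (inv (d g)))" using k
        by (metis cong_dvd_modulus_nat mult.commute)
      then have "int (ord (inv (d g))) dvd 1 - int (k * m)"
        by (metis cong_iff_dvd_diff cong_int_iff cong_sym of_nat_1)
      then have "inv (d g) [^] int (k * m) = inv (d g) [^] (1 :: int)"
        using int_pow_eq[of "inv (d g)"] dg(2) P.mem_carrier by blast
      then have "inv (d g) [^] (k * m) = inv (d g)"
        using dg(2) P.mem_carrier by (simp add: int_pow_int del: of_nat_mult)
      then have "x [^] m = inv (d g)"
        using dg(2) P.mem_carrier by (simp add: x_def nat_pow_pow)
      moreover have "d (x \<otimes> g) = d x \<otimes> d g"
        using d_mult[of x g] g x dg P.mem_carrier comm[of x "d g"] comm[of "d x" "d g"] dP[of x]
        by (simp add: m_assoc)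
      ultimately have "x \<otimes> g \<in> K"
        using d_P[OF x] x g dg P.mem_carrier by (simp add: K_def)
      then have "inv x \<otimes> (x \<otimes> g) \<in> P <#> K" using x by (auto simp: set_mult_def)
      then show "g \<in> P <#> K" using x g P.mem_carrier by simp
    qed
    show "P <#> K \<subseteq> carrier G"
      using setmult_subset_G[OF P.subset subgroup.subset[OF K]] .
  qed
  have "card P * card K = order G"
    using card_set_mult_trivial_Int[OF P.subgroup_axioms K] PK G by (simp add: order_def)
  then have "card K = m" using ord cP by simp
  then show ?thesis using that K PK G by blast
qed

section \<open>Normal subgroups and quotients of solvable groups\<close>

lemma (in group) conj_nat_pow:
  assumes "g \<in> carrier G" "x \<in> carrier G"
  shows "(g \<otimes> x \<otimes> inv g) [^] (k::nat) = g \<otimes> x [^] k \<otimes> inv g"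
  using assms by (induction k) (simp_all add: m_assoc)

text \<open>Conjugation commutes with powers. That the torsion elements form a subgroup is assumed,
  because in nonabelian \<open>M\<close> it has to be established case by case.\<close>

lemma (in group) normal_torsion:
  assumes M: "M \<lhd> G" and S: "subgroup {x \<in> M. x [^] (k::nat) = \<one>} G"
  shows "{x \<in> M. x [^] k = \<one>} \<lhd> G"
proof (rule normal_invI[OF S])
  fix x h assume x: "x \<in> carrier G" "h \<in> {x \<in> M. x [^] k = \<one>}"
  then have "h \<in> M" "h [^] k = \<one>" "h \<in> carrier G"
    using subgroup.mem_carrier[OF normal_imp_subgroup[OF M]] by auto
  then show "x \<otimes> h \<otimes> inv x \<in> {x \<in> M. x [^] k = \<one>}"
    using x(1) normal.inv_op_closed2[OF M] by (simp add: conj_nat_pow)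
qed

lemma (in group) centralizer_normal:
  assumes "N \<lhd> G"
  shows "centralizer N \<lhd> G"
proof (rule normal_invI)
  have NG: "N \<subseteq> carrier G" using subgroup.subset[OF normal_imp_subgroup[OF assms]] .
  then show "subgroup (centralizer N) G" by (rule centralizer_subgroup)
  fix x h assume x: "x \<in> carrier G" and h: "h \<in> centralizer N"
  have hG: "h \<in> carrier G" using h by (simp add: centralizer_def)
  have "x \<otimes> h \<otimes> inv x \<otimes> s = s \<otimes> (x \<otimes> h \<otimes> inv x)" if s: "s \<in> N" for s
  proof -
    have sG: "s \<in> carrier G" using s NG by blast
    have "inv x \<otimes> s \<otimes> x \<in> N" using normal.inv_op_closed1[OF assms x s] .
    then have "h \<otimes> (inv x \<otimes> s \<otimes> x) = inv x \<otimes> s \<otimes> x \<otimes> h" using h by (simp add: centralizer_def)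
    then have "x \<otimes> (h \<otimes> (inv x \<otimes> s \<otimes> x)) \<otimes> inv x = x \<otimes> (inv x \<otimes> s \<otimes> x \<otimes> h) \<otimes> inv x" by simp
    then show ?thesis using x hG sG by (simp add: m_assoc)
  qed
  then show "x \<otimes> h \<otimes> inv x \<in> centralizer N" using x hG by (auto simp: centralizer_def)
qed

text \<open>\<open>M\<close> is the direct product of \<open>N\<close> and \<open>P\<close>, which
  have coprime orders, so \<open>P\<close> consists of the elements of \<open>M\<close> killed by
  its own order. This description is invariant under conjugation.\<close>

lemma (in group) normal_of_centralizing:
  assumes fin: "finite (carrier G)" and M: "M \<lhd> G" and N: "subgroup N G" "N \<subseteq> M"
    and P: "subgroup P G" "P \<subseteq> M"
    and card: "card M = card N * card P" and cop: "coprime (card N) (card P)"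
      and PN: "P \<subseteq> centralizer N"
  shows "P \<lhd> G"
proof -
  have MG: "subgroup M G" using M by (rule normal_imp_subgroup)
  have finM: "finite M" using fin subgroup.subset[OF MG] finite_subset by blast
  have fNP: "finite N" "finite P" using finM N(2) P(2) finite_subset by auto
  have "N \<inter> P = {\<one>}" using subgroups_coprime_Int[OF N(1) P(1) fin cop] .
  then have "card (N <#> P) = card M" using card_set_mult_trivial_Int N(1) P(1) card by simp
  moreover have "N <#> P \<subseteq> M"
    using N(2) P(2) subgroup.m_closed[OF MG] by (auto simp: set_mult_def)
  ultimately have NP: "N <#> P = M" using card_subset_eq[OF finM] by blast
  have "P = {x \<in> M. x [^] card P = \<one>}"
  proof
    show "P \<subseteq> {x \<in> M. x [^] card P = \<one>}" using P fNP subgroup_pow_card[OF P(1)] by auto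
    show "{x \<in> M. x [^] card P = \<one>} \<subseteq> P"
    proof
      fix x assume x: "x \<in> {x \<in> M. x [^] card P = \<one>}"
      then obtain n y where ny: "n \<in> N" "y \<in> P" "x = n \<otimes> y" using NP by (auto simp: set_mult_def)
      have c: "n \<in> carrier G" "y \<in> carrier G" "n \<otimes> y = y \<otimes> n"
        using ny PN subgroup.mem_carrier[OF N(1)] by (auto simp: centralizer_def)
      have "x [^] card P = n [^] card P \<otimes> y [^] card P"
        using c ny(3) pow_mult_distrib by simp
      then have "n [^] card P = \<one>" using x subgroup_pow_card[OF P(1) fNP(2) ny(2)] c by simp
      then have "n = \<one>"
        using pow_coprime_eq_one[OF c(1) subgroup_pow_card[OF N(1) fNP(1) ny(1)]] cop by blast
      then show "x \<in> P" using ny c by simp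
    qed
  qed
  then show ?thesis using normal_torsion[OF M, of "card P"] P(1) by simp
qed

text \<open>The last nontrivial term of the derived series is an abelian normal subgroup; for a
  prime q dividing its order, \<open>N\<close> consists of its elements killed by q.\<close>

lemma (in group) solvable_normal_prime_power:
  assumes fin: "finite (carrier G)" and sol: "solvable G" and nt: "carrier G \<noteq> {\<one>}"
  obtains N q j where "N \<lhd> G" "prime q" "card N = q ^ j" "j > 0"
proof -
  define D where "D k = (derived G ^^ k) (carrier G)" for k
  have norm: "D k \<lhd> G" for k
    by (induction k) (auto simp: D_def normal_self derived_is_normal)
  have "\<exists>n. D n = {\<one>}" using sol solvable_iff_trivial_derived_seq by (simp add: D_def)
  then obtain n where n: "D n = {\<one>}" "\<And>m. m < n \<Longrightarrow> D m \<noteq> {\<one>}"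
    unfolding exists_least_iff[of "\<lambda>n. D n = {\<one>}"] by blast
  have "D 0 = carrier G" by (simp add: D_def)
  then have "n \<noteq> 0" using n(1) nt by metis
  then obtain m where m: "n = Suc m" by (cases n) auto
  define A where "A = D m"
  have A: "A \<lhd> G" "A \<noteq> {\<one>}" using norm n(2) m by (auto simp: A_def)
  have AG: "subgroup A G" using A(1) by (rule normal_imp_subgroup)
  have dA: "derived G A = {\<one>}" using n(1) m by (simp add: A_def D_def)
  have comm: "x \<otimes> y = y \<otimes> x" if "x \<in> A" "y \<in> A" for x y
  proof -
    have c: "x \<in> carrier G" "y \<in> carrier G" using that subgroup.mem_carrier[OF AG] by auto
    have "x \<otimes> y \<otimes> inv x \<otimes> inv y \<in> derived_set G A" using that by blast
    then have "x \<otimes> y \<otimes> inv x \<otimes> inv y \<in> derived G A" unfolding derived_def by (rule generate.incl)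
    then have "x \<otimes> y \<otimes> inv x \<otimes> inv y = \<one>" using dA by simp
    then have "x \<otimes> y \<otimes> inv x \<otimes> inv y \<otimes> (y \<otimes> x) = y \<otimes> x" using c by simp
    then show ?thesis using c by (simp add: m_assoc)
  qed
  let ?A = "G\<lparr>carrier := A\<rparr>"
  interpret A: group ?A using AG by (rule subgroup_imp_group)
  interpret A: comm_group ?A by (rule A.group_comm_groupI) (use comm in auto)
  have finA: "finite A" using fin subgroup.subset[OF AG] finite_subset by blast
  have "card A \<noteq> 1" using A(2) subgroup.one_closed[OF AG] by (metis card_1_singletonE singletonD)
  then obtain q where q: "prime q" "q dvd card A" using prime_factor_nat by blast
  define N where "N = {x \<in> A. x [^] q = \<one>}"
  have N': "N = {a \<in> carrier ?A. a [^]\<^bsub>?A\<^esub> (q ^ 1) = \<one>\<^bsub>?A\<^esub>}"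
    by (simp add: N_def nat_pow_consistent[symmetric])
  have "subgroup N ?A" unfolding N' by (rule A.subgroup_pow_eq_one)
  then have NG: "subgroup N G" using incl_subgroup[OF AG] by blast
  then have "N \<lhd> G" using normal_torsion[OF A(1)] by (simp add: N_def)
  obtain j where j: "card N = q ^ j" unfolding N' using A.card_torsion[of q 1] finA q(1) by auto
  obtain x where "x \<in> carrier ?A" "x \<noteq> \<one>\<^bsub>?A\<^esub>" "x [^]\<^bsub>?A\<^esub> q = \<one>\<^bsub>?A\<^esub>"
    using A.cauchy[of q] finA q by (auto simp: order_def)
  then have x: "x \<in> N" "x \<noteq> \<one>" by (auto simp: N_def nat_pow_consistent[symmetric])
  have "j \<noteq> 0"
  proof
    assume "j = 0"
    then obtain c where "N = {c}" using j by (metis card_1_singletonE power_0)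
    then show False using x subgroup.one_closed[OF NG] by auto
  qed
  then show ?thesis using that[OF \<open>N \<lhd> G\<close> q(1) j] by simp
qed

text \<open>The quotient by \<open>N\<close> is transported from cosets to natural numbers, so that
  it belongs to the same family of groups and an induction over that family can be applied to
  it.\<close>

lemma (in group) solvable_quotient:
  assumes fin: "finite (carrier G)" and sol: "solvable G" and N: "N \<lhd> G"
  obtains H \<pi> where "H \<in> solvable_groups_of_order (order G div card N)" "group_hom G H \<pi>"
    "\<pi> ` carrier G = carrier H" "kernel G H \<pi> = N"
proof -
  interpret N: normal N G by fact
  let ?Q = "G Mod N"
  have Q: "group ?Q" by (rule N.factorgroup_is_group)
  have h: "(\<lambda>x. N #> x) \<in> hom G ?Q" by (rule N.r_coset_hom_Mod)
  have gh: "group_hom G ?Q (\<lambda>x. N #> x)"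
    using h Q by (simp add: group_hom_def group_hom_axioms_def)
  have surj: "(\<lambda>x. N #> x) ` carrier G = carrier ?Q" by (simp add: carrier_FactGroup)
  have "solvable ?Q" using group_hom.surj_hom_imp_solvable[OF gh surj sol] .
  moreover have finQ: "finite (carrier ?Q)" using surj fin by (metis finite_imageI)
  moreover have "order ?Q = order G div card N"
  proof -
    have "order ?Q * card N = order G"
      using lagrange[OF N.subgroup_axioms] by (simp add: FactGroup_def order_def)
    then show ?thesis using N.finite_imp_card_positive[OF fin]
      by (metis nonzero_mult_div_cancel_right not_gr_zero)
  qed
  ultimately obtain H where H: "H \<in> solvable_groups_of_order (order G div card N)" "?Q \<cong> H"
    using solvable_group_of_order_iso[OF Q finQ] by blast
  then obtain f where f: "f \<in> iso ?Q H" by (auto simp: is_iso_def)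
  have Hg: "group H" using H(1) by (simp add: solvable_groups_of_order_def)
  have fb: "bij_betw f (carrier ?Q) (carrier H)" "f \<in> hom ?Q H" using f by (auto simp: iso_def)
  define \<pi> where "\<pi> = f \<circ> (\<lambda>x. N #> x)"
  have "\<pi> \<in> hom G H" unfolding \<pi>_def using Group.hom_compose[OF h fb(2)] .
  then have gp: "group_hom G H \<pi>" using Hg by (simp add: group_hom_def group_hom_axioms_def)
  moreover have "\<pi> ` carrier G = carrier H" using surj fb(1) unfolding \<pi>_def
    by (metis bij_betw_def image_comp)
  moreover have "kernel G H \<pi> = N"
  proof -
    have one: "f N = \<one>\<^bsub>H\<^esub>" using hom_one[OF fb(2) Q Hg] by simp
    have NQ: "N \<in> carrier ?Q" using group.is_monoid[OF Q] monoid.one_closed by fastforce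
    have "f (N #> x) = \<one>\<^bsub>H\<^esub> \<longleftrightarrow> x \<in> N" if x: "x \<in> carrier G" for x
    proof -
      have "N #> x \<in> carrier ?Q" using x surj by blast
      then have "f (N #> x) = \<one>\<^bsub>H\<^esub> \<longleftrightarrow> N #> x = N"
        using fb(1) one NQ by (metis bij_betw_def inj_on_def)
      then show ?thesis
        using coset_join1[OF _ x N.subgroup_axioms] coset_join2[OF x N.subgroup_axioms] N.subset
      by blast
    qed
    then show ?thesis using N.subset by (auto simp: kernel_def \<pi>_def)
  qed
  ultimately show ?thesis using that H(1) by blast
qed

lemma (in group_hom) preimage_normal:
  assumes R: "R \<lhd> H"
  shows "{g \<in> carrier G. h g \<in> R} \<lhd> G"
proof (rule G.normal_invI)
  interpret R: normal R H by fact
  show "subgroup {g \<in> carrier G. h g \<in> R} G"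
    by (rule G.subgroupI) (auto intro!: exI[of _ \<one>])
  show "x \<otimes> g \<otimes> inv x \<in> {g \<in> carrier G. h g \<in> R}"
    if "x \<in> carrier G" "g \<in> {g \<in> carrier G. h g \<in> R}" for x g
    using that R.inv_op_closed2 by simp
qed

lemma (in group_hom) card_preimage:
  assumes fin: "finite (carrier G)" and surj: "h ` carrier G = carrier H" and R: "R \<subseteq> carrier H"
  shows "card {g \<in> carrier G. h g \<in> R} = card (kernel G H h) * card R"
proof -
  have finR: "finite R" using fin surj R by (metis finite_imageI finite_subset)
  have fiber: "card {g \<in> carrier G. h g = r} = card (kernel G H h)" if r: "r \<in> R" for r
  proof -
    have "r \<in> h ` carrier G" using subsetD[OF R r] by (simp only: surj)
    then obtain a where a: "a \<in> carrier G" "h a = r" by (metis imageE)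
    have "bij_betw (\<lambda>x. x \<otimes> a) (kernel G H h) {g \<in> carrier G. h g = r}"
    proof (rule bij_betwI[where g = "\<lambda>x. x \<otimes> inv a"])
      show "(\<lambda>x. x \<otimes> a) \<in> kernel G H h \<rightarrow> {g \<in> carrier G. h g = r}"
        using a r R by (auto simp: kernel_def)
      show "(\<lambda>x. x \<otimes> inv a) \<in> {g \<in> carrier G. h g = r} \<rightarrow> kernel G H h"
        using a r R by (auto simp: kernel_def)
    qed (use a in \<open>simp_all add: kernel_def G.m_assoc\<close>)
    then show ?thesis by (rule bij_betw_same_card[symmetric])
  qed
  have "{g \<in> carrier G. h g \<in> R} = (\<Union>r\<in>R. {g \<in> carrier G. h g = r})" by auto
  also have "card \<dots> = (\<Sum>r\<in>R. card {g \<in> carrier G. h g = r})"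
    using fin finR by (intro card_UN_disjoint) auto
  also have "\<dots> = card (kernel G H h) * card R" using fiber by simp
  finally show ?thesis .
qed

section \<open>Normal Sylow subgroups in cube-free order\<close>

text \<open>\<open>P\<close> fixes q^i elements of \<open>N\<close>, and q^i is congruent to q^j
  modulo p. If i < j, then p divides q^(j-i) - 1; as q < p, this leaves only p dividing q + 1, so p
  and q are consecutive primes.\<close>

lemma (in group) centralizes_smaller_prime:
  assumes fin: "finite (carrier G)" and P: "subgroup P G" "card P = p ^ a" "prime p"
    and N: "N \<lhd> G" "card N = q ^ j" "prime q" and "q < p" "j \<le> 2"
  shows "P \<subseteq> centralizer N \<or> q = 2 \<and> p = 3 \<and> j = 2"
proof (rule disjCI, rule ccontr)
  assume not: "\<not> (q = 2 \<and> p = 3 \<and> j = 2)" "\<not> P \<subseteq> centralizer N"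
  let ?C = "N \<inter> centralizer P"
  have NG: "subgroup N G" using N(1) by (rule normal_imp_subgroup)
  have PG: "P \<subseteq> carrier G" using P(1) by (rule subgroup.subset)
  have finN: "finite N" using fin subgroup.subset[OF NG] finite_subset by blast
  have C: "subgroup ?C G" using subgroups_Inter_pair[OF NG centralizer_subgroup[OF PG]] .
  have "\<not> N \<subseteq> centralizer P" using not(2) PG subgroup.subset[OF NG]
    by (fastforce simp: centralizer_def)
  then have "?C \<subset> N" by blast
  then have lt: "card ?C < q ^ j" using psubset_card_mono[OF finN] N(2) by metis
  have "card ?C dvd q ^ j" using card_subgroup_dvd_card[OF C NG] N(2) by auto
  then obtain i where i: "card ?C = q ^ i" using divides_primepow_nat[OF N(3)] by blast
  have q1: "q > 1" using prime_gt_1_nat[OF N(3)] .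
  have "i < j" using lt i q1 by simp
  have "[q ^ i = q ^ j] (mod p)"
    using card_centralizer_cong[OF fin P(1) NG P(3,2)] normal.inv_op_closed2[OF N(1)] PG i N(2)
    by auto
  then have "p dvd q ^ j - q ^ i"
    using \<open>i < j\<close> q1 by (metis cong_altdef_nat cong_sym less_imp_le_nat power_increasing)
  moreover have "q ^ j - q ^ i = q ^ i * (q ^ (j - i) - 1)"
    using \<open>i < j\<close> by (simp add: diff_mult_distrib2 flip: power_add)
  moreover have "coprime p (q ^ i)" using \<open>q < p\<close> N(3) P(3) by (simp add: primes_coprime)
  ultimately have dvd: "p dvd q ^ (j - i) - 1" by (metis coprime_dvd_mult_right_iff)
  have q_1: "\<not> p dvd q - 1" using q1 \<open>q < p\<close> by (intro nat_dvd_not_less) auto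
  have "j - i = 1 \<or> j - i = 2 \<and> j = 2" using \<open>i < j\<close> \<open>j \<le> 2\<close> by linarith
  then show False
  proof
    assume "j - i = 1" then show False using dvd q_1 by simp
  next
    assume ji: "j - i = 2 \<and> j = 2"
    have "q ^ 2 - 1 = (q - 1) * (q + 1)" using q1 by (simp add: algebra_simps power2_eq_square)
    then have "p dvd (q - 1) * (q + 1)" using dvd ji by metis
    then have "p dvd q + 1" using q_1 prime_dvd_multD[OF P(3)] by blast
    then have "p = q + 1" using \<open>q < p\<close> dvd_imp_le[of p "q + 1"] by simp
    then have "q = 2" using N(3) P(3)
      by (metis prime_odd_nat even_plus_one_iff le_neq_implies_less prime_ge_2_nat prime_nat_iff'
        add_less_same_cancel1 nat_neq_iff not_add_less1 less_add_one)
    then show False using not(1) \<open>p = q + 1\<close> ji by simp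
  qed
qed

lemma (in group) index_two_square:
  assumes fin: "finite (carrier G)" and H: "subgroup H G" "order G = 2 * card H"
    and x: "x \<in> carrier G"
  shows "x \<otimes> x \<in> H"
proof (rule ccontr)
  assume n: "x \<otimes> x \<notin> H"
  have cH: "card H > 0" using subgroup.finite_imp_card_positive[OF H(1) fin] .
  have card: "card (rcosets H) = 2" using lagrange[OF H(1)] H(2) cH by simp
  have "x \<notin> H" using n subgroup.m_closed[OF H(1)] by blast
  have eq: "a \<otimes> inv b \<in> H" if "a \<in> carrier G" "b \<in> carrier G" "H #> a = H #> b" for a b
    using that rcos_self[OF that(1) H(1)] subgroup.rcos_module[OF H(1) is_group that(2,1)] by simp
  have "H #> \<one> \<noteq> H #> x"
    using eq[of x \<one>] x \<open>x \<notin> H\<close> by auto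
  moreover have "H #> \<one> \<noteq> H #> (x \<otimes> x)"
    using eq[of "x \<otimes> x" \<one>] x n by auto
  moreover have "H #> x \<noteq> H #> (x \<otimes> x)"
    using eq[of "x \<otimes> x" x] x \<open>x \<notin> H\<close> by (auto simp: m_assoc)
  ultimately have "card {H #> \<one>, H #> x, H #> (x \<otimes> x)} = 3" by simp
  moreover have "{H #> \<one>, H #> x, H #> (x \<otimes> x)} \<subseteq> rcosets H"
    using x rcosetsI[OF subgroup.subset[OF H(1)]] by simp
  moreover have "finite (rcosets H)" using card by (metis card.infinite zero_neq_numeral)
  ultimately show False using card card_mono
    by (metis numeral_le_iff semiring_norm(69) semiring_norm(72) numeral_3_eq_3 numeral_2_eq_2
      Suc_n_not_le_n)
qed

text \<open>A nontrivial element of \<open>N\<close> has at most two conjugates, and its stabilizer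
  is the centralizer of \<open>N\<close>, which therefore is a normal subgroup of order 18. A
  subgroup \<open>S\<close> of order 9 in it has index 2 there and contains all of its elements
  killed by 9, which makes \<open>S\<close> normal in \<open>G\<close>.\<close>

lemma (in group) normal_sylow_3_of_order_36:
  assumes fin: "finite (carrier G)" and N: "N \<lhd> G" "card N = 3" and ord: "order G = 36"
    and T: "T \<subseteq> carrier G" "\<not> T \<subseteq> centralizer N"
  obtains S where "S \<lhd> G" "card S = 9"
proof -
  have NG: "subgroup N G" using N(1) by (rule normal_imp_subgroup)
  have NC: "N \<subseteq> carrier G" using subgroup.subset[OF NG] .
  have finN: "finite N" using N(2) by (metis card.infinite zero_neq_numeral)
  obtain g x where gx: "g \<in> T" "x \<in> N" "g \<otimes> x \<noteq> x \<otimes> g" using T by (auto simp: centralizer_def)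
  have gG: "g \<in> carrier G" and xG: "x \<in> carrier G" using gx T NC by auto
  have x1: "x \<noteq> \<one>" using gx gG by auto
  interpret A: group_action "G\<lparr>carrier := carrier G\<rparr>" N "\<lambda>g. \<lambda>x\<in>N. g \<otimes> x \<otimes> inv g"
    using subgroup_conj_action[OF subgroup_self NG] normal.inv_op_closed2[OF N(1)] by blast
  let ?C = "centralizer N"
  have CG: "subgroup ?C G" using centralizer_subgroup[OF NC] .
  have Cn: "?C \<lhd> G" using centralizer_normal[OF N(1)] .
  \<comment> \<open>\<open>N\<close> has prime order, so it is generated by x, and an element
    commuting with x centralizes \<open>N\<close>.\<close>
  have gen: "subgroup K G \<Longrightarrow> x \<in> K \<Longrightarrow> N \<subseteq> K" for K
  proof -
    assume K: "subgroup K G" "x \<in> K"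
    have NK: "subgroup (N \<inter> K) G" using subgroups_Inter_pair[OF NG K(1)] .
    then have "card (N \<inter> K) dvd 3" using card_subgroup_dvd_card[OF NK NG] N(2) by auto
    moreover have "card (N \<inter> K) \<noteq> 1"
      using K(2) gx(2) x1 subgroup.one_closed[OF NK] by (metis IntI card_1_singletonE singletonD)
    ultimately have "card (N \<inter> K) = 3" using prime_nat_iff[of 3] by auto
    then have "N \<inter> K = N" using N(2) finN by (intro card_subset_eq) auto
    then show "N \<subseteq> K" by blast
  qed
  have stab: "stabilizer (G\<lparr>carrier := carrier G\<rparr>) (\<lambda>g. \<lambda>x\<in>N. g \<otimes> x \<otimes> inv g) x = ?C"
  proof
    show "?C \<subseteq> stabilizer (G\<lparr>carrier := carrier G\<rparr>) (\<lambda>g. \<lambda>x\<in>N. g \<otimes> x \<otimes> inv g) x"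
      using gx(2) xG by (auto simp: stabilizer_def centralizer_def conj_eq_iff_commute)
    show "stabilizer (G\<lparr>carrier := carrier G\<rparr>) (\<lambda>g. \<lambda>x\<in>N. g \<otimes> x \<otimes> inv g) x \<subseteq> ?C"
    proof
      fix h assume "h \<in> stabilizer (G\<lparr>carrier := carrier G\<rparr>) (\<lambda>g. \<lambda>x\<in>N. g \<otimes> x \<otimes> inv g) x"
      then have h: "h \<in> carrier G" "h \<otimes> x = x \<otimes> h"
        using gx(2) xG by (auto simp: stabilizer_def conj_eq_iff_commute)
      then have "N \<subseteq> centralizer {h}" using xG
        by (intro gen centralizer_subgroup) (auto simp: centralizer_def)
      then show "h \<in> ?C" using h(1) by (auto simp: centralizer_def)
    qed
  qed
  let ?O = "orbit (G\<lparr>carrier := carrier G\<rparr>) (\<lambda>g. \<lambda>x\<in>N. g \<otimes> x \<otimes> inv g) x"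
  have arith: "k = 18" if "c \<le> 2" "c * k = 36" "k \<noteq> 36" for c k :: nat
  proof -
    consider "c = 0" | "c = 1" | "c = 2" using \<open>c \<le> 2\<close> by linarith
    then show ?thesis using that by cases auto
  qed
  have "?O \<subseteq> N - {\<one>}"
  proof
    fix y assume "y \<in> ?O"
    then obtain h where h: "h \<in> carrier G" "y = h \<otimes> x \<otimes> inv h" using gx(2) by (auto simp: orbit_def)
    have "y \<noteq> \<one>" using conj_eq_iff_commute[OF h(1) xG one_closed] h x1 xG by simp
    moreover have "y \<in> N" using normal.inv_op_closed2[OF N(1) h(1) gx(2)] h(2) by simp
    ultimately show "y \<in> N - {\<one>}" by simp
  qed
  then have "card ?O \<le> 2" using card_mono[of "N - {\<one>}" ?O] finN N(2) subgroup.one_closed[OF NG]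
    by simp
  moreover have "card ?O * card ?C = 36"
    using A.orbit_stabilizer_theorem[OF gx(2)] stab ord by (simp add: order_def)
  moreover have "card ?C \<noteq> 36"
  proof
    assume "card ?C = 36"
    then have "?C = carrier G" using ord fin subgroup.subset[OF CG]
      by (intro card_subset_eq) (auto simp: order_def)
    then show False using T by blast
  qed
  ultimately have C18: "card ?C = 18"
    by (rule arith)
  interpret C: group "G\<lparr>carrier := ?C\<rparr>" using CG by (rule subgroup_imp_group)
  have finC: "finite (carrier (G\<lparr>carrier := ?C\<rparr>))" using C18 by (auto intro: card_ge_0_finite)
  have "order (G\<lparr>carrier := ?C\<rparr>) = 3 ^ 2 * 2" using C18 by (simp add: order_def)
  then obtain S where S: "subgroup S (G\<lparr>carrier := ?C\<rparr>)" "card S = 3 ^ 2"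
    using sylow_thm[OF _ C.is_group _ finC, of 3 2 2] by auto
  have SG: "subgroup S G" using incl_subgroup[OF CG S(1)] .
  have SC: "S \<subseteq> ?C" using subgroup.subset[OF S(1)] by simp
  have finS: "finite S" using S(2) by (auto intro: card_ge_0_finite)
  have "S = {y \<in> ?C. y [^] (9::nat) = \<one>}"
  proof
    show "S \<subseteq> {y \<in> ?C. y [^] (9::nat) = \<one>}"
      using SC subgroup_pow_card[OF SG finS] S(2) by auto
    show "{y \<in> ?C. y [^] (9::nat) = \<one>} \<subseteq> S"
    proof
      fix y assume "y \<in> {y \<in> ?C. y [^] (9::nat) = \<one>}"
      then have y: "y \<in> ?C" "y [^] (9::nat) = \<one>" "y \<in> carrier G" by (auto simp: centralizer_def)
      have "y \<otimes> y \<in> S"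
        using C.index_two_square[OF finC S(1)] S(2) C18 y(1) by (simp add: order_def)
      then have "(y \<otimes> y) [^] (5::nat) \<in> S"
        using subgroup_int_pow_closed[OF SG, of "y \<otimes> y" 5] int_pow_int[of G "y \<otimes> y" 5] by simp
      \<comment> \<open>Since y^9 is the unit, y equals y^10, a power of the square of y, and
        squares lie in a subgroup of index 2.\<close>
      moreover have "(y \<otimes> y) [^] (5::nat) = y [^] (9::nat) \<otimes> y"
        using y(3) by (simp add: numeral_eq_Suc m_assoc)
      ultimately show "y \<in> S" using y by simp
    qed
  qed
  then have "S \<lhd> G" using normal_torsion[OF Cn, of 9] SG by simp
  then show ?thesis using that S(2) by simp
qed

lemma cube_freeD: "cube_free n \<Longrightarrow> prime p \<Longrightarrow> \<not> p ^ 3 dvd n"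
  by (simp add: cube_free_def)

text \<open>A normal q-subgroup \<open>N\<close> is factored out. Let \<open>M\<close> be the
  preimage of a normal Sylow p-subgroup of the quotient. If q = p, then \<open>M\<close> is the
  required subgroup; otherwise a Sylow p-subgroup of \<open>M\<close> centralizes \<open>N\<close>
  and is therefore normal in \<open>G\<close>, except when q = 2, p = 3 and \<open>N\<close> has
  order 4. The alternative records \<open>4 dvd n\<close> because this later pins down n.\<close>

lemma normal_sylow_largest_prime:
  fixes G :: "nat monoid"
  assumes "G \<in> solvable_groups_of_order n" "cube_free n" "prime p" "p dvd n"
    and "\<And>q. prime q \<Longrightarrow> q dvd n \<Longrightarrow> q \<le> p"
  shows "(\<exists>P. P \<lhd> G \<and> card P = p ^ multiplicity p n) \<or> p = 3 \<and> 4 dvd n \<and> (\<exists>P. P \<lhd> G \<and> card P = 4)"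
  using assms
proof (induction n arbitrary: G rule: less_induct)
  case (less n)
  have G: "group G" "finite (carrier G)" "order G = n" "solvable G"
    using less.prems(1) by (auto simp: solvable_groups_of_order_def)
  interpret group G by fact
  have n0: "n > 0" using G(2,3) order_gt_0_iff_finite by simp
  have p1: "p > 1" using prime_gt_1_nat[OF less.prems(3)] .
  have "carrier G \<noteq> {\<one>\<^bsub>G\<^esub>}"
  proof
    assume "carrier G = {\<one>\<^bsub>G\<^esub>}"
    then have "n = 1" using G(3) by (simp add: order_def)
    then show False using less.prems(4) p1 by simp
  qed
  then obtain N q j where N: "N \<lhd> G" "prime q" "card N = q ^ j" "j > 0"
    using solvable_normal_prime_power[OF G(2,4)] by blast
  have NG: "subgroup N G" using N(1) by (rule normal_imp_subgroup)
  have dvd: "q ^ j dvd n" using card_subgroup_dvd[OF NG] N(3) G(3) by simp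
  then have qn: "q dvd n" using N(4) by (meson dvd_power dvd_trans)
  have qp: "q \<le> p" using less.prems(5) N(2) qn by blast
  have "j \<le> multiplicity q n" using dvd n0 N(2) by (intro multiplicity_geI) auto
  then have j2: "j \<le> 2" using cube_free_multiplicity_le[OF less.prems(2) n0 N(2)] by simp
  obtain H \<pi> where H: "H \<in> solvable_groups_of_order (n div card N)" "group_hom G H \<pi>"
    "\<pi> ` carrier G = carrier H" "kernel G H \<pi> = N"
    using solvable_quotient[OF G(2,4) N(1)] G(3) by metis
  interpret \<pi>: group_hom G H \<pi> by fact
  define m where "m = n div card N"
  have nm: "n = q ^ j * m" using dvd N(3) by (simp add: m_def)
  have m0: "m > 0" using n0 nm by simp
  have q1: "q ^ j > 1" using one_less_power[of q j] N(4) prime_gt_1_nat[OF N(2)] by blast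
  then have mn: "m < n" using nm m0 by simp
  have pre: "{g \<in> carrier G. \<pi> g \<in> R} \<lhd> G" "card {g \<in> carrier G. \<pi> g \<in> R} = q ^ j * card R"
    "N \<subseteq> {g \<in> carrier G. \<pi> g \<in> R}" if "R \<lhd> H" for R
  proof -
    interpret R: normal R H by fact
    show "{g \<in> carrier G. \<pi> g \<in> R} \<lhd> G" using \<pi>.preimage_normal[OF that] .
    show "card {g \<in> carrier G. \<pi> g \<in> R} = q ^ j * card R"
      using \<pi>.card_preimage[OF G(2) H(3) R.subset] H(4) N(3) by simp
    show "N \<subseteq> {g \<in> carrier G. \<pi> g \<in> R}"
      unfolding H(4)[symmetric] by (auto simp: kernel_def)
  qed
  have mult_n: "multiplicity p n = multiplicity p (q ^ j) + multiplicity p m"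
    using m0 N(2) less.prems(3) unfolding nm by (intro prime_elem_multiplicity_mult_distrib) auto
  show ?case
  proof (cases "p dvd m")
    case False
    \<comment> \<open>The whole p-part of n sits in \<open>N\<close>, so \<open>N\<close> is itself
      a Sylow p-subgroup.\<close>
    then have "p dvd q ^ j" using less.prems(3,4) nm by (simp add: prime_dvd_mult_iff)
    then have "p = q" using less.prems(3) N(2) by (meson prime_dvd_power primes_dvd_imp_eq)
    then have "multiplicity p n = j"
      using mult_n False less.prems(3) by (simp add: not_dvd_imp_multiplicity_0)
    then show ?thesis using N \<open>p = q\<close> by auto
  next
    case True
    have "(\<exists>R. R \<lhd> H \<and> card R = p ^ multiplicity p m) \<or> p = 3 \<and> 4 dvd m \<and> (\<exists>R. R \<lhd> H \<and> card R = 4)"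
    proof (rule less.IH[OF mn])
      show "H \<in> solvable_groups_of_order m" using H(1) by (simp add: m_def)
      show "cube_free m" using cube_free_dvd[OF less.prems(2)] nm by simp
      show "r \<le> p" if "prime r" "r dvd m" for r using less.prems(5)[of r] that nm by simp
    qed (use less.prems True in auto)
    then show ?thesis
    proof
      assume "\<exists>R. R \<lhd> H \<and> card R = p ^ multiplicity p m"
      then obtain R where R: "R \<lhd> H" "card R = p ^ multiplicity p m" by blast
      let ?M = "{g \<in> carrier G. \<pi> g \<in> R}"
      show ?thesis
      proof (cases "q = p")
        case True
        then have "card ?M = p ^ multiplicity p n"
          using pre(2)[OF R(1)] R(2) mult_n less.prems(3) by (simp add: power_add)
        then show ?thesis using pre(1)[OF R(1)] by blast
      next
        case False
        then have "q < p" using qp by simp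
        have pq: "\<not> p dvd q ^ j"
          using False prime_dvd_power[OF less.prems(3)] primes_dvd_imp_eq[OF less.prems(3) N(2)]
          by blast
        then have mpn: "multiplicity p n = multiplicity p m"
          using mult_n by (simp add: not_dvd_imp_multiplicity_0)
        have MG: "subgroup ?M G" using pre(1)[OF R(1)] by (rule normal_imp_subgroup)
        interpret M: group "G\<lparr>carrier := ?M\<rparr>" using MG by (rule subgroup_imp_group)
        have "order (G\<lparr>carrier := ?M\<rparr>) = p ^ multiplicity p m * q ^ j"
          using pre(2)[OF R(1)] R(2) by (simp add: order_def)
        then obtain P where P: "subgroup P (G\<lparr>carrier := ?M\<rparr>)" "card P = p ^ multiplicity p m"
          using sylow_thm[OF less.prems(3) M.is_group] G(2) by auto
        have PG: "subgroup P G" "P \<subseteq> ?M"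
          using incl_subgroup[OF MG P(1)] subgroup.subset[OF P(1)] by auto
        show ?thesis
        proof (cases "P \<subseteq> centralizer N")
          case True
          have "coprime (card N) (card P)" using N(2,3) P(2) less.prems(3) False
            by (simp add: primes_coprime)
          then have "P \<lhd> G"
            using normal_of_centralizing[OF G(2) pre(1)[OF R(1)] NG pre(3)[OF R(1)] PG] pre(2)[OF
              R(1)] R(2) N(3) P(2) True
            by simp
          then show ?thesis using P(2) mpn by auto
        next
          case False
          \<comment> \<open>The second alternative holds, with \<open>N\<close> as the normal
            subgroup of order 4.\<close>
          then have e: "q = 2" "p = 3" "j = 2"
            using centralizes_smaller_prime[OF G(2) PG(1) P(2) less.prems(3) N(1,3,2) \<open>q < p\<close> j2]
            by auto
          then show ?thesis using N(1,3) dvd by auto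
        qed
      qed
    next
      \<comment> \<open>The quotient is of exceptional type. With q = 2, the order n would be
        divisible by 8, so q = 3 and \<open>N\<close> has order 3, because 27 does not divide n.
        Thus 36 divides n, and as 2 and 3 are the only primes left, n = 36.\<close>
      assume "p = 3 \<and> 4 dvd m \<and> (\<exists>R. R \<lhd> H \<and> card R = 4)"
      then obtain R where R: "p = 3" "4 dvd m" "R \<lhd> H" "card R = 4" by blast
      have "q \<noteq> 2"
      proof
        assume "q = 2"
        obtain k where "m = 4 * k" using R(2) by blast
        then have "n = 2 ^ 3 * (2 ^ (j - 1) * k)" using nm \<open>q = 2\<close> N(4) by (cases j) auto
        then have "2 ^ 3 dvd n" by (metis dvd_triv_left)
        then show False using cube_freeD[OF less.prems(2) two_is_prime_nat] by blast
      qed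
      moreover have "q \<ge> 2" using prime_ge_2_nat[OF N(2)] .
      ultimately have q3: "q = 3" using qp R(1) by simp
      have no27: "\<not> 27 dvd n" using cube_freeD[OF less.prems(2,3)] R(1) by simp
      have j1: "j = 1"
      proof (rule ccontr)
        assume "j \<noteq> 1"
        then have "j = 2" using N(4) j2 by simp
        then show False using nm True R(1) q3 no27 by (auto elim!: dvdE)
      qed
      have "4 dvd m" "3 dvd m" using R(1,2) True by auto
      then have "12 dvd m" by presburger
      then obtain r where r: "n = 36 * r" using nm q3 j1 by (auto elim!: dvdE)
      have "r = 1"
      proof (rule ccontr)
        assume "r \<noteq> 1"
        then obtain s where s: "prime s" "s dvd r" using prime_factor_nat by blast
        then have "s \<le> 3" using less.prems(5)[of s] r R(1) by simp
        then have "s = 2 \<or> s = 3" using prime_ge_2_nat[OF s(1)] by linarith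
        then show False
        proof
          assume "s = 2"
          then have "2 ^ 3 dvd n" using r s(2) by (auto elim!: dvdE)
          then show False using cube_freeD[OF less.prems(2) two_is_prime_nat] by blast
        next
          assume "s = 3"
          then show False using r s(2) no27 by (auto elim!: dvdE)
        qed
      qed
      then have n36: "n = 36" using r by simp
      let ?M = "{g \<in> carrier G. \<pi> g \<in> R}"
      have MG: "subgroup ?M G" using pre(1)[OF R(3)] by (rule normal_imp_subgroup)
      interpret M: group "G\<lparr>carrier := ?M\<rparr>" using MG by (rule subgroup_imp_group)
      have "order (G\<lparr>carrier := ?M\<rparr>) = 2 ^ 2 * 3"
        using pre(2)[OF R(3)] R(4) q3 j1 by (simp add: order_def)
      then obtain T where T: "subgroup T (G\<lparr>carrier := ?M\<rparr>)" "card T = 2 ^ 2"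
        using sylow_thm[OF two_is_prime_nat M.is_group, of 2 3] G(2) by auto
      have TG: "subgroup T G" "T \<subseteq> ?M"
        using incl_subgroup[OF MG T(1)] subgroup.subset[OF T(1)] by auto
      show ?thesis
      proof (cases "T \<subseteq> centralizer N")
        case True
        have "coprime (3::nat) 4" by (simp add: coprime_iff_gcd_eq_1 gcd_non_0_nat)
        then have "T \<lhd> G"
          using normal_of_centralizing[OF G(2) pre(1)[OF R(3)] NG pre(3)[OF R(3)] TG] pre(2)[OF
            R(3)] R(4) N(3) T(2) True q3 j1
          by simp
        then show ?thesis using T(2) R(1) n36 by auto
      next
        case False
        \<comment> \<open>\<open>T\<close> acts nontrivially on \<open>N\<close>, and then the first
          alternative holds with a normal Sylow 3-subgroup.\<close>
        obtain S where "S \<lhd> G" "card S = 9"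
          using normal_sylow_3_of_order_36[OF G(2) N(1)] N(3) q3 j1 G(3) n36 subgroup.subset[OF
            TG(1)] False
          by auto
        moreover have "multiplicity 3 (36::nat) = 2"
          by (rule multiplicity_eqI) auto
        ultimately show ?thesis using R(1) n36 by auto
      qed
    qed
  qed
qed

section \<open>Non-central abelian normal subgroups\<close>

lemma (in group) subgroup_eq_of_card_dvd:
  assumes "finite (carrier G)" "subgroup M G" "subgroup C G" "C \<subseteq> M" "card M dvd card C"
  shows "C = M"
proof -
  have fin: "finite M" using assms(1) subgroup.subset[OF assms(2)] finite_subset by blast
  have "card C > 0" using subgroup.finite_imp_card_positive[OF assms(3,1)] .
  then have "card M \<le> card C" using assms(5) by (rule dvd_imp_le[rotated])
  then show ?thesis using card_seteq[OF fin assms(4)] by blast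
qed

text \<open>Let \<open>M\<close> be the preimage of a normal subgroup of order q^j in the quotient
  by the centre \<open>Z\<close>. It is normal and larger than \<open>Z\<close>, and it is abelian:
  for j = 1 because \<open>Z\<close> has prime index in \<open>M\<close>; for j = 2 because
  cube-freeness makes the order of \<open>Z\<close> prime to q, so that \<open>M\<close> is the
  product of \<open>Z\<close> and an abelian group of order q^2.\<close>

lemma (in group) cube_free_noncentral_abelian_normal:
  assumes fin: "finite (carrier G)" and sol: "solvable G" and cf: "cube_free (order G)"
    and xy: "x \<in> carrier G" "y \<in> carrier G" "x \<otimes> y \<noteq> y \<otimes> x"
  obtains A where "A \<lhd> G" "\<And>a b. a \<in> A \<Longrightarrow> b \<in> A \<Longrightarrow> a \<otimes> b = b \<otimes> a" "\<not> A \<subseteq> centralizer (carrier G)"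
proof -
  define Z where "Z = centralizer (carrier G)"
  have Zn: "Z \<lhd> G" unfolding Z_def using centralizer_normal[OF normal_self] .
  have Z: "subgroup Z G" using Zn by (rule normal_imp_subgroup)
  have Zc: "a \<otimes> b = b \<otimes> a" if "a \<in> Z" "b \<in> carrier G" for a b
    using that by (auto simp: Z_def centralizer_def)
  have n0: "order G > 0" using fin order_gt_0_iff_finite by simp
  have cZ: "card Z > 0" using subgroup.finite_imp_card_positive[OF Z fin] .
  obtain K \<pi> where K: "K \<in> solvable_groups_of_order (order G div card Z)" "group_hom G K \<pi>"
    "\<pi> ` carrier G = carrier K" "kernel G K \<pi> = Z"
    using solvable_quotient[OF fin sol Zn] .
  interpret \<pi>: group_hom G K \<pi> by fact
  have Kf: "finite (carrier K)" "solvable K" using K(1) by (auto simp: solvable_groups_of_order_def)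
  have "x \<notin> Z" using xy Zc by blast
  then have "\<pi> x \<noteq> \<one>\<^bsub>K\<^esub>" using xy(1) K(4) by (auto simp: kernel_def)
  then have "carrier K \<noteq> {\<one>\<^bsub>K\<^esub>}" using \<pi>.hom_closed[OF xy(1)] by blast
  then obtain N q j where N: "N \<lhd> K" "prime q" "card N = q ^ j" "j > 0"
    using \<pi>.H.solvable_normal_prime_power[OF Kf] by blast
  define M where "M = {g \<in> carrier G. \<pi> g \<in> N}"
  have Mn: "M \<lhd> G" unfolding M_def using \<pi>.preimage_normal[OF N(1)] .
  have M: "subgroup M G" using Mn by (rule normal_imp_subgroup)
  have finM: "finite M" using fin by (simp add: M_def)
  have cM: "card M = card Z * q ^ j"
    using \<pi>.card_preimage[OF fin K(3), of N] K(4) N(3) subgroup.subset[OF normal_imp_subgroup[OF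
      N(1)]]
    by (simp add: M_def)
  have ZM: "Z \<subseteq> M"
    unfolding K(4)[symmetric] M_def using subgroup.one_closed[OF normal_imp_subgroup[OF N(1)]]
    by (auto simp: kernel_def)
  have qj: "q ^ j > 1" using one_less_power[of q j] N(4) prime_gt_1_nat[OF N(2)] by blast
  have nMZ: "\<not> M \<subseteq> Z"
  proof
    assume "M \<subseteq> Z"
    then have "card M = card Z" using ZM by auto
    then have "card Z * q ^ j = card Z * 1" using cM by simp
    then have "q ^ j = 1" using cZ by (metis mult_cancel1 not_gr_zero)
    then show False using qj by linarith
  qed
  have Mdvd: "card Z * q ^ j dvd order G" using card_subgroup_dvd[OF M] cM by simp
  have j2: "j \<le> 2"
  proof -
    have "q ^ j dvd order G" using Mdvd by (rule dvd_mult_right)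
    then have "j \<le> multiplicity q (order G)" using n0 N(2) by (intro multiplicity_geI) auto
    then show ?thesis using cube_free_multiplicity_le[OF cf n0 N(2)] by simp
  qed
  have CM: "subgroup (M \<inter> centralizer {s}) G" "Z \<subseteq> M \<inter> centralizer {s}" if "s \<in> carrier G" for s
  proof -
    show "subgroup (M \<inter> centralizer {s}) G"
      using subgroups_Inter_pair[OF M centralizer_subgroup] that by simp
    show "Z \<subseteq> M \<inter> centralizer {s}"
      using ZM that by (auto simp: Z_def centralizer_def)
  qed
  have comm: "a \<otimes> b = b \<otimes> a" if ab: "a \<in> M" "b \<in> M" for a b
  proof -
    have c: "a \<in> carrier G" "b \<in> carrier G" using ab subgroup.mem_carrier[OF M] by auto
    have "M \<inter> centralizer {a} = M"
    proof (cases "j = 1")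
      case True
      show ?thesis
      proof (cases "a \<in> Z")
        case True
        then show ?thesis using Zc subgroup.subset[OF M] by (auto simp: centralizer_def)
      next
        case False
        \<comment> \<open>The centralizer of \<open>a\<close> in \<open>M\<close> contains
          \<open>Z\<close> and also \<open>a\<close>, which is not in \<open>Z\<close>; as the index
          of \<open>Z\<close> in \<open>M\<close> is prime, it is all of \<open>M\<close>.\<close>
        have "card Z dvd card (M \<inter> centralizer {a})"
          using card_subgroup_dvd_card[OF Z CM(1)[OF c(1)] CM(2)[OF c(1)]] .
        then obtain k where k: "card (M \<inter> centralizer {a}) = card Z * k" by blast
        have "card (M \<inter> centralizer {a}) dvd card M"
          using card_subgroup_dvd_card[OF CM(1)[OF c(1)] M] by blast
        then have "k dvd q" using k cM cZ True \<open>j = 1\<close> by simp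
        moreover have "k \<noteq> 1"
        proof
          assume "k = 1"
          then have "Z = M \<inter> centralizer {a}"
            using k CM(2)[OF c(1)] finM by (intro card_subset_eq) auto
          then show False using False ab(1) c(1) by (auto simp: centralizer_def)
        qed
        ultimately have "k = q" using N(2) by (auto simp: prime_nat_iff)
        then have "card M dvd card (M \<inter> centralizer {a})" using k cM \<open>j = 1\<close> by simp
        then show ?thesis by (intro subgroup_eq_of_card_dvd[OF fin M CM(1)[OF c(1)]]) auto
      qed
    next
      case False
      then have j: "j = 2" using N(4) j2 by simp
      have "\<not> q dvd card Z"
      proof
        assume "q dvd card Z"
        then have "q * q ^ 2 dvd card Z * q ^ 2" by (rule mult_dvd_mono) simp
        then have "q * q ^ 2 dvd order G" using dvd_trans Mdvd unfolding j by blast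
        then show False using cube_freeD[OF cf N(2)]
          by (simp add: power3_eq_cube power2_eq_square mult.assoc)
      qed
      then have cop: "coprime (card Z) (q ^ 2)"
        using prime_imp_coprime[OF N(2), of "card Z"] \<open>\<not> q dvd card Z\<close>
      by (simp add: coprime_commute)
      interpret M: group "G\<lparr>carrier := M\<rparr>" using M by (rule subgroup_imp_group)
      have "order (G\<lparr>carrier := M\<rparr>) = q ^ 2 * card Z" using cM j by (simp add: order_def)
      then obtain S where S: "subgroup S (G\<lparr>carrier := M\<rparr>)" "card S = q ^ 2"
        using sylow_thm[OF N(2) M.is_group] finM by auto
      have SG: "subgroup S G" "S \<subseteq> M" using incl_subgroup[OF M S(1)] subgroup.subset[OF S(1)]
        by auto
      interpret S: group "G\<lparr>carrier := S\<rparr>" using SG(1) by (rule subgroup_imp_group)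
      have Sc: "s \<otimes> t = t \<otimes> s" if "s \<in> S" "t \<in> S" for s t
        using S.order_prime_square_comm[OF N(2), of s t] S(2) that by (simp add: order_def)
      \<comment> \<open>\<open>Z\<close> and \<open>S\<close> have coprime orders with product
        \<open>card M\<close>, so a subgroup of \<open>M\<close> containing both is
        \<open>M\<close>. Applied to elements of \<open>S\<close> this shows that \<open>S\<close>
        is central in \<open>M\<close>; then it applies to any \<open>a\<close> in
        \<open>M\<close>.\<close>
      have full: "M \<inter> centralizer {s} = M" if s: "s \<in> carrier G" "S \<subseteq> centralizer {s}" for s
      proof -
        have "card Z dvd card (M \<inter> centralizer {s})"
          using card_subgroup_dvd_card[OF Z CM(1)[OF s(1)] CM(2)[OF s(1)]] .
        moreover have "card S dvd card (M \<inter> centralizer {s})"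
          using card_subgroup_dvd_card[OF SG(1) CM(1)[OF s(1)]] s(2) SG(2) by blast
        ultimately have "card M dvd card (M \<inter> centralizer {s})"
          using cop S(2) cM j by (simp add: divides_mult)
        then show ?thesis by (intro subgroup_eq_of_card_dvd[OF fin M CM(1)[OF s(1)]]) auto
      qed
      have "S \<subseteq> centralizer {a}"
      proof
        fix s assume s: "s \<in> S"
        have sG: "s \<in> carrier G" using s subgroup.mem_carrier[OF SG(1)] by blast
        have "S \<subseteq> centralizer {s}" using Sc s subgroup.subset[OF SG(1)]
          by (auto simp: centralizer_def)
        then have "a \<in> centralizer {s}" using full[OF sG] ab(1) by blast
        then show "s \<in> centralizer {a}" using sG by (simp add: centralizer_def)
      qed
      then show ?thesis by (rule full[OF c(1)])
    qed
    then have "b \<in> centralizer {a}" using ab(2) by blast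
    then show ?thesis by (simp add: centralizer_def)
  qed
  show ?thesis using that[OF Mn comm] nMZ by (simp add: Z_def)
qed

section \<open>Conjugacy classes of homomorphisms\<close>

lemma (in group) conj_restrict_homs:
  assumes Q: "group Q" and \<phi>: "\<phi> \<in> homs Q G" and g: "g \<in> carrier G"
  shows "(\<lambda>q\<in>carrier Q. g \<otimes> \<phi> q \<otimes> inv g) \<in> homs Q G"
proof -
  interpret Q: group Q by fact
  have "g \<otimes> \<phi> (q \<otimes>\<^bsub>Q\<^esub> r) \<otimes> inv g = g \<otimes> \<phi> q \<otimes> inv g \<otimes> (g \<otimes> \<phi> r \<otimes> inv g)"
    if "q \<in> carrier Q" "r \<in> carrier Q" for q r
    using homsD[OF \<phi>] that g by (simp add: m_assoc)
  then show ?thesis using homsD(3)[OF \<phi>] g by (auto simp: homs_def hom_def)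
qed

lemma (in group) conj_action_homs:
  assumes Q: "group Q"
  shows "group_action G (homs Q G) (\<lambda>g. \<lambda>\<phi>\<in>homs Q G. \<lambda>q\<in>carrier Q. g \<otimes> \<phi> q \<otimes> inv g)"
proof (rule group_actionI)
  show "group G" ..
  show "(\<lambda>q\<in>carrier Q. g \<otimes> \<phi> q \<otimes> inv g) \<in> homs Q G" if "g \<in> carrier G" "\<phi> \<in> homs Q G" for g \<phi>
    using conj_restrict_homs[OF Q that(2,1)] .
  show "(\<lambda>q\<in>carrier Q. \<one> \<otimes> \<phi> q \<otimes> inv \<one>) = \<phi>" if "\<phi> \<in> homs Q G" for \<phi>
    using homsD(2,3)[OF that] by (auto simp: fun_eq_iff extensional_def)
  show "(\<lambda>q\<in>carrier Q. g \<otimes> h \<otimes> \<phi> q \<otimes> inv (g \<otimes> h)) =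
      (\<lambda>q\<in>carrier Q. g \<otimes> (\<lambda>q\<in>carrier Q. h \<otimes> \<phi> q \<otimes> inv h) q \<otimes> inv g)"
    if "g \<in> carrier G" "h \<in> carrier G" "\<phi> \<in> homs Q G" for g h \<phi>
    using homsD(3)[OF that(3)] that by (auto simp: fun_eq_iff m_assoc inv_mult_group)
qed

lemma homs_into_subgroup:
  assumes "\<phi> \<in> homs Q A" "\<And>q. q \<in> carrier Q \<Longrightarrow> \<phi> q \<in> S"
  shows "\<phi> \<in> homs Q (A\<lparr>carrier := S\<rparr>)"
  using assms by (auto simp: homs_def hom_def)

lemma (in group) card_homs_into_comm_subgroup:
  assumes fin: "finite (carrier G)" and Q: "group Q" "finite (carrier Q)" "cube_free (order Q)"
    and S: "subgroup S G" "\<And>a b. a \<in> S \<Longrightarrow> b \<in> S \<Longrightarrow> a \<otimes> b = b \<otimes> a" "card S \<le> c"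
  shows "card (homs Q (G\<lparr>carrier := S\<rparr>)) \<le> c ^ 2"
proof -
  interpret S: group "G\<lparr>carrier := S\<rparr>" using S(1) by (rule subgroup_imp_group)
  have "comm_group (G\<lparr>carrier := S\<rparr>)" by (rule S.group_comm_groupI) (use S(2) in auto)
  moreover have "finite S" using fin subgroup.subset[OF S(1)] finite_subset by blast
  ultimately have "card (homs Q (G\<lparr>carrier := S\<rparr>)) \<le> card S ^ 2"
    using card_homs_comm_le[OF Q, of "G\<lparr>carrier := S\<rparr>"] by (simp add: order_def)
  also have "\<dots> \<le> c ^ 2" using S(3) by (rule power_mono) simp
  finally show ?thesis .
qed

text \<open>The elements conjugating t to u form a coset of the centralizer of t or the empty
  set.\<close>

lemma (in group) card_conjugators_le:
  assumes fin: "finite (carrier G)" and t: "t \<in> carrier G"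
  shows "card {s \<in> carrier G. s \<otimes> t \<otimes> inv s = u} \<le> card (centralizer {t})"
proof (cases "\<exists>s\<in>carrier G. s \<otimes> t \<otimes> inv s = u")
  case False
  then have "{s \<in> carrier G. s \<otimes> t \<otimes> inv s = u} = {}" by blast
  then show ?thesis by (simp only: card.empty le0)
next
  case True
  then obtain s0 where s0: "s0 \<in> carrier G" "s0 \<otimes> t \<otimes> inv s0 = u" by blast
  have u: "u \<in> carrier G" using s0 t by auto
  show ?thesis
  proof (rule card_inj_on_le[where f = "\<lambda>s. inv s0 \<otimes> s"])
    show "inj_on (\<lambda>s. inv s0 \<otimes> s) {s \<in> carrier G. s \<otimes> t \<otimes> inv s = u}"
      using s0 by (auto simp: inj_on_def)
    show "finite (centralizer {t})" using fin by (simp add: centralizer_def)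
    show "(\<lambda>s. inv s0 \<otimes> s) ` {s \<in> carrier G. s \<otimes> t \<otimes> inv s = u} \<subseteq> centralizer {t}"
    proof clarify
      fix s assume s: "s \<in> carrier G" "u = s \<otimes> t \<otimes> inv s"
      have "s \<otimes> t = u \<otimes> s" "u \<otimes> s0 = s0 \<otimes> t"
        using conj_eq_iff_commute[OF s(1) t u] conj_eq_iff_commute[OF s0(1) t u] s(2) s0(2) by auto
      then have "inv s0 \<otimes> s \<otimes> t = inv s0 \<otimes> (u \<otimes> s)"
        using s(1) t s0(1) by (simp add: m_assoc)
      also have "\<dots> = inv s0 \<otimes> (u \<otimes> s0) \<otimes> (inv s0 \<otimes> s)"
        using s(1) s0(1) u by (simp add: m_assoc)
      also have "u \<otimes> s0 = s0 \<otimes> t" by fact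
      also have "inv s0 \<otimes> (s0 \<otimes> t) \<otimes> (inv s0 \<otimes> s) = t \<otimes> (inv s0 \<otimes> s)"
        using s(1) t s0(1) by (simp add: m_assoc)
      finally show "inv s0 \<otimes> s \<in> centralizer {t}" using s(1) s0(1) by (simp add: centralizer_def)
    qed
  qed
qed

text \<open>The action on \<open>{t, u}\<close> amounts to a homomorphism to the group of order 2,
  with at most 4 possibilities. For each of them there are at most \<open>c ^ 2\<close> restrictions
  to the kernel and at most \<open>c\<close> values at one further element, since these values
  conjugate t to a known element.\<close>

lemma (in group) card_homs_two_conjugates:
  assumes fin: "finite (carrier G)" and Q: "group Q" "finite (carrier Q)" "cube_free (order Q)"
    and t: "t \<in> carrier G" and c: "card (centralizer {t}) \<le> c"
    and cc: "\<And>a b. a \<in> centralizer {t} \<Longrightarrow> b \<in> centralizer {t} \<Longrightarrow> a \<otimes> b = b \<otimes> a"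
  shows "card {\<phi> \<in> homs Q G. \<forall>q\<in>carrier Q. \<phi> q \<otimes> t \<otimes> inv (\<phi> q) \<in> {t, u}} \<le> 4 * c ^ 3"
proof -
  interpret Q: group Q by fact
  define E where "E = {\<phi> \<in> homs Q G. \<forall>q\<in>carrier Q. \<phi> q \<otimes> t \<otimes> inv (\<phi> q) \<in> {t, u}}"
  define B where "B = integer_mod_group 2"
  have B: "comm_group B" "carrier B = {0, 1}" by (auto simp: B_def carrier_integer_mod_group)
  \<comment> \<open>\<open>\<phi>\<close> is determined by the kernel of \<open>\<epsilon> \<phi>\<close>, which acts through the centralizer of \<open>t\<close>,
    and the value of \<open>\<phi>\<close> at one element outside.\<close>
  define \<epsilon> where "\<epsilon> \<phi> = (\<lambda>q\<in>carrier Q. if \<phi> q \<otimes> t \<otimes> inv (\<phi> q) = t then 0 else 1 :: int)" for \<phi>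
  have \<epsilon>: "\<epsilon> \<phi> \<in> homs Q B" if \<phi>: "\<phi> \<in> E" for \<phi>
  proof -
    have h: "\<phi> \<in> homs Q G" using \<phi> by (simp add: E_def)
    define a where "a q s = \<phi> q \<otimes> s \<otimes> inv (\<phi> q)" for q s
    have a_in: "a q t \<in> {t, u}" if "q \<in> carrier Q" for q using \<phi> that by (simp add: E_def a_def)
    have a_mult: "a (q \<otimes>\<^bsub>Q\<^esub> r) t = a q (a r t)" if "q \<in> carrier Q" "r \<in> carrier Q" for q r
      using homsD(3,4)[OF h] that t by (simp add: a_def m_assoc inv_mult_group)
    have a_inj: "s = s'" if "q \<in> carrier Q" "s \<in> carrier G" "s' \<in> carrier G" "a q s = a q s'"
      for q s s'
      using that homsD(3)[OF h] by (simp add: a_def)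
    have cl: "a q s \<in> carrier G" if "q \<in> carrier Q" "s \<in> carrier G" for q s
      using that homsD(3)[OF h] by (simp add: a_def)
    have "(a (q \<otimes>\<^bsub>Q\<^esub> r) t = t) = ((a q t = t) = (a r t = t))" if q: "q \<in> carrier Q"
      and r: "r \<in> carrier Q" for q r
    proof (cases "a r t = t")
      case True then show ?thesis using a_mult[OF q r] by simp
    next
      case False
      then have u: "a r t = u" "u \<noteq> t" using a_in[OF r] by auto
      then have "u \<in> carrier G" using cl[OF r t] by simp
      \<comment> \<open>Once u is known to be a conjugate of t, every \<open>\<phi> q\<close>
        permutes the two-element set \<open>{t, u}\<close>, by fixing or swapping its
        points.\<close>
      then have "a q t \<noteq> a q u" using a_inj[OF q t] u(2) by blast
      moreover have "a q t \<in> {t, u}" "a q u \<in> {t, u}"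
        using a_in[OF q] a_in[OF Q.m_closed[OF q r]] a_mult[OF q r] u(1) by auto
      ultimately show ?thesis using a_mult[OF q r] u by auto
    qed
    then have "\<epsilon> \<phi> \<in> hom Q B"
      by (auto simp: hom_def \<epsilon>_def B(2) a_def[symmetric]) (auto simp: B_def)
    then show ?thesis by (simp add: homs_def \<epsilon>_def)
  qed
  have part: "card {\<phi> \<in> E. \<epsilon> \<phi> = e} \<le> c ^ 3" if e: "e \<in> homs Q B" for e
  proof -
    interpret e: group_hom Q B e using homs_group_hom[OF e] Q.is_group B(1) comm_group.axioms(2)
      by blast
    define Q0 where "Q0 = kernel Q B e"
    have Q0: "subgroup Q0 Q" unfolding Q0_def by (rule e.subgroup_kernel)
    have Q0': "Q0 = {q \<in> carrier Q. e q = 0}" by (auto simp: Q0_def kernel_def B_def)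
    \<comment> \<open>An element outside the kernel if there is one; otherwise the unit, so that the
      same encoding covers the trivial \<open>e\<close>.\<close>
    define x where "x = (if \<exists>q\<in>carrier Q. e q = 1 then SOME q. q \<in> carrier Q \<and> e q = 1 else \<one>\<^bsub>Q\<^esub>)"
    have x: "x \<in> carrier Q" "\<And>q. q \<in> carrier Q \<Longrightarrow> e q = 1 \<Longrightarrow> e x = 1"
      using someI_ex[of "\<lambda>q. q \<in> carrier Q \<and> e q = 1"] by (auto simp: x_def)
    define v where "v = (if e x = 0 then t else u)"
    let ?X = "homs (Q\<lparr>carrier := Q0\<rparr>) (G\<lparr>carrier := centralizer {t}\<rparr>) \<times> {s \<in> carrier G. s \<otimes> t
        \<otimes> inv s = v}"
    have C: "subgroup (centralizer {t}) G" using t by (intro centralizer_subgroup) auto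
    have finX: "finite (homs (Q\<lparr>carrier := Q0\<rparr>) (G\<lparr>carrier := centralizer {t}\<rparr>))"
      using Q(2) fin by (intro finite_homs) (auto simp: Q0' centralizer_def)
    have "card {\<phi> \<in> E. \<epsilon> \<phi> = e} \<le> card ?X"
    proof (rule card_inj_on_le[where f = "\<lambda>\<phi>. (restrict \<phi> Q0, \<phi> x)"])
      show "inj_on (\<lambda>\<phi>. (restrict \<phi> Q0, \<phi> x)) {\<phi> \<in> E. \<epsilon> \<phi> = e}"
      proof (rule inj_onI, clarsimp)
        fix \<phi> \<psi> assume h: "\<phi> \<in> E" "\<psi> \<in> E" "\<epsilon> \<psi> = \<epsilon> \<phi>" "e = \<epsilon> \<phi>" "restrict \<phi> Q0 = restrict \<psi> Q0"
          "\<phi> x = \<psi> x"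
        have hm: "\<phi> \<in> homs Q G" "\<psi> \<in> homs Q G" using h(1,2) by (auto simp: E_def)
        have eq0: "\<phi> q = \<psi> q" if "q \<in> Q0" for q using fun_cong[OF h(5), of q] that by simp
        have "\<phi> q = \<psi> q" if q: "q \<in> carrier Q" for q
        proof (cases "e q = 0")
          case True then show ?thesis using eq0 q by (simp add: Q0')
        next
          case False
          then have e1: "e q = 1" using e.hom_closed[OF q] B(2) by auto
          then have "e x = 1" using x(2) q by blast
          then have "inv\<^bsub>Q\<^esub> x \<otimes>\<^bsub>Q\<^esub> q \<in> Q0"
            using x(1) q e1 by (simp add: Q0' B_def inv_integer_mod_group carrier_integer_mod_group)
          then have "\<phi> x \<otimes> \<phi> (inv\<^bsub>Q\<^esub> x \<otimes>\<^bsub>Q\<^esub> q) = \<psi> x \<otimes> \<psi> (inv\<^bsub>Q\<^esub> x \<otimes>\<^bsub>Q\<^esub> q)"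
            using eq0 h(6) by simp
          moreover have "\<phi> x \<otimes> \<phi> (inv\<^bsub>Q\<^esub> x \<otimes>\<^bsub>Q\<^esub> q) = \<phi> q" "\<psi> x \<otimes> \<psi> (inv\<^bsub>Q\<^esub> x \<otimes>\<^bsub>Q\<^esub> q) = \<psi> q"
            using homsD(4)[OF hm(1), of x "inv\<^bsub>Q\<^esub> x \<otimes>\<^bsub>Q\<^esub> q"] homsD(4)[OF hm(2), of x
              "inv\<^bsub>Q\<^esub> x \<otimes>\<^bsub>Q\<^esub> q"] x(1) q
            by auto
          ultimately show ?thesis by simp
        qed
        then show "\<phi> = \<psi>" using homsD(2)[OF hm(1)] homsD(2)[OF hm(2)] by (intro extensionalityI)
      qed
      show "finite ?X" using finX fin by auto
      show "(\<lambda>\<phi>. (restrict \<phi> Q0, \<phi> x)) ` {\<phi> \<in> E. \<epsilon> \<phi> = e} \<subseteq> ?X"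
      proof (rule image_subsetI)
        fix \<phi> assume "\<phi> \<in> {\<phi> \<in> E. \<epsilon> \<phi> = e}"
        then have \<phi>: "\<phi> \<in> E" "\<epsilon> \<phi> = e" "\<phi> \<in> homs Q G" by (auto simp: E_def)
        have iff: "e q = 0 \<longleftrightarrow> \<phi> q \<otimes> t \<otimes> inv (\<phi> q) = t" if "q \<in> carrier Q" for q
          using that \<phi>(2) by (auto simp: \<epsilon>_def split: if_splits)
        have "\<phi> q \<in> centralizer {t}" if "q \<in> Q0" for q
          using that iff[of q] homsD(3)[OF \<phi>(3)] t
          by (auto simp: Q0' centralizer_def conj_eq_iff_commute)
        then have "restrict \<phi> Q0 \<in> homs (Q\<lparr>carrier := Q0\<rparr>) (G\<lparr>carrier := centralizer {t}\<rparr>)"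
          using homsD(4)[OF \<phi>(3)] subgroup.m_closed[OF Q0] by (auto simp: homs_def hom_def Q0')
        moreover have "\<phi> x \<otimes> t \<otimes> inv (\<phi> x) = v"
          using iff[OF x(1)] \<phi>(1) x(1) by (auto simp: v_def E_def)
        ultimately show "(restrict \<phi> Q0, \<phi> x) \<in> ?X" using homsD(3)[OF \<phi>(3) x(1)] by simp
      qed
    qed
    also have "\<dots> = card (homs (Q\<lparr>carrier := Q0\<rparr>) (G\<lparr>carrier := centralizer {t}\<rparr>))
        * card {s \<in> carrier G. s \<otimes> t \<otimes> inv s = v}"
      by (rule card_cartesian_product)
    also have "\<dots> \<le> c ^ 2 * c"
    proof (rule mult_le_mono)
      show "card {s \<in> carrier G. s \<otimes> t \<otimes> inv s = v} \<le> c"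
        using card_conjugators_le[OF fin t] c order_trans by blast
      have "card Q0 dvd order Q" using Q.card_subgroup_dvd[OF Q0] .
      then show "card (homs (Q\<lparr>carrier := Q0\<rparr>) (G\<lparr>carrier := centralizer {t}\<rparr>)) \<le> c ^ 2"
        using cube_free_dvd[OF Q(3)] Q.subgroup_imp_group[OF Q0] Q(2) c cc C
        by (intro card_homs_into_comm_subgroup[OF fin]) (auto simp: order_def Q0')
    qed
    also have "\<dots> = c ^ 3" by (simp add: power3_eq_cube power2_eq_square)
    finally show ?thesis .
  qed
  have finB: "finite (homs Q B)" using Q(2) B(2) by (intro finite_homs) auto
  have finE: "finite E" unfolding E_def using finite_homs[OF Q(2) fin] by simp
  have "E = (\<Union>e\<in>homs Q B. {\<phi> \<in> E. \<epsilon> \<phi> = e})" using \<epsilon> by auto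
  then have "card E \<le> (\<Sum>e\<in>homs Q B. card {\<phi> \<in> E. \<epsilon> \<phi> = e})"
    using card_UN_le[OF finB, of "\<lambda>e. {\<phi> \<in> E. \<epsilon> \<phi> = e}"] by simp
  also have "\<dots> \<le> card (homs Q B) * c ^ 3" using sum_bounded_above[of "homs Q B" _ "c ^ 3"] part
    by simp
  also have "\<dots> \<le> 4 * c ^ 3"
  proof (rule mult_right_mono)
    show "card (homs Q B) \<le> 4"
      using card_homs_comm_le[OF Q B(1)] B(2) by (simp add: order_def power2_eq_square)
  qed simp
  finally show ?thesis by (simp add: E_def)
qed

text \<open>The image of \<open>h\<close> has order dividing \<open>order G\<close>, hence
  cube-free, so it has a noncentral abelian normal subgroup. Take \<open>h t\<close> in it and not
  central; its conjugates stay in this subgroup and so commute with it.\<close>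

lemma (in group_hom) cube_free_image_abelian_normal:
  assumes fin: "finite (carrier G)" and sol: "solvable G" and cf: "cube_free (order G)"
    and xy: "x \<in> carrier G" "y \<in> carrier G" "h x \<otimes>\<^bsub>H\<^esub> h y \<noteq> h y \<otimes>\<^bsub>H\<^esub> h x"
  obtains t y where "t \<in> carrier G" "y \<in> carrier G" "h y \<otimes>\<^bsub>H\<^esub> h t \<noteq> h t \<otimes>\<^bsub>H\<^esub> h y"
    "\<And>q. q \<in> carrier G \<Longrightarrow> h q \<otimes>\<^bsub>H\<^esub> h t \<otimes>\<^bsub>H\<^esub> inv\<^bsub>H\<^esub> h q \<in> H.centralizer {h t}"
proof -
  let ?I = "H\<lparr>carrier := h ` carrier G\<rparr>"
  have sub: "subgroup (h ` carrier G) H" by (rule img_is_subgroup)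
  interpret I: group ?I using sub by (rule H.subgroup_imp_group)
  have hom: "group_hom G ?I h"
    using homh by (auto simp: group_hom_def group_hom_axioms_def hom_def)
  have "solvable ?I" using group_hom.surj_hom_imp_solvable[OF hom _ sol] by simp
  moreover have "{g \<in> carrier G. h g \<in> h ` carrier G} = carrier G" by blast
  then have "order ?I dvd order G"
    using group_hom.card_preimage[OF hom fin, of "h ` carrier G"] by (simp add: order_def)
  then have "cube_free (order ?I)" using cf cube_free_dvd by blast
  ultimately obtain A where A: "A \<lhd> ?I" "\<And>a b. a \<in> A \<Longrightarrow> b \<in> A \<Longrightarrow> a \<otimes>\<^bsub>H\<^esub> b = b \<otimes>\<^bsub>H\<^esub> a"
    "\<not> A \<subseteq> I.centralizer (h ` carrier G)"
    using I.cube_free_noncentral_abelian_normal[of "h x" "h y"] fin xy by auto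
  have AI: "A \<subseteq> h ` carrier G" using subgroup.subset[OF normal_imp_subgroup[OF A(1)]] by simp
  obtain a b where ab: "a \<in> A" "b \<in> h ` carrier G" "b \<otimes>\<^bsub>H\<^esub> a \<noteq> a \<otimes>\<^bsub>H\<^esub> b"
  proof -
    obtain a where a: "a \<in> A" "a \<notin> I.centralizer (h ` carrier G)" using A(3) by blast
    then have "\<exists>b\<in>h ` carrier G. a \<otimes>\<^bsub>H\<^esub> b \<noteq> b \<otimes>\<^bsub>H\<^esub> a" using AI by (auto simp: I.centralizer_def)
    then obtain b where "b \<in> h ` carrier G" "a \<otimes>\<^bsub>H\<^esub> b \<noteq> b \<otimes>\<^bsub>H\<^esub> a" by blast
    with a(1) that show ?thesis by metis
  qed
  obtain t where t: "t \<in> carrier G" "h t = a" using ab(1) AI by blast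
  obtain s where s: "s \<in> carrier G" "h s = b" using ab(2) by blast
  have "h q \<otimes>\<^bsub>H\<^esub> h t \<otimes>\<^bsub>H\<^esub> inv\<^bsub>H\<^esub> h q \<in> H.centralizer {h t}" if q: "q \<in> carrier G" for q
  proof -
    have "h q \<otimes>\<^bsub>H\<^esub> a \<otimes>\<^bsub>H\<^esub> inv\<^bsub>H\<^esub> h q \<in> A"
      using normal.inv_op_closed2[OF A(1), of "h q" a] q ab(1) H.m_inv_consistent[OF sub, of "h q"]
      by simp
    then show ?thesis using A(2) ab(1) t q by (auto simp: H.centralizer_def)
  qed
  then show ?thesis using that[OF t(1) s(1)] ab(3) s t by simp
qed

text \<open>
  In Burnside's lemma, each \<open>g \<notin> Z\<close> fixes at most \<open>c\<^sup>2\<close> homomorphisms. Altogether there are at most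
  \<open>z\<^sup>2\<close> homomorphisms into \<open>Z\<close>, and every other one takes \<open>t\<close> to at most two conjugates for some \<open>t \<notin> Z\<close>.
\<close>
lemma (in group) card_conj_orbits_homs_le:
  assumes fin: "finite (carrier G)"
    and Q: "group Q" "finite (carrier Q)" "cube_free (order Q)" "solvable Q"
    and Z: "subgroup Z G" "\<And>a b. a \<in> Z \<Longrightarrow> b \<in> carrier G \<Longrightarrow> a \<otimes> b = b \<otimes> a" "card Z \<le> z"
    and C: "\<And>t. t \<in> carrier G - Z \<Longrightarrow> card (centralizer {t}) \<le> c"
      "\<And>t a b. t \<in> carrier G - Z \<Longrightarrow> a \<in> centralizer {t} \<Longrightarrow> b \<in> centralizer {t} \<Longrightarrow> a \<otimes> b = b \<otimes> a"
    and conj: "\<And>t. t \<in> carrier G - Z \<Longrightarrow> t [^] order Q = \<one> \<Longrightarrow>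
      \<exists>u. \<forall>h\<in>carrier G. h \<otimes> t \<otimes> inv h \<in> centralizer {t} \<longrightarrow> h \<otimes> t \<otimes> inv h \<in> {t, u}"
  shows "card (orbits G (homs Q G) (\<lambda>g. \<lambda>\<phi>\<in>homs Q G. \<lambda>q\<in>carrier Q. g \<otimes> \<phi> q \<otimes> inv g))
    \<le> z ^ 2 + 4 * z * c ^ 3 + c ^ 2"
proof -
  let ?act = "\<lambda>g. \<lambda>\<phi>\<in>homs Q G. \<lambda>q\<in>carrier Q. g \<otimes> \<phi> q \<otimes> inv g"
  interpret Q: group Q by fact
  interpret A: group_action G "homs Q G" ?act using conj_action_homs[OF Q(1)] .
  have finH: "finite (homs Q G)" using finite_homs[OF Q(2) fin] .
  \<comment> \<open>Values of homomorphisms from \<open>Q\<close> are killed by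
    \<open>order Q\<close>, so only such t are needed; only for them is the number of conjugates in
    the centralizer controlled.\<close>
  define T where "T = {t \<in> carrier G - Z. t [^] order Q = \<one>}"
  have finT: "finite T" "card T \<le> order G"
    using fin by (auto simp: T_def order_def intro: card_mono)
  obtain u where u: "\<And>t h. t \<in> T \<Longrightarrow> h \<in> carrier G \<Longrightarrow> h \<otimes> t \<otimes> inv h \<in> centralizer {t}
      \<Longrightarrow> h \<otimes> t \<otimes> inv h \<in> {t, u t}"
  proof -
    have "\<forall>t\<in>T. \<exists>u. \<forall>h\<in>carrier G. h \<otimes> t \<otimes> inv h \<in> centralizer {t} \<longrightarrow> h \<otimes> t \<otimes> inv h \<in> {t, u}"
      using conj by (simp add: T_def)
    from bchoice[OF this] show ?thesis using that by blast
  qed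
  define E where "E t = {\<phi> \<in> homs Q G. \<forall>q\<in>carrier Q. \<phi> q \<otimes> t \<otimes> inv (\<phi> q) \<in> {t, u t}}" for t
  have Ecard: "card (E t) \<le> 4 * c ^ 3" if "t \<in> T" for t
    unfolding E_def using card_homs_two_conjugates[OF fin Q(1-3) _ C(1) C(2)] that
    by (auto simp: T_def)
  let ?HZ = "homs Q (G\<lparr>carrier := Z\<rparr>)"
  have cover: "homs Q G \<subseteq> ?HZ \<union> (\<Union>t\<in>T. E t)"
  proof
    fix \<phi> assume \<phi>: "\<phi> \<in> homs Q G"
    interpret f: group_hom Q G \<phi> using homs_group_hom[OF \<phi> Q(1) is_group] .
    have pow: "\<phi> q [^] order Q = \<one>" if "q \<in> carrier Q" for q
      using f.hom_nat_pow[OF that, of "order Q"] Q.pow_order_eq_1[OF that] by simp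
    show "\<phi> \<in> ?HZ \<union> (\<Union>t\<in>T. E t)"
    proof (cases "\<forall>q\<in>carrier Q. \<phi> q \<in> Z")
      case True then show ?thesis using homs_into_subgroup[OF \<phi>] by blast
    next
      case False
      then obtain r where r: "r \<in> carrier Q" "\<phi> r \<notin> Z" by blast
      show ?thesis
      proof (cases "\<forall>x\<in>carrier Q. \<forall>y\<in>carrier Q. \<phi> x \<otimes> \<phi> y = \<phi> y \<otimes> \<phi> x")
        case True
        \<comment> \<open>When the image is abelian, any value outside \<open>Z\<close> serves as t,
          since it is fixed under conjugation by the image.\<close>
        have "\<phi> r \<in> T" using r pow by (simp add: T_def)
        moreover have "\<phi> \<in> E (\<phi> r)"
          using \<phi> True r(1) by (simp add: E_def conj_eq_iff_commute)
        ultimately show ?thesis by blast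
      next
        case False
        then obtain x y where "x \<in> carrier Q" "y \<in> carrier Q" "\<phi> x \<otimes> \<phi> y \<noteq> \<phi> y \<otimes> \<phi> x" by blast
        then obtain t y where t: "t \<in> carrier Q" "y \<in> carrier Q" "\<phi> y \<otimes> \<phi> t \<noteq> \<phi> t \<otimes> \<phi> y"
          "\<And>q. q \<in> carrier Q \<Longrightarrow> \<phi> q \<otimes> \<phi> t \<otimes> inv (\<phi> q) \<in> centralizer {\<phi> t}"
          using f.cube_free_image_abelian_normal[OF Q(2,4,3)] by blast
        have "\<phi> t \<notin> Z" using Z(2)[of "\<phi> t" "\<phi> y"] t by auto
        then have T: "\<phi> t \<in> T" using t(1) pow by (simp add: T_def)
        then have "\<phi> \<in> E (\<phi> t)" using \<phi> u[OF T] t(4) by (simp add: E_def)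
        then show ?thesis using T by blast
      qed
    qed
  qed
  have Zc: "a \<otimes> b = b \<otimes> a" if "a \<in> Z" "b \<in> Z" for a b
    using Z(2) that subgroup.mem_carrier[OF Z(1)] by blast
  have HZ: "card ?HZ \<le> z ^ 2" using card_homs_into_comm_subgroup[OF fin Q(1-3) Z(1) Zc Z(3)] .
  have finHZ: "finite ?HZ"
    using Q(2) fin subgroup.subset[OF Z(1)] by (intro finite_homs) (auto intro: finite_subset)
  have "card (homs Q G) \<le> card (?HZ \<union> (\<Union>t\<in>T. E t))"
    using cover finHZ finT(1) finH by (intro card_mono) (auto simp: E_def)
  also have "\<dots> \<le> card ?HZ + card (\<Union>t\<in>T. E t)" by (rule card_Un_le)
  also have "card (\<Union>t\<in>T. E t) \<le> (\<Sum>t\<in>T. card (E t))" by (rule card_UN_le[OF finT(1)])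
  also have "(\<Sum>t\<in>T. card (E t)) \<le> card T * (4 * c ^ 3)"
    using sum_bounded_above[of T "\<lambda>t. card (E t)" "4 * c ^ 3"] Ecard by simp
  also have "card T * (4 * c ^ 3) \<le> order G * (4 * c ^ 3)" using finT(2)
    by (rule mult_right_mono) simp
  finally have homs_le: "card (homs Q G) \<le> z ^ 2 + order G * (4 * c ^ 3)" using HZ by linarith
  \<comment> \<open>To be used for \<open>g\<close> in \<open>Z\<close>. Such \<open>g\<close> is
    central and fixes every homomorphism, so the total number is the right bound.\<close>
  have inv1: "card (invariants (homs Q G) ?act g) \<le> z ^ 2 + order G * (4 * c ^ 3)" for g
    using card_mono[OF finH, of "invariants (homs Q G) ?act g"] homs_le
    by (auto simp: invariants_def)
  have inv2: "card (invariants (homs Q G) ?act g) \<le> c ^ 2" if g: "g \<in> carrier G - Z" for g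
  proof -
    have sub: "subgroup (centralizer {g}) G" using g by (intro centralizer_subgroup) auto
    have "invariants (homs Q G) ?act g \<subseteq> homs Q (G\<lparr>carrier := centralizer {g}\<rparr>)"
    proof
      fix \<phi> assume "\<phi> \<in> invariants (homs Q G) ?act g"
      then have \<phi>: "\<phi> \<in> homs Q G" "(\<lambda>q\<in>carrier Q. g \<otimes> \<phi> q \<otimes> inv g) = \<phi>"
        by (auto simp: invariants_def)
      have "\<phi> q \<in> centralizer {g}" if q: "q \<in> carrier Q" for q
      proof -
        have "g \<otimes> \<phi> q \<otimes> inv g = \<phi> q" using fun_cong[OF \<phi>(2), of q] q by simp
        then show ?thesis using homsD(3)[OF \<phi>(1) q] g
          by (simp add: centralizer_def conj_eq_iff_commute)
      qed
      then show "\<phi> \<in> homs Q (G\<lparr>carrier := centralizer {g}\<rparr>)" using homs_into_subgroup[OF \<phi>(1)]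
        by blast
    qed
    moreover have "finite (homs Q (G\<lparr>carrier := centralizer {g}\<rparr>))"
      using Q(2) fin by (intro finite_homs) (auto simp: centralizer_def)
    ultimately have "card (invariants (homs Q G) ?act g)
        \<le> card (homs Q (G\<lparr>carrier := centralizer {g}\<rparr>))"
      by (rule card_mono[rotated])
    also have "\<dots> \<le> c ^ 2"
      using card_homs_into_comm_subgroup[OF fin Q(1-3) sub C(2)[OF g] C(1)[OF g]] by blast
    finally show ?thesis .
  qed
  have ZG: "Z \<subseteq> carrier G" using subgroup.subset[OF Z(1)] .
  have cardZ: "card Z \<le> order G" using card_mono[OF fin ZG] by (simp add: order_def)
  have "card (orbits G (homs Q G) ?act) * order G
      = (\<Sum>g\<in>carrier G. card (invariants (homs Q G) ?act g))"
    using A.burnside[OF fin finH] .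
  also have "\<dots> = (\<Sum>g\<in>carrier G - Z. card (invariants (homs Q G) ?act g))
      + (\<Sum>g\<in>Z. card (invariants (homs Q G) ?act g))"
    by (rule sum.subset_diff[OF ZG fin])
  \<comment> \<open>The factor \<open>order G\<close> in the total count is multiplied only by
    \<open>card Z\<close>; after division by \<open>order G\<close> it leaves
    \<open>4 * z * c ^ 3\<close>.\<close>
  also have "\<dots> \<le> card (carrier G - Z) * c ^ 2 + card Z * (z ^ 2 + order G * (4 * c ^ 3))"
    using sum_bounded_above[of "carrier G - Z" _ "c ^ 2"] inv2
      sum_bounded_above[of Z _ "z ^ 2 + order G * (4 * c ^ 3)"] inv1
    by (intro add_mono) auto
  also have "\<dots> \<le> order G * c ^ 2 + (order G * z ^ 2 + z * (order G * (4 * c ^ 3)))"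
    using card_mono[OF fin, of "carrier G - Z"] cardZ Z(3)
    by (simp add: distrib_left order_def add_mono mult_right_mono)
  also have "\<dots> = (z ^ 2 + 4 * z * c ^ 3 + c ^ 2) * order G" by (simp add: algebra_simps)
  finally have "card (orbits G (homs Q G) ?act) * order G
      \<le> (z ^ 2 + 4 * z * c ^ 3 + c ^ 2) * order G" .
  moreover have "0 < order G" using fin order_gt_0_iff_finite by simp
  ultimately show ?thesis unfolding mult_le_cancel2 by blast
qed

section \<open>Automorphisms of groups of order \<open>p\<close> and \<open>p\<^sup>2\<close>\<close>

lemma autoD:
  assumes "f \<in> auto G"
  shows "f \<in> hom G G" "x \<in> carrier G \<Longrightarrow> f x \<in> carrier G" "inj_on f (carrier G)"
    "f ` carrier G = carrier G" "f \<in> extensional (carrier G)"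
  using assms by (auto simp: auto_def Bij_def bij_betw_def hom_def)

lemma carrier_AutoGroup [simp]: "carrier (AutoGroup G) = auto G"
  by (simp add: AutoGroup_def)

lemma AutoGroup_mult:
  assumes "f \<in> auto G" "g \<in> auto G" "x \<in> carrier G"
  shows "(f \<otimes>\<^bsub>AutoGroup G\<^esub> g) x = f (g x)"
  using assms by (simp add: AutoGroup_def BijGroup_def auto_def compose_def)

lemma AutoGroup_one: "x \<in> carrier G \<Longrightarrow> \<one>\<^bsub>AutoGroup G\<^esub> x = x"
  by (simp add: AutoGroup_def BijGroup_def)

lemma auto_eqI:
  assumes "f \<in> auto G" "g \<in> auto G" "\<And>x. x \<in> carrier G \<Longrightarrow> f x = g x"
  shows "f = g"
  using extensionalityI[OF autoD(5)[OF assms(1)] autoD(5)[OF assms(2)]] assms(3) by blast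

lemma finite_auto:
  assumes "finite (carrier G)"
  shows "finite (auto G)"
  by (rule finite_subset[OF _ finite_homs[OF assms assms]]) (auto simp: auto_def homs_def Bij_def)

lemma (in group) auto_group_hom: "f \<in> auto G \<Longrightarrow> group_hom G G f"
  by (simp add: group_hom_def group_hom_axioms_def autoD(1))

lemma (in group) AutoGroup_inv:
  assumes "f \<in> auto G" "x \<in> carrier G"
  shows "inv\<^bsub>AutoGroup G\<^esub> f \<in> auto G" "(inv\<^bsub>AutoGroup G\<^esub> f) (f x) = x"
    "f ((inv\<^bsub>AutoGroup G\<^esub> f) x) = x"
proof -
  interpret A: group "AutoGroup G" by (rule AutoGroup)
  show i: "inv\<^bsub>AutoGroup G\<^esub> f \<in> auto G" using A.inv_closed[of f] assms(1) by simp
  have "inv\<^bsub>AutoGroup G\<^esub> f \<otimes>\<^bsub>AutoGroup G\<^esub> f = \<one>\<^bsub>AutoGroup G\<^esub>"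
    "f \<otimes>\<^bsub>AutoGroup G\<^esub> inv\<^bsub>AutoGroup G\<^esub> f = \<one>\<^bsub>AutoGroup G\<^esub>"
    using A.l_inv[of f] A.r_inv[of f] assms(1) by auto
  then show "(inv\<^bsub>AutoGroup G\<^esub> f) (f x) = x" "f ((inv\<^bsub>AutoGroup G\<^esub> f) x) = x"
    using AutoGroup_mult[OF i assms(1,2)] AutoGroup_mult[OF assms(1) i assms(2)] AutoGroup_one[OF
      assms(2)] by auto
qed

lemma (in group) auto_int_pow:
  assumes "f \<in> auto G" "x \<in> carrier G"
  shows "f (x [^] (k::int)) = f x [^] k"
  using group_hom.hom_int_pow[OF auto_group_hom[OF assms(1)] assms(2)] .

lemma (in group) AutoGroup_nat_pow:
  assumes "f \<in> auto G" "x \<in> carrier G"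
  shows "(f [^]\<^bsub>AutoGroup G\<^esub> (k::nat)) x = (f ^^ k) x"
  using assms(2)
proof (induction k arbitrary: x)
  case (Suc k)
  interpret A: group "AutoGroup G" by (rule AutoGroup)
  have "f [^]\<^bsub>AutoGroup G\<^esub> k \<in> auto G" using A.nat_pow_closed[of f k] assms(1) by simp
  then have "(f [^]\<^bsub>AutoGroup G\<^esub> Suc k) x = (f [^]\<^bsub>AutoGroup G\<^esub> k) (f x)"
    using AutoGroup_mult assms(1) Suc.prems by simp
  then show ?case using Suc autoD(2)[OF assms(1)] by (simp add: funpow_swap1)
qed (simp add: AutoGroup_one)

text \<open>An automorphism acts on a generator \<open>a\<close> as a power map, so automorphisms
  commute, and it is determined by the image of \<open>a\<close>, for which the unit is
  excluded.\<close>

lemma (in group) AutoGroup_cyclic: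
  assumes fin: "finite (carrier G)" and a: "a \<in> carrier G"
    "\<And>x. x \<in> carrier G \<Longrightarrow> \<exists>k::int. x = a [^] k"
    and nt: "order G > 1"
  shows "comm_group (AutoGroup G)" "order (AutoGroup G) \<le> order G - 1"
proof -
  interpret A: group "AutoGroup G" by (rule AutoGroup)
  have fg: "f (g x) = g (f x)" if f: "f \<in> auto G" and g: "g \<in> auto G"
    and x: "x \<in> carrier G" for f g x
  proof -
    obtain i :: int where i: "f a = a [^] i" using a(2) autoD(2)[OF f a(1)] by blast
    obtain j :: int where j: "g a = a [^] j" using a(2) autoD(2)[OF g a(1)] by blast
    obtain k :: int where k: "x = a [^] k" using a(2) x by blast
    show ?thesis
      using i j k a(1) auto_int_pow[OF f a(1)] auto_int_pow[OF g a(1)]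
      by (simp add: int_pow_pow mult_ac)
  qed
  show "comm_group (AutoGroup G)"
  proof (rule A.group_comm_groupI)
    fix f g assume "f \<in> carrier (AutoGroup G)" "g \<in> carrier (AutoGroup G)"
    then have f: "f \<in> auto G" "g \<in> auto G" by auto
    then show "f \<otimes>\<^bsub>AutoGroup G\<^esub> g = g \<otimes>\<^bsub>AutoGroup G\<^esub> f"
      using A.m_closed[of f g] A.m_closed[of g f]
      by (intro auto_eqI[of _ G]) (auto simp: AutoGroup_mult fg)
  qed
  have "inj_on (\<lambda>f. f a) (auto G)"
  proof (rule inj_onI)
    fix f g assume f: "f \<in> auto G" and g: "g \<in> auto G" and eq: "f a = g a"
    show "f = g"
    proof (rule auto_eqI[OF f g])
      fix x assume "x \<in> carrier G"
      then obtain k :: int where "x = a [^] k" using a(2) by blast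
      then show "f x = g x" using eq auto_int_pow[OF f a(1)] auto_int_pow[OF g a(1)] by simp
    qed
  qed
  moreover have "(\<lambda>f. f a) ` auto G \<subseteq> carrier G - {\<one>}"
  proof (rule image_subsetI)
    fix f assume f: "f \<in> auto G"
    interpret f: group_hom G G f using auto_group_hom[OF f] .
    have "f a \<noteq> \<one>"
    proof
      assume "f a = \<one>"
      then have "a = \<one>" using inj_onD[OF autoD(3)[OF f], of a \<one>] a(1) by simp
      then have "carrier G = {\<one>}" using a(2) by force
      then show False using nt by (simp add: order_def)
    qed
    then show "f a \<in> carrier G - {\<one>}" using autoD(2)[OF f a(1)] by simp
  qed
  ultimately have "card (auto G) \<le> card (carrier G - {\<one>})" using fin by (intro card_inj_on_le) auto
  then show "order (AutoGroup G) \<le> order G - 1" using fin by (simp add: order_def)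
qed

text \<open>Let t^2 = a t + b modulo p and s = i + j t. The two divisibilities state, coefficient by
  coefficient, that s satisfies the same equation s^2 = a s + b. If s is not a scalar and the
  discriminant is nonzero, then s is one of the two roots t and a - t.\<close>

lemma quadratic_conjugate_cong:
  fixes p a b i j :: int
  assumes p: "prime p" and e1: "p dvd i * i + b * j * j - b - a * i"
    and e2: "p dvd 2 * i * j + a * j * j - a * j"
    and j: "\<not> p dvd j" and disc: "p = 2 \<or> \<not> p dvd a * a + 4 * b"
  shows "p dvd i \<and> p dvd j - 1 \<or> p dvd i - a \<and> p dvd j + 1"
proof -
  define D where "D = 2 * i + a * j - a"
  define E where "E = i * i + b * j * j - b - a * i"
  have "p dvd j * D" using e2 by (simp add: D_def algebra_simps)
  then have D: "p dvd D" using prime_dvd_multD[OF p] j by blast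
  show ?thesis
  proof (cases "p = 2")
    case True
    \<comment> \<open>For p = 2 both conclusions on j hold as soon as j is odd, and the first
      equation leaves i (i - a) even.\<close>
    have jo: "odd j" using j True by simp
    then have "even (i * (i - a))" using e1 True by (auto simp: algebra_simps)
    then have "even i \<or> even (i - a)" by simp
    then show ?thesis using jo True by auto
  next
    case False
    \<comment> \<open>Completing the square: 4 \<open>E\<close> is the difference of (2 i - a)^2 and
      a^2, plus 4 b (j^2 - 1), while \<open>D * (D - 2 * a * j)\<close> equals (2 i - a)^2 - a^2
      j^2.\<close>
    have "(a * a + 4 * b) * ((j - 1) * (j + 1)) = 4 * E - D * (D - 2 * a * j)"
      by (simp add: D_def E_def algebra_simps)
    moreover have "p dvd E" using e1 by (simp only: E_def)
    ultimately have "p dvd (a * a + 4 * b) * ((j - 1) * (j + 1))"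
      using D by (simp only: dvd_diff dvd_mult dvd_mult2)
    then have jj: "p dvd j - 1 \<or> p dvd j + 1"
      using prime_dvd_multD[OF p] disc False by blast
    have p2: "\<not> p dvd 2"
    proof
      assume "p dvd 2"
      then have "p = 2" using p two_is_prime primes_dvd_imp_eq by blast
      then show False using False by simp
    qed
    show ?thesis
    proof (rule disjE[OF jj])
      assume h: "p dvd j - 1"
      have "2 * i = D - a * (j - 1)" by (simp add: D_def algebra_simps)
      then have "p dvd 2 * i" using h D by simp
      then show ?thesis using h prime_dvd_multD[OF p] p2 by blast
    next
      assume h: "p dvd j + 1"
      have "2 * (i - a) = D - a * (j + 1)" by (simp add: D_def algebra_simps)
      then have "p dvd 2 * (i - a)" using h D by simp
      then show ?thesis using h prime_dvd_multD[OF p] p2 by blast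
    qed
  qed
qed

text \<open>A plane over the field with p elements, written multiplicatively: scalars are integer
  exponents, which matter only modulo p, and \<open>AutoGroup G\<close> plays the role of GL(2,
  p).\<close>

locale rank_two = comm_group G for G (structure) +
  fixes p :: nat
  assumes prime_p: "prime p" and order_p: "order G = p ^ 2"
    and exponent: "\<And>x. x \<in> carrier G \<Longrightarrow> x [^] p = \<one>"
begin

lemma finite_carrier: "finite (carrier G)"
  using order_gt_0_iff_finite order_p prime_gt_0_nat[OF prime_p] by simp

lemma int_pow_eq_one_iff:
  assumes "x \<in> carrier G" "x \<noteq> \<one>"
  shows "x [^] (k::int) = \<one> \<longleftrightarrow> int p dvd k"
proof -
  have "ord x dvd p" using exponent[OF assms(1)] pow_eq_id[OF assms(1)] by simp
  then have "ord x = p" using assms prime_p ord_eq_1 by (auto simp: prime_nat_iff)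
  then show ?thesis using int_pow_eq_id[OF assms(1)] by simp
qed

lemma int_pow_cong:
  assumes "x \<in> carrier G" "int p dvd k - l"
  shows "x [^] k = x [^] l"
proof (cases "x = \<one>")
  case False
  then have "x [^] (k - l) = \<one>" using int_pow_eq_one_iff assms by blast
  then show ?thesis using assms(1)
    by (simp add: int_pow_diff) (metis int_pow_closed inv_equality inv_inv inv_closed)
qed simp

definition basis :: "'a \<Rightarrow> 'a \<Rightarrow> bool"
  where "basis v w \<longleftrightarrow> v \<in> carrier G \<and> w \<in> carrier G \<and> v \<noteq> \<one> \<and> (\<forall>k::int. w \<noteq> v [^] k)"

lemma basis_eq_one:
  assumes vw: "basis v w" and eq: "v [^] (i::int) \<otimes> w [^] (j::int) = \<one>"
  shows "int p dvd i \<and> int p dvd j"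
proof -
  have c: "v \<in> carrier G" "w \<in> carrier G" "v \<noteq> \<one>" "\<And>k::int. w \<noteq> v [^] k" using vw
    by (auto simp: basis_def)
  have j: "int p dvd j"
  proof (rule ccontr)
    assume "\<not> int p dvd j"
    then have "coprime j (int p)" using prime_p
      by (metis coprime_commute prime_imp_coprime prime_nat_int_transfer)
    then obtain k where k: "[j * k = 1] (mod int p)" using cong_solve_coprime_int by blast
    have "w = w [^] (j * k)" using int_pow_cong[OF c(2), of "j * k" 1] k c(2)
      by (simp add: cong_iff_dvd_diff)
    also have "\<dots> = (w [^] j) [^] k" using c(2) by (simp add: int_pow_pow)
    also have "w [^] j = v [^] (- i)"
      using eq c(1,2) by (simp add: int_pow_neg) (metis int_pow_closed inv_equality inv_inv m_comm)
    finally show False using c by (simp add: int_pow_pow)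
  qed
  then have "w [^] j = \<one>" using int_pow_cong[OF c(2), of j 0] by simp
  then have "v [^] i = \<one>" using eq c by simp
  then show ?thesis using int_pow_eq_one_iff c j by blast
qed

lemma basis_eq_iff:
  assumes vw: "basis v w"
  shows "v [^] (i::int) \<otimes> w [^] (j::int) = v [^] (i'::int) \<otimes> w [^] (j'::int)
    \<longleftrightarrow> int p dvd i - i' \<and> int p dvd j - j'"
proof
  have c: "v \<in> carrier G" "w \<in> carrier G" using vw by (auto simp: basis_def)
  assume eq: "v [^] i \<otimes> w [^] j = v [^] i' \<otimes> w [^] j'"
  have "v [^] (i - i') \<otimes> w [^] (j - j') = (v [^] i \<otimes> w [^] j) \<otimes> inv (v [^] i' \<otimes> w [^] j')"
    using c by (simp add: int_pow_diff inv_mult m_ac)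
  also have "\<dots> = \<one>" using eq c by simp
  finally show "int p dvd i - i' \<and> int p dvd j - j'" using basis_eq_one[OF vw] by blast
next
  assume "int p dvd i - i' \<and> int p dvd j - j'"
  then show "v [^] i \<otimes> w [^] j = v [^] i' \<otimes> w [^] j'"
    using vw int_pow_cong[of v i i'] int_pow_cong[of w j j'] by (simp add: basis_def)
qed

text \<open>The p^2 products with exponents in {0, ..., p - 1} are pairwise distinct and therefore
  exhaust a group of order p^2.\<close>

lemma basis_span:
  assumes vw: "basis v w" and x: "x \<in> carrier G"
  obtains i j :: int where "x = v [^] i \<otimes> w [^] j"
proof -
  have c: "v \<in> carrier G" "w \<in> carrier G" using vw by (auto simp: basis_def)
  let ?f = "\<lambda>(i::int, j::int). v [^] i \<otimes> w [^] j"
  let ?S = "{0..<int p} \<times> {0..<int p}"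
  have small: "k = l" if "k \<in> {0..<int p}" "l \<in> {0..<int p}" "int p dvd k - l" for k l
    using that by (metis atLeastLessThan_iff cong_iff_dvd_diff cong_less_imp_eq_int)
  have "inj_on ?f ?S"
    using small by (intro inj_onI) (auto simp: basis_eq_iff[OF vw])
  then have "card (?f ` ?S) = p ^ 2"
    by (simp add: card_image card_cartesian_product power2_eq_square)
  moreover have "?f ` ?S \<subseteq> carrier G" using c by auto
  ultimately have "?f ` ?S = carrier G"
    using order_p finite_carrier by (intro card_subset_eq) (auto simp: order_def)
  then show ?thesis using x that by force
qed

lemma basis_exists:
  assumes "v \<in> carrier G" "v \<noteq> \<one>"
  obtains w where "basis v w"
proof -
  let ?S = "(\<lambda>k. v [^] k) ` {0..<int p}"
  have "card ?S \<le> p" using card_image_le[of "{0..<int p}" "\<lambda>k. v [^] k"] by simp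
  also have "p < p ^ 2" using prime_gt_1_nat[OF prime_p] by (simp add: power2_eq_square)
  finally have "card ?S < card (carrier G)" using order_p by (simp add: order_def)
  then have "\<not> carrier G \<subseteq> ?S" using card_mono[of ?S "carrier G"] by auto
  then obtain w where w: "w \<in> carrier G" "w \<notin> ?S" by blast
  have "w \<noteq> v [^] k" for k :: int
  proof -
    have "v [^] k = v [^] (k mod int p)" using assms(1)
      by (intro int_pow_cong) (auto simp: mod_eq_dvd_iff[symmetric])
    moreover have "k mod int p \<in> {0..<int p}" using prime_gt_0_nat[OF prime_p] by simp
    ultimately show ?thesis using w(2) by auto
  qed
  then show ?thesis using that w assms by (auto simp: basis_def)
qed

lemma nontrivial: obtains v where "v \<in> carrier G" "v \<noteq> \<one>"
proof -
  have "card (carrier G) > 1"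
    using order_p one_less_power[OF prime_gt_1_nat[OF prime_p], of 2] by (simp only: order_def)
  then have "\<not> carrier G \<subseteq> {\<one>}" using card_mono[of "{\<one>}" "carrier G"] by auto
  then show ?thesis using that by blast
qed

definition scalars :: "('a \<Rightarrow> 'a) set"
  where "scalars = {t \<in> auto G. \<exists>k::int. \<forall>x\<in>carrier G. t x = x [^] k}"

text \<open>If every vector is an eigenvector, the eigenvalues at v, w and
  \<open>v \<otimes> w\<close> agree by independence of v and w.\<close>

lemma scalars_iff:
  assumes t: "t \<in> auto G"
  shows "t \<in> scalars \<longleftrightarrow> (\<forall>x\<in>carrier G. \<exists>k::int. t x = x [^] k)"
proof
  assume pw: "\<forall>x\<in>carrier G. \<exists>k::int. t x = x [^] k"
  interpret t: group_hom G G t using auto_group_hom[OF t] .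
  obtain v where v: "v \<in> carrier G" "v \<noteq> \<one>" using nontrivial .
  obtain w where vw: "basis v w" using basis_exists[OF v] .
  then have w: "w \<in> carrier G" by (simp add: basis_def)
  obtain a b c :: int where abc: "t v = v [^] a" "t w = w [^] b" "t (v \<otimes> w) = (v \<otimes> w) [^] c"
    using pw v w by (meson m_closed)
  then have "v [^] a \<otimes> w [^] b = v [^] c \<otimes> w [^] c" using v w by (simp add: int_pow_distrib)
  then have "int p dvd a - c" "int p dvd b - c" using basis_eq_iff[OF vw] by auto
  then have tvw: "t v = v [^] c" "t w = w [^] c" using abc v w int_pow_cong by auto
  have "t x = x [^] c" if x: "x \<in> carrier G" for x
  proof -
    obtain i j :: int where "x = v [^] i \<otimes> w [^] j" using basis_span[OF vw x] .
    then show ?thesis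
      using v w tvw auto_int_pow[OF t] by (simp add: int_pow_distrib int_pow_pow mult.commute)
  qed
  then show "t \<in> scalars" using t by (auto simp: scalars_def)
qed (auto simp: scalars_def)

lemma scalars_central:
  assumes s: "s \<in> scalars" and t: "t \<in> auto G"
  shows "s \<otimes>\<^bsub>AutoGroup G\<^esub> t = t \<otimes>\<^bsub>AutoGroup G\<^esub> s"
proof -
  interpret A: group "AutoGroup G" by (rule AutoGroup)
  obtain k :: int where k: "s \<in> auto G" "\<And>x. x \<in> carrier G \<Longrightarrow> s x = x [^] k" using s
    by (auto simp: scalars_def)
  show ?thesis
  proof (rule auto_eqI[of _ G])
    fix x assume "x \<in> carrier G"
    then show "(s \<otimes>\<^bsub>AutoGroup G\<^esub> t) x = (t \<otimes>\<^bsub>AutoGroup G\<^esub> s) x"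
      using k t autoD(2)[OF t] by (simp add: AutoGroup_mult auto_int_pow)
  qed (use A.m_closed[of s t] A.m_closed[of t s] k(1) t in auto)
qed

lemma scalars_subgroup: "subgroup scalars (AutoGroup G)"
proof -
  interpret A: group "AutoGroup G" by (rule AutoGroup)
  have inv_in: "inv\<^bsub>AutoGroup G\<^esub> s \<in> scalars" if s: "s \<in> scalars" for s
  proof -
    obtain k :: int where k: "s \<in> auto G" "\<And>x. x \<in> carrier G \<Longrightarrow> s x = x [^] k" using s
      by (auto simp: scalars_def)
    obtain v where v: "v \<in> carrier G" "v \<noteq> \<one>" using nontrivial .
    have "\<not> int p dvd k"
    proof
      assume "int p dvd k"
      then have "s v = s \<one>" using k(2) int_pow_cong[OF v(1), of k 0] v(1) by simp
      then show False using inj_onD[OF autoD(3)[OF k(1)]] v by blast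
    qed
    then have "coprime k (int p)" using prime_p
      by (metis coprime_commute prime_imp_coprime prime_nat_int_transfer)
    then obtain l where l: "[k * l = 1] (mod int p)" using cong_solve_coprime_int by blast
    have "(inv\<^bsub>AutoGroup G\<^esub> s) x = x [^] l" if x: "x \<in> carrier G" for x
    proof -
      have "s (x [^] l) = x [^] (l * k)" using k(2) x by (simp add: int_pow_pow)
      also have "\<dots> = x" using int_pow_cong[OF x, of "l * k" 1] l x
        by (simp add: cong_iff_dvd_diff mult.commute)
      finally have "s (x [^] l) = x" .
      then show ?thesis using AutoGroup_inv(2)[OF k(1), of "x [^] l"] x by simp
    qed
    then show ?thesis using AutoGroup_inv(1)[OF k(1) v(1)] by (auto simp: scalars_def)
  qed
  show ?thesis
  proof (rule A.subgroupI)
    show "scalars \<subseteq> carrier (AutoGroup G)" by (auto simp: scalars_def)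
    have "\<one>\<^bsub>AutoGroup G\<^esub> \<in> auto G" using A.one_closed by simp
    then have "\<one>\<^bsub>AutoGroup G\<^esub> \<in> scalars"
      by (auto simp: scalars_def AutoGroup_one intro!: exI[of _ 1])
    then show "scalars \<noteq> {}" by blast
    fix s t assume st: "s \<in> scalars" "t \<in> scalars"
    then obtain k l :: int where kl: "s \<in> auto G" "t \<in> auto G"
      "\<And>x. x \<in> carrier G \<Longrightarrow> s x = x [^] k" "\<And>x. x \<in> carrier G \<Longrightarrow> t x = x [^] l"
        by (auto simp: scalars_def)
    then have "(s \<otimes>\<^bsub>AutoGroup G\<^esub> t) x = x [^] (l * k)" if "x \<in> carrier G" for x
      using that by (simp add: AutoGroup_mult int_pow_pow)
    then show "s \<otimes>\<^bsub>AutoGroup G\<^esub> t \<in> scalars" using A.m_closed[of s t] kl(1,2)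
      by (auto simp: scalars_def)
  qed (use inv_in in auto)
qed

lemma card_scalars: "card scalars \<le> p - 1"
proof -
  obtain v where v: "v \<in> carrier G" "v \<noteq> \<one>" using nontrivial .
  let ?S = "(\<lambda>k. v [^] k) ` {1..<int p}"
  have "card scalars \<le> card ?S"
  proof (rule card_inj_on_le[where f = "\<lambda>t. t v"])
    show "inj_on (\<lambda>t. t v) scalars"
    proof (rule inj_onI)
      fix s t assume st: "s \<in> scalars" "t \<in> scalars" "s v = t v"
      then obtain k l :: int where kl: "s \<in> auto G" "t \<in> auto G"
        "\<And>x. x \<in> carrier G \<Longrightarrow> s x = x [^] k" "\<And>x. x \<in> carrier G \<Longrightarrow> t x = x [^] l"
          by (auto simp: scalars_def)
      then have "v [^] k = v [^] l" using st(3) v by simp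
      then have "v [^] (k - l) = \<one>" using v by (simp add: int_pow_diff)
      then have "int p dvd k - l" using int_pow_eq_one_iff[OF v] by simp
      then show "s = t" using kl int_pow_cong by (intro auto_eqI[of _ G]) auto
    qed
    show "(\<lambda>t. t v) ` scalars \<subseteq> ?S"
    proof (rule image_subsetI)
      fix t assume t: "t \<in> scalars"
      then obtain k :: int where k: "t \<in> auto G" "t v = v [^] k" using v by (auto simp: scalars_def)
      interpret t: group_hom G G t using auto_group_hom[OF k(1)] .
      have "t v \<noteq> \<one>" using inj_onD[OF autoD(3)[OF k(1)], of v \<one>] v by auto
      have "v [^] k = v [^] (k mod int p)" using v(1)
        by (intro int_pow_cong) (auto simp: mod_eq_dvd_iff[symmetric])
      moreover have "k mod int p \<noteq> 0" using calculation k(2) \<open>t v \<noteq> \<one>\<close> by (metis int_pow_0)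
      moreover have "0 \<le> k mod int p" "k mod int p < int p" using prime_gt_0_nat[OF prime_p]
        by simp_all
      ultimately have "t v = v [^] (k mod int p)" "k mod int p \<in> {1..<int p}" using k(2) by auto
      then show "t v \<in> ?S" by blast
    qed
  qed simp
  also have "\<dots> \<le> p - 1" using card_image_le[of "{1..<int p}" "\<lambda>k. v [^] k"] by simp
  finally show ?thesis .
qed

text \<open>Companion form: v is a cyclic vector, and t satisfies t^2 = a t + b, so a is its trace
  and -b its determinant modulo p.\<close>

definition quad :: "('a \<Rightarrow> 'a) \<Rightarrow> 'a \<Rightarrow> int \<Rightarrow> int \<Rightarrow> bool"
  where "quad t v a b \<longleftrightarrow> t \<in> auto G \<and> basis v (t v) \<and> (\<forall>x\<in>carrier G. t (t x) = x [^] b \<otimes> t x [^] a)"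

lemma hom_eq_on_basis:
  assumes vw: "basis v w" and f: "f \<in> hom G G" "f' \<in> hom G G" and eq: "f v = f' v" "f w = f' w"
    and x: "x \<in> carrier G"
  shows "f x = f' x"
proof -
  interpret f: group_hom G G f using f(1) by (simp add: group_hom_def group_hom_axioms_def)
  interpret f': group_hom G G f' using f(2) by (simp add: group_hom_def group_hom_axioms_def)
  obtain i j :: int where "x = v [^] i \<otimes> w [^] j" using basis_span[OF vw x] .
  then show ?thesis using vw eq by (simp add: basis_def f.hom_int_pow f'.hom_int_pow)
qed

text \<open>A non-scalar t moves some v off its line. The quadratic relation holds at v by expanding
  \<open>t (t v)\<close> in the basis v, \<open>t v\<close>, then at \<open>t v\<close> by applying
  t, and so everywhere.\<close>

lemma quad_exists:
  assumes t: "t \<in> auto G" "t \<notin> scalars"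
  obtains v a b where "quad t v a b"
proof -
  obtain v where v: "v \<in> carrier G" "\<And>k::int. t v \<noteq> v [^] k" using scalars_iff[OF t(1)] t(2)
    by blast
  have tv: "t v \<in> carrier G" using autoD(2)[OF t(1) v(1)] .
  have "v \<noteq> \<one>"
  proof
    assume "v = \<one>"
    then have "t v = v [^] (0::int)" using group_hom.hom_one[OF auto_group_hom[OF t(1)]] by simp
    then show False using v(2) by blast
  qed
  then have b: "basis v (t v)" using v tv by (simp add: basis_def)
  obtain b a :: int where ab: "t (t v) = v [^] b \<otimes> t v [^] a"
    using basis_span[OF b autoD(2)[OF t(1) tv]] .
  have "t (t x) = x [^] b \<otimes> t x [^] a" if x: "x \<in> carrier G" for x
  proof (rule hom_eq_on_basis[OF b, of "\<lambda>x. t (t x)" "\<lambda>x. x [^] b \<otimes> t x [^] a"])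
    show "(\<lambda>x. t (t x)) \<in> hom G G" "(\<lambda>x. x [^] b \<otimes> t x [^] a) \<in> hom G G"
      using autoD(1,2)[OF t(1)] by (auto simp: hom_def int_pow_distrib m_ac)
    show "t (t (t v)) = t v [^] b \<otimes> t (t v) [^] a"
      using ab v(1) tv hom_mult[OF autoD(1)[OF t(1)], of "v [^] b"
        "t v [^] a"] auto_int_pow[OF t(1)] by simp
  qed (use ab b x in auto)
  then show ?thesis using that t(1) b by (auto simp: quad_def)
qed

text \<open>Both s and i + j t commute with t, so they agree everywhere once they agree at the
  cyclic vector v.\<close>

lemma centralizer_quad:
  assumes q: "quad t v a b" and s: "s \<in> auto G" "\<And>x. x \<in> carrier G \<Longrightarrow> s (t x) = t (s x)"
  obtains i j :: int where "\<And>x. x \<in> carrier G \<Longrightarrow> s x = x [^] i \<otimes> t x [^] j"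
proof -
  have t: "t \<in> auto G" and vw: "basis v (t v)" using q by (auto simp: quad_def)
  have v: "v \<in> carrier G" "t v \<in> carrier G" using vw by (auto simp: basis_def)
  obtain i j :: int where ij: "s v = v [^] i \<otimes> t v [^] j"
    using basis_span[OF vw autoD(2)[OF s(1) v(1)]] .
  have "s x = x [^] i \<otimes> t x [^] j" if x: "x \<in> carrier G" for x
  proof (rule hom_eq_on_basis[OF vw, of s "\<lambda>x. x [^] i \<otimes> t x [^] j"])
    show "s \<in> hom G G" using autoD(1)[OF s(1)] .
    show "(\<lambda>x. x [^] i \<otimes> t x [^] j) \<in> hom G G"
      using autoD(1,2)[OF t] by (auto simp: hom_def int_pow_distrib m_ac)
    show "s (t v) = t v [^] i \<otimes> t (t v) [^] j"
      using s(2)[OF v(1)] ij v hom_mult[OF autoD(1)[OF t], of "v [^] i"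
        "t v [^] j"] auto_int_pow[OF t] by simp
  qed (use ij x in auto)
  then show ?thesis using that by blast
qed

lemma AutoGroup_centralizerD:
  assumes "s \<in> group.centralizer (AutoGroup G) {t}" "t \<in> auto G" "x \<in> carrier G"
  shows "s \<in> auto G" "s (t x) = t (s x)"
proof -
  interpret A: group "AutoGroup G" by (rule AutoGroup)
  show s: "s \<in> auto G" using assms(1) by (simp add: A.centralizer_def)
  have "(s \<otimes>\<^bsub>AutoGroup G\<^esub> t) x = (t \<otimes>\<^bsub>AutoGroup G\<^esub> s) x" using assms(1)
    by (simp add: A.centralizer_def)
  then show "s (t x) = t (s x)" using AutoGroup_mult s assms(2,3) by metis
qed

text \<open>Whatever commutes with t is a polynomial i + j t in t, hence commutes with everything
  else that commutes with t.\<close>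

lemma centralizer_nonscalar_comm:
  assumes t: "t \<in> auto G" "t \<notin> scalars"
    and s: "s \<in> group.centralizer (AutoGroup G) {t}" "s' \<in> group.centralizer (AutoGroup G) {t}"
  shows "s \<otimes>\<^bsub>AutoGroup G\<^esub> s' = s' \<otimes>\<^bsub>AutoGroup G\<^esub> s"
proof -
  interpret A: group "AutoGroup G" by (rule AutoGroup)
  obtain v a b where q: "quad t v a b" using quad_exists[OF t] .
  note sD = AutoGroup_centralizerD[OF s(1) t(1)] and sD' = AutoGroup_centralizerD[OF s(2) t(1)]
  have sa: "s \<in> auto G" "s' \<in> auto G" using sD(1) sD'(1) one_closed by blast+
  obtain i j :: int where ij: "\<And>x. x \<in> carrier G \<Longrightarrow> s' x = x [^] i \<otimes> t x [^] j"
    using centralizer_quad[OF q sa(2) sD'(2)] by blast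
  show ?thesis
  proof (rule auto_eqI[of _ G])
    fix x assume x: "x \<in> carrier G"
    have c: "s x \<in> carrier G" "t x \<in> carrier G" using autoD(2)[OF sa(1) x] autoD(2)[OF t(1) x]
      by auto
    have "s (s' x) = s x [^] i \<otimes> s (t x) [^] j"
      using ij[OF x] x c hom_mult[OF autoD(1)[OF sa(1)], of "x [^] i"
        "t x [^] j"] auto_int_pow[OF sa(1)] by simp
    also have "\<dots> = s' (s x)" using ij[OF c(1)] sD(2)[OF x] by simp
    finally show "(s \<otimes>\<^bsub>AutoGroup G\<^esub> s') x = (s' \<otimes>\<^bsub>AutoGroup G\<^esub> s) x"
      using AutoGroup_mult sa x by metis
  qed (use A.m_closed[of s s'] A.m_closed[of s' s] sa in auto)
qed

text \<open>An element of the centralizer is determined by its value at a cyclic vector, and this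
  value is one of the p^2 - 1 nontrivial elements.\<close>

lemma card_centralizer_nonscalar:
  assumes t: "t \<in> auto G" "t \<notin> scalars"
  shows "card (group.centralizer (AutoGroup G) {t}) \<le> p ^ 2 - 1"
proof -
  obtain v a b where q: "quad t v a b" using quad_exists[OF t] .
  have vw: "basis v (t v)" using q by (simp add: quad_def)
  have v: "v \<in> carrier G" "v \<noteq> \<one>" using vw by (auto simp: basis_def)
  have "card (group.centralizer (AutoGroup G) {t}) \<le> card (carrier G - {\<one>})"
  proof (rule card_inj_on_le[where f = "\<lambda>s. s v"])
    show "inj_on (\<lambda>s. s v) (group.centralizer (AutoGroup G) {t})"
    proof (rule inj_onI)
      fix s s' assume s: "s \<in> group.centralizer (AutoGroup G) {t}"
        "s' \<in> group.centralizer (AutoGroup G) {t}" "s v = s' v"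
      note sD = AutoGroup_centralizerD[OF s(1) t(1) v(1)]
        and sD' = AutoGroup_centralizerD[OF s(2) t(1) v(1)]
      have "s (t v) = s' (t v)" using sD(2) sD'(2) s(3) by simp
      then show "s = s'"
        using hom_eq_on_basis[OF vw autoD(1)[OF sD(1)] autoD(1)[OF sD'(1)] s(3)] sD(1) sD'(1)
        by (intro auto_eqI[of _ G]) auto
    qed
    show "(\<lambda>s. s v) ` group.centralizer (AutoGroup G) {t} \<subseteq> carrier G - {\<one>}"
    proof (rule image_subsetI)
      fix s assume "s \<in> group.centralizer (AutoGroup G) {t}"
      then have s: "s \<in> auto G" using AutoGroup_centralizerD(1) t(1) v(1) by blast
      interpret s: group_hom G G s using auto_group_hom[OF s] .
      have "s v \<noteq> \<one>" using inj_onD[OF autoD(3)[OF s], of v \<one>] v by auto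
      then show "s v \<in> carrier G - {\<one>}" using autoD(2)[OF s v(1)] by simp
    qed
  qed (use finite_carrier in auto)
  also have "\<dots> = p ^ 2 - 1" using finite_carrier order_p by (simp add: order_def)
  finally show ?thesis .
qed

text \<open>
  If the discriminant \<open>a\<^sup>2 + 4 b\<close> of \<open>t\<^sup>2 = a t + b\<close> vanishes, then \<open>t = c + n\<close> with \<open>2 c = a\<close> and
  \<open>n\<^sup>2 = 0\<close>, so that \<open>t\<^sup>k = c\<^sup>k + k c\<^sup>k\<^sup>-\<^sup>1 n\<close>.
\<close>
lemma discriminant_nonzero:
  assumes q: "quad t v a b" and k: "(t ^^ Suc k) v = v" "coprime p (Suc k)" and p2: "p \<noteq> 2"
  shows "\<not> int p dvd a * a + 4 * b"
proof
  assume disc: "int p dvd a * a + 4 * b"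
  have t: "t \<in> auto G" and vw: "basis v (t v)"
    and tt: "\<And>x. x \<in> carrier G \<Longrightarrow> t (t x) = x [^] b \<otimes> t x [^] a"
    using q by (auto simp: quad_def)
  interpret t: group_hom G G t using auto_group_hom[OF t] .
  have v: "v \<in> carrier G" "t v \<in> carrier G" using vw by (auto simp: basis_def)
  have pp: "prime (int p)" using prime_p by simp
  have n2: "\<not> int p dvd 2" using p2 prime_p
    by (metis primes_dvd_imp_eq prime_nat_int_transfer two_is_prime of_nat_eq_iff of_nat_numeral)
  have n4: "\<not> int p dvd 4"
  proof
    assume "int p dvd 4"
    then have "int p dvd 2 * 2" by simp
    then show False using n2 prime_dvd_multD[OF pp] by blast
  qed
  have "coprime (2::int) (int p)" using n2 pp by (metis coprime_commute prime_imp_coprime)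
  then obtain c0 where c0: "[2 * c0 = 1] (mod int p)" using cong_solve_coprime_int by blast
  \<comment> \<open>Half of a modulo p, the double root of x^2 - a x - b.\<close>
  define c where "c = a * c0"
  have "2 * c - a = a * (2 * c0 - 1)" by (simp add: c_def algebra_simps)
  then have ca: "int p dvd 2 * c - a" using c0 by (simp add: cong_iff_dvd_diff)
  have "4 * (b + c * c) = (a * a + 4 * b) + (2 * c - a) * (2 * c + a)" by (simp add: algebra_simps)
  moreover have "int p dvd (a * a + 4 * b) + (2 * c - a) * (2 * c + a)"
    by (rule dvd_add[OF disc dvd_mult2[OF ca]])
  ultimately have "int p dvd 4 * (b + c * c)" by (simp only:)
  then have bc: "int p dvd b + c * c" using prime_dvd_multD[OF pp] n4 by blast
  have tc: "t (t x) = x [^] (- (c * c)) \<otimes> t x [^] (2 * c)" if x: "x \<in> carrier G" for x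
  proof -
    have "x [^] b = x [^] (- (c * c))" using int_pow_cong[OF x, of b "- (c * c)"] bc by simp
    moreover have "t x [^] a = t x [^] (2 * c)"
      using int_pow_cong[of "t x" a "2 * c"] x ca by (simp add: dvd_diff_commute)
    ultimately show ?thesis using tt[OF x] by simp
  qed
  have comb: "y [^] r \<otimes> (x [^] s \<otimes> y [^] e) [^] l = x [^] (s * l) \<otimes> y [^] (r + e * l)"
    if "x \<in> carrier G" "y \<in> carrier G" for x y and r s e l :: int
    using that by (simp add: int_pow_distrib int_pow_pow int_pow_mult m_lcomm)
  \<comment> \<open>The expansion of t^(m+1) with n = t - c, sorted by coordinates: t^(m+1) = - m
    c^(m+1) + (m+1) c^m t.\<close>
  have pow: "(t ^^ Suc m) v = v [^] (- int m * c ^ Suc m) \<otimes> t v [^] (int (Suc m) * c ^ m)" for m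
  proof (induction m)
    case (Suc m)
    have "(t ^^ Suc (Suc m)) v = t (v [^] (- int m * c ^ Suc m) \<otimes> t v [^] (int (Suc m) * c ^ m))"
      using Suc by simp
    also have "\<dots> = t v [^] (- int m * c ^ Suc m) \<otimes> (v [^] (- (c * c)) \<otimes> t v [^] (2
        * c)) [^] (int (Suc m) * c ^ m)"
      using v tc[OF v(1)] by (simp add: t.hom_int_pow del: of_nat_Suc)
    also have "\<dots> = v [^] (- (c * c) * (int (Suc m) * c ^ m)) \<otimes> t v [^] (- int m * c ^ Suc m + 2 * c
        * (int (Suc m) * c ^ m))"
      by (rule comb[OF v])
    also have "- (c * c) * (int (Suc m) * c ^ m) = - int (Suc m) * c ^ Suc (Suc m)"
      by (simp add: algebra_simps)
    also have "- int m * c ^ Suc m + 2 * c * (int (Suc m) * c ^ m) = int (Suc (Suc m)) * c ^ Suc m"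
      by (simp add: algebra_simps)
    finally show ?case .
  qed (use v in simp)
  have "v [^] (- int k * c ^ Suc k) \<otimes> t v [^] (int (Suc k) * c ^ k)
      = v [^] (1::int) \<otimes> t v [^] (0::int)"
    using pow[of k] k(1) v by simp
  \<comment> \<open>As p does not divide k + 1, it divides c. Then t^2 sends everything to the unit,
    which is impossible for an automorphism.\<close>
  then have "int p dvd int (Suc k) * c ^ k - 0" unfolding basis_eq_iff[OF vw] by (rule conjunct2)
  then have "int p dvd int (Suc k) * c ^ k" by (simp only: diff_0_right)
  moreover have "\<not> int p dvd int (Suc k)"
    using k(2) prime_p by (metis coprime_absorb_left int_dvd_int_iff not_prime_unit)
  ultimately have "int p dvd c ^ k" using prime_dvd_multD[OF pp] by blast
  then have pc: "int p dvd c" using prime_dvd_power[OF pp] by blast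
  then have "t (t v) = \<one>"
    using tc[OF v(1)] v int_pow_cong[OF v(1), of "- (c * c)" 0] int_pow_cong[OF v(2), of "2 * c" 0]
    by simp
  then have "t v = \<one>" using inj_onD[OF autoD(3)[OF t], of "t v" \<one>] v by simp
  then have "v = \<one>" using inj_onD[OF autoD(3)[OF t], of v \<one>] v by simp
  then show False using vw by (simp add: basis_def)
qed

text \<open>A conjugate s of t satisfies the quadratic equation of t, and if it commutes with t, it
  has the form i + j t. So it is t or a - t, provided that for odd p the discriminant is nonzero;
  this follows from t having order prime to p.\<close>

lemma nonscalar_conjugates:
  assumes t: "t \<in> auto G" "t \<notin> scalars" and n: "t [^]\<^bsub>AutoGroup G\<^esub> n = \<one>\<^bsub>AutoGroup G\<^esub>" "coprime p n"
    "n > 0"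
  obtains u where "\<And>h. h \<in> auto G \<Longrightarrow> h \<otimes>\<^bsub>AutoGroup G\<^esub> t
      \<otimes>\<^bsub>AutoGroup G\<^esub> inv\<^bsub>AutoGroup G\<^esub> h \<in> group.centralizer (AutoGroup G) {t}
    \<Longrightarrow> h \<otimes>\<^bsub>AutoGroup G\<^esub> t \<otimes>\<^bsub>AutoGroup G\<^esub> inv\<^bsub>AutoGroup G\<^esub> h \<in> {t, u}"
proof -
  interpret A: group "AutoGroup G" by (rule AutoGroup)
  interpret t: group_hom G G t using auto_group_hom[OF t(1)] .
  obtain v a b where q: "quad t v a b" using quad_exists[OF t] .
  have vw: "basis v (t v)" and tt: "\<And>x. x \<in> carrier G \<Longrightarrow> t (t x) = x [^] b \<otimes> t x [^] a"
    using q by (auto simp: quad_def)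
  have v: "v \<in> carrier G" "t v \<in> carrier G" using vw by (auto simp: basis_def)
  have pp: "prime (int p)" using prime_p by simp
  have disc: "int p = 2 \<or> \<not> int p dvd a * a + 4 * b"
  proof (cases "p = 2")
    case False
    obtain k where k: "n = Suc k" using n(3) gr0_implies_Suc by blast
    have "(t ^^ Suc k) v = v"
      using AutoGroup_nat_pow[OF t(1) v(1), of n] n(1) AutoGroup_one[OF v(1)] k by simp
    then show ?thesis using discriminant_nonzero[OF q] n(2) k False by blast
  qed simp
  \<comment> \<open>The second root a - t of the quadratic equation.\<close>
  define u where "u = (\<lambda>x\<in>carrier G. x [^] a \<otimes> t x [^] (- 1 :: int))"
  have "s \<in> {t, u}"
    if h: "h \<in> auto G" and s_def: "s = h \<otimes>\<^bsub>AutoGroup G\<^esub> t \<otimes>\<^bsub>AutoGroup G\<^esub> inv\<^bsub>AutoGroup G\<^esub> h"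
      and sC: "s \<in> group.centralizer (AutoGroup G) {t}" for h s
  proof -
    define g where "g = inv\<^bsub>AutoGroup G\<^esub> h"
    have g: "g \<in> auto G" "\<And>x. x \<in> carrier G \<Longrightarrow> g (h x) = x" "\<And>x. x \<in> carrier G \<Longrightarrow> h (g x) = x"
      using AutoGroup_inv[OF h] one_closed by (auto simp: g_def)
    have sa: "s \<in> auto G" and st: "\<And>x. x \<in> carrier G \<Longrightarrow> s (t x) = t (s x)"
      using AutoGroup_centralizerD[OF sC t(1)] one_closed by blast+
    interpret h: group_hom G G h using auto_group_hom[OF h] .
    interpret g: group_hom G G g using auto_group_hom[OF g(1)] .
    interpret s: group_hom G G s using auto_group_hom[OF sa] .
    have sx: "s x = h (t (g x))" if x: "x \<in> carrier G" for x
      unfolding s_def g_def[symmetric] using A.m_closed[of h t] h t(1) g(1) x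
      by (simp add: AutoGroup_mult)
    obtain i j :: int where ij: "\<And>x. x \<in> carrier G \<Longrightarrow> s x = x [^] i \<otimes> t x [^] j"
      using centralizer_quad[OF q sa st] by blast
    \<comment> \<open>Two evaluations of \<open>s (s v)\<close>: from s = i + j t, and from the
      relation s^2 = a s + b inherited from t by conjugation.\<close>
    have "v [^] (i * i + b * j * j) \<otimes> t v [^] (2 * i * j + a * j * j)
        = v [^] (b + a * i) \<otimes> t v [^] (a * j)"
    proof -
      have "s (s v) = s v [^] i \<otimes> s (t v) [^] j" using ij[OF v(1)] v by (simp add: s.hom_int_pow)
      also have "\<dots> = (v [^] i \<otimes> t v [^] j) [^] i \<otimes> (t v [^] i \<otimes> (v [^] b \<otimes> t v [^] a) [^] j) [^] j"
        using ij[OF v(1)] ij[OF v(2)] tt[OF v(1)] by simp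
      also have "\<dots> = v [^] (i * i + b * j * j) \<otimes> t v [^] (2 * i * j + a * j * j)"
      proof -
        have "v [^] (i * i + b * j * j) = v [^] (i * i) \<otimes> v [^] (b * j * j)" using v
          by (simp add: int_pow_mult)
        moreover have "2 * i * j + a * j * j = j * i + i * j + a * j * j" by simp
        then have "t v [^] (2 * i * j + a * j * j)
            = t v [^] (j * i) \<otimes> t v [^] (i * j) \<otimes> t v [^] (a * j * j)"
          using v by (simp only: int_pow_mult)
        ultimately show ?thesis using v by (simp add: int_pow_distrib int_pow_pow m_ac)
      qed
      finally have l: "s (s v) = v [^] (i * i + b * j * j) \<otimes> t v [^] (2 * i * j + a * j * j)" .
      have "s (s v) = h (t (t (g v)))" using sx v g(2) by simp
      also have "\<dots> = h (g v [^] b \<otimes> t (g v) [^] a)" using tt[of "g v"] v by simp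
      also have "\<dots> = v [^] b \<otimes> s v [^] a" using v sx[OF v(1)] g(3)[OF v(1)]
        by (simp add: h.hom_int_pow)
      also have "\<dots> = v [^] (b + a * i) \<otimes> t v [^] (a * j)"
        using ij[OF v(1)] v
        by (simp add: int_pow_distrib int_pow_pow int_pow_mult m_ac mult.commute)
      finally show ?thesis using l by simp
    qed
    then have e: "int p dvd i * i + b * j * j - b - a * i" "int p dvd 2 * i * j + a * j * j - a * j"
      using basis_eq_iff[OF vw] by (auto simp: algebra_simps)
    \<comment> \<open>Otherwise s would be a scalar, and then so would its conjugate t.\<close>
    have "\<not> int p dvd j"
    proof
      assume "int p dvd j"
      then have si: "s x = x [^] i" if "x \<in> carrier G" for x
        using ij[OF that] that int_pow_cong[of "t x" j 0] by simp
      have "t x = x [^] i" if x: "x \<in> carrier G" for x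
      proof -
        have "t x = g (s (h x))" using sx[of "h x"] g(2) x by simp
        then show ?thesis using si[of "h x"] x g(2)[OF x] by (simp add: g.hom_int_pow)
      qed
      then show False using t by (auto simp: scalars_def)
    qed
    then consider "int p dvd i" "int p dvd j - 1" | "int p dvd i - a" "int p dvd j + 1"
      using quadratic_conjugate_cong[OF pp e] disc by blast
    then show "s \<in> {t, u}"
    proof cases
      case 1
      have "s x = t x" if x: "x \<in> carrier G" for x
        using ij[OF x] x 1 int_pow_cong[OF x, of i 0] int_pow_cong[of "t x" j 1] by simp
      then show ?thesis using auto_eqI[OF sa t(1)] by blast
    next
      case 2
      have "s x = u x" if x: "x \<in> carrier G" for x
        using ij[OF x] x 2 int_pow_cong[OF x, of i a] int_pow_cong[of "t x" j "- 1"]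
        by (simp add: u_def)
      moreover have "u \<in> extensional (carrier G)" by (simp add: u_def)
      ultimately show ?thesis using extensionalityI[OF autoD(5)[OF sa]] by blast
    qed
  qed
  then show ?thesis using that by blast
qed

end

section \<open>Semidirect products\<close>

abbreviation conj_homs :: "('a, 'c) monoid_scheme \<Rightarrow> ('b, 'd) monoid_scheme \<Rightarrow> 'b \<Rightarrow> ('a \<Rightarrow> 'b) \<Rightarrow> 'a \<Rightarrow>
    'b"
  where "conj_homs Q A \<equiv> \<lambda>g. \<lambda>\<phi>\<in>homs Q A. \<lambda>q\<in>carrier Q. g \<otimes>\<^bsub>A\<^esub> \<phi> q \<otimes>\<^bsub>A\<^esub> inv\<^bsub>A\<^esub> g"

text \<open>The general orbit bound with z = p - 1 for the scalars and c = p^2 - 1 for the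
  centralizers of the other automorphisms. Coprimality of p and \<open>order Q\<close> enters
  through \<open>nonscalar_conjugates\<close>.\<close>

lemma (in rank_two) card_orbits_AutoGroup_le:
  assumes Q: "group Q" "finite (carrier Q)" "cube_free (order Q)" "solvable Q"
    and cop: "coprime p (order Q)"
  shows "card (orbits (AutoGroup G) (homs Q (AutoGroup G)) (conj_homs Q (AutoGroup G)))
    \<le> (p - 1) ^ 2 + 4 * (p - 1) * (p ^ 2 - 1) ^ 3 + (p ^ 2 - 1) ^ 2"
proof -
  interpret A: group "AutoGroup G" by (rule AutoGroup)
  have n0: "order Q > 0"
    using Q(1,2) monoid.order_gt_0_iff_finite[of Q] group.is_monoid by blast
  show ?thesis
  proof (rule A.card_conj_orbits_homs_le[OF _ Q scalars_subgroup _ card_scalars])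
    show "finite (carrier (AutoGroup G))" using finite_auto[OF finite_carrier] by simp
    fix t assume "t \<in> carrier (AutoGroup G) - scalars"
    then have t: "t \<in> auto G" "t \<notin> scalars" by auto
    show "card (A.centralizer {t}) \<le> p ^ 2 - 1" using card_centralizer_nonscalar[OF t] .
    show "a \<otimes>\<^bsub>AutoGroup G\<^esub> b = b \<otimes>\<^bsub>AutoGroup G\<^esub> a"
      if "a \<in> A.centralizer {t}" "b \<in> A.centralizer {t}" for a b
      using centralizer_nonscalar_comm[OF t that] .
    show "\<exists>u. \<forall>h\<in>carrier (AutoGroup G). h \<otimes>\<^bsub>AutoGroup G\<^esub> t
        \<otimes>\<^bsub>AutoGroup G\<^esub> inv\<^bsub>AutoGroup G\<^esub> h \<in> A.centralizer {t} \<longrightarrow>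
        h \<otimes>\<^bsub>AutoGroup G\<^esub> t \<otimes>\<^bsub>AutoGroup G\<^esub> inv\<^bsub>AutoGroup G\<^esub> h \<in> {t, u}"
      if "t [^]\<^bsub>AutoGroup G\<^esub> order Q = \<one>\<^bsub>AutoGroup G\<^esub>"
      using nonscalar_conjugates[OF t that cop n0] by (metis carrier_AutoGroup)
  qed (use scalars_central in auto)
qed

text \<open>Both groups are parametrized by the same set, possibly with repetitions. Integers can
  thus serve as exponents without reduction to normal forms.\<close>

lemma isoI_parametrized:
  assumes "e ` I = carrier G" "f ` I = carrier H"
    and iff: "\<And>i j. i \<in> I \<Longrightarrow> j \<in> I \<Longrightarrow> e i = e j \<longleftrightarrow> f i = f j"
    and mult: "\<And>i j. i \<in> I \<Longrightarrow> j \<in> I \<Longrightarrow>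
      \<exists>k\<in>I. e k = e i \<otimes>\<^bsub>G\<^esub> e j \<and> f k = f i \<otimes>\<^bsub>H\<^esub> f j"
  shows "G \<cong> H"
proof -
  define h where "h x = f (inv_into I e x)" for x
  have h: "h (e i) = f i" if "i \<in> I" for i
    unfolding h_def using iff[OF inv_into_into[of "e i" e I] that] f_inv_into_f[of "e i" e I] that
    by simp
  have eI: "\<exists>i\<in>I. x = e i" if "x \<in> carrier G" for x using that assms(1) by (metis imageE)
  have "h \<in> hom G H"
  proof (rule homI)
    fix x assume "x \<in> carrier G"
    then obtain i where "i \<in> I" "x = e i" using eI by blast
    moreover from this have "f i \<in> carrier H" using assms(2) by (metis imageI)
    ultimately show "h x \<in> carrier H" using h by simp
  next
    fix x y assume "x \<in> carrier G" "y \<in> carrier G"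
    then obtain i j where ij: "i \<in> I" "x = e i" "j \<in> I" "y = e j" using eI by metis
    then obtain k where "k \<in> I" "e k = e i \<otimes>\<^bsub>G\<^esub> e j" "f k = f i \<otimes>\<^bsub>H\<^esub> f j" using mult by metis
    then show "h (x \<otimes>\<^bsub>G\<^esub> y) = h x \<otimes>\<^bsub>H\<^esub> h y" using ij h by metis
  qed
  moreover have "bij_betw h (carrier G) (carrier H)"
  proof (rule bij_betw_imageI)
    show "inj_on h (carrier G)"
    proof (rule inj_onI)
      fix x y assume xy: "x \<in> carrier G" "y \<in> carrier G" "h x = h y"
      obtain i where i: "i \<in> I" "x = e i" using eI xy(1) by blast
      obtain j where j: "j \<in> I" "y = e j" using eI xy(2) by blast
      show "x = y" using xy(3) i j iff[OF i(1) j(1)] h by simp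
    qed
    have "h ` carrier G = h ` e ` I" using assms(1) by simp
    also have "\<dots> = f ` I" using h by (simp add: image_image)
    finally show "h ` carrier G = carrier H" using assms(2) by simp
  qed
  ultimately show ?thesis by (auto simp: is_iso_def iso_def)
qed

section \<open>Isomorphism types of the groups of order p and p^2\<close>

definition cyclic :: "('a, 'b) monoid_scheme \<Rightarrow> bool"
  where "cyclic G \<longleftrightarrow> (\<exists>a\<in>carrier G. \<forall>x\<in>carrier G. \<exists>k::int. x = a [^]\<^bsub>G\<^esub> k)"

lemma (in group) ord_cyclic_generator:
  assumes "finite (carrier G)" "a \<in> carrier G" "\<And>x. x \<in> carrier G \<Longrightarrow> \<exists>k::int. x = a [^] k"
  shows "ord a = order G"
proof -
  have "generate G {a} = carrier G" using assms(2,3) generate_pow[OF assms(2)] by auto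
  then show ?thesis using generate_pow_card[OF assms(2)] by (simp add: order_def)
qed

lemma cyclic_iso:
  assumes G: "group G" "finite (carrier G)" "cyclic G"
    and H: "group H" "finite (carrier H)" "cyclic H"
    and ord: "order G = order H"
  shows "G \<cong> H"
proof -
  interpret G: group G by fact
  interpret H: group H by fact
  obtain a where a: "a \<in> carrier G" "\<And>x. x \<in> carrier G \<Longrightarrow> \<exists>k::int. x = a [^]\<^bsub>G\<^esub> k"
    using G(3) by (auto simp: cyclic_def)
  obtain b where b: "b \<in> carrier H" "\<And>x. x \<in> carrier H \<Longrightarrow> \<exists>k::int. x = b [^]\<^bsub>H\<^esub> k"
    using H(3) by (auto simp: cyclic_def)
  have eq: "G.ord a = H.ord b"
    using G.ord_cyclic_generator[OF G(2) a] H.ord_cyclic_generator[OF H(2) b] ord by simp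
  show ?thesis
  proof (rule isoI_parametrized[where e = "\<lambda>k::int. a [^]\<^bsub>G\<^esub> k" and f = "\<lambda>k::int. b [^]\<^bsub>H\<^esub> k"
    and I = UNIV])
    show "range (\<lambda>k::int. a [^]\<^bsub>G\<^esub> k) = carrier G" using a by blast
    show "range (\<lambda>k::int. b [^]\<^bsub>H\<^esub> k) = carrier H" using b by blast
    show "(a [^]\<^bsub>G\<^esub> i = a [^]\<^bsub>G\<^esub> j) = (b [^]\<^bsub>H\<^esub> i = b [^]\<^bsub>H\<^esub> j)" for i j :: int
      using G.int_pow_eq[OF a(1)] H.int_pow_eq[OF b(1)] eq by simp
    show "\<exists>k\<in>UNIV :: int set. a [^]\<^bsub>G\<^esub> k = a [^]\<^bsub>G\<^esub> i \<otimes>\<^bsub>G\<^esub> a [^]\<^bsub>G\<^esub> j \<and> b [^]\<^bsub>H\<^esub> k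
        = b [^]\<^bsub>H\<^esub> i \<otimes>\<^bsub>H\<^esub> b [^]\<^bsub>H\<^esub> j" for i j :: int
      by (rule bexI[where x = "i + j"]) (use a(1) b(1) in \<open>simp_all add: G.int_pow_mult
        H.int_pow_mult\<close>)
  qed
qed

lemma rank_two_iso:
  assumes "rank_two G p" "rank_two H p"
  shows "G \<cong> H"
proof -
  interpret G: rank_two G p by fact
  interpret H: rank_two H p by fact
  obtain v w where vw: "G.basis v w" using G.nontrivial G.basis_exists by metis
  obtain x y where xy: "H.basis x y" using H.nontrivial H.basis_exists by metis
  have c: "v \<in> carrier G" "w \<in> carrier G" "x \<in> carrier H" "y \<in> carrier H"
    using vw xy by (auto simp: G.basis_def H.basis_def)
  show ?thesis
  proof (rule isoI_parametrized[where e = "\<lambda>(i::int, j::int). v [^]\<^bsub>G\<^esub> i \<otimes>\<^bsub>G\<^esub> w [^]\<^bsub>G\<^esub> j" and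
        f = "\<lambda>(i::int, j::int). x [^]\<^bsub>H\<^esub> i \<otimes>\<^bsub>H\<^esub> y [^]\<^bsub>H\<^esub> j" and I = UNIV])
    show "range (\<lambda>(i::int, j::int). v [^]\<^bsub>G\<^esub> i \<otimes>\<^bsub>G\<^esub> w [^]\<^bsub>G\<^esub> j) = carrier G"
      using c G.basis_span[OF vw] by (auto simp: image_iff) (metis G.basis_span[OF vw])
    show "range (\<lambda>(i::int, j::int). x [^]\<^bsub>H\<^esub> i \<otimes>\<^bsub>H\<^esub> y [^]\<^bsub>H\<^esub> j) = carrier H"
      using c H.basis_span[OF xy] by (auto simp: image_iff) (metis H.basis_span[OF xy])
    fix i j :: "int \<times> int"
    show "(case i of (i, j) \<Rightarrow> v [^]\<^bsub>G\<^esub> i \<otimes>\<^bsub>G\<^esub> w [^]\<^bsub>G\<^esub> j)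
        = (case j of (i, j) \<Rightarrow> v [^]\<^bsub>G\<^esub> i \<otimes>\<^bsub>G\<^esub> w [^]\<^bsub>G\<^esub> j) \<longleftrightarrow>
      (case i of (i, j) \<Rightarrow> x [^]\<^bsub>H\<^esub> i \<otimes>\<^bsub>H\<^esub> y [^]\<^bsub>H\<^esub> j) = (case j of (i, j) \<Rightarrow> x [^]\<^bsub>H\<^esub> i
          \<otimes>\<^bsub>H\<^esub> y [^]\<^bsub>H\<^esub> j)"
      by (simp add: G.basis_eq_iff[OF vw] H.basis_eq_iff[OF xy] split: prod.split)
    show "\<exists>k\<in>UNIV :: (int \<times> int) set. (case k of (i, j) \<Rightarrow> v [^]\<^bsub>G\<^esub> i \<otimes>\<^bsub>G\<^esub> w [^]\<^bsub>G\<^esub> j) =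
        (case i of (i, j) \<Rightarrow> v [^]\<^bsub>G\<^esub> i \<otimes>\<^bsub>G\<^esub> w [^]\<^bsub>G\<^esub> j) \<otimes>\<^bsub>G\<^esub> (case j of (i, j) \<Rightarrow> v [^]\<^bsub>G\<^esub> i
            \<otimes>\<^bsub>G\<^esub> w [^]\<^bsub>G\<^esub> j) \<and>
        (case k of (i, j) \<Rightarrow> x [^]\<^bsub>H\<^esub> i \<otimes>\<^bsub>H\<^esub> y [^]\<^bsub>H\<^esub> j) =
        (case i of (i, j) \<Rightarrow> x [^]\<^bsub>H\<^esub> i \<otimes>\<^bsub>H\<^esub> y [^]\<^bsub>H\<^esub> j) \<otimes>\<^bsub>H\<^esub> (case j of (i, j) \<Rightarrow> x [^]\<^bsub>H\<^esub> i
            \<otimes>\<^bsub>H\<^esub> y [^]\<^bsub>H\<^esub> j)"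
      by (rule bexI[where x = "(fst i + fst j, snd i + snd j)"])
        (use c in \<open>auto simp: G.int_pow_mult H.int_pow_mult G.m_ac H.m_ac split: prod.split\<close>)
  qed
qed

lemma (in group) cyclic_prime_order:
  assumes "prime p" "order G = p"
  shows "cyclic G"
proof -
  have fin: "finite (carrier G)" using assms order_gt_0_iff_finite prime_gt_0_nat by simp
  obtain x where x: "x \<in> carrier G" "x \<noteq> \<one>" using cauchy[OF fin assms(1)] assms(2) by auto
  have "ord x dvd p" using ord_dvd_group_order[OF x(1)] assms(2) by simp
  then have "ord x = p" using x assms(1) ord_eq_1 by (auto simp: prime_nat_iff)
  then have "card (generate G {x}) = order G" using generate_pow_card[OF x(1)] assms(2) by simp
  then have "generate G {x} = carrier G"
    using generate_incl[of "{x}"] x(1) fin by (intro card_subset_eq) (auto simp: order_def)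
  then show ?thesis using x(1) generate_pow[OF x(1)] by (auto simp: cyclic_def)
qed

lemma (in group) cyclic_or_rank_two:
  assumes p: "prime p" and ord: "order G = p ^ 2" and nc: "\<not> cyclic G"
  shows "rank_two G p"
proof -
  have fin: "finite (carrier G)" using p ord order_gt_0_iff_finite prime_gt_0_nat by simp
  interpret comm_group G by (rule group_comm_groupI) (rule order_prime_square_comm[OF p ord])
  show ?thesis
  proof unfold_locales
    fix x assume x: "x \<in> carrier G"
    have "ord x dvd p ^ 2" using ord_dvd_group_order[OF x] ord by simp
    then obtain i where i: "i \<le> 2" "ord x = p ^ i" using divides_primepow_nat[OF p] by blast
    have "i \<noteq> 2"
    proof
      assume "i = 2"
      then have "card (generate G {x}) = order G" using generate_pow_card[OF x] i(2) ord by simp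
      then have "generate G {x} = carrier G"
        using generate_incl[of "{x}"] x fin by (intro card_subset_eq) (auto simp: order_def)
      then have "cyclic G" using x generate_pow[OF x] by (auto simp: cyclic_def)
      then show False using nc by blast
    qed
    then have "ord x dvd p" using i by (cases i) (auto simp: less_2_cases_iff)
    then show "x [^] p = \<one>" using pow_eq_id[OF x] by blast
  qed (use p ord in auto)
qed

text \<open>\<open>G\<close> is the internal semidirect product of the images of \<open>a\<close> and \<open>b\<close>.\<close>
definition splits :: "('a, 'm) monoid_scheme \<Rightarrow> ('b, 'n) monoid_scheme \<Rightarrow> ('c, 'k) monoid_scheme \<Rightarrow>
    ('a \<Rightarrow> 'c) \<Rightarrow> ('b \<Rightarrow> 'c) \<Rightarrow> ('b \<Rightarrow> 'a \<Rightarrow> 'a) \<Rightarrow> bool"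
  where "splits P Q G a b \<phi> \<longleftrightarrow> group P \<and> group Q \<and> group G \<and> a \<in> hom P G \<and> b \<in> hom Q G \<and>
    inj_on (\<lambda>(x, q). a x \<otimes>\<^bsub>G\<^esub> b q) (carrier P \<times> carrier Q) \<and>
    (\<lambda>(x, q). a x \<otimes>\<^bsub>G\<^esub> b q) ` (carrier P \<times> carrier Q) = carrier G \<and>
    \<phi> \<in> homs Q (AutoGroup P) \<and>
    (\<forall>x\<in>carrier P. \<forall>q\<in>carrier Q. b q \<otimes>\<^bsub>G\<^esub> a x = a (\<phi> q x) \<otimes>\<^bsub>G\<^esub> b q)"

text \<open>In both groups products obey the rule (x q) (y r) = (x times the image of y under q) (q
  r), so applying \<open>\<sigma>\<close> to the first component is an isomorphism exactly because
  it intertwines the two actions.\<close>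

lemma splits_iso:
  assumes G: "splits P Q G a b \<phi>" and H: "splits P Q H a' b' \<phi>'" and s: "\<sigma> \<in> auto P"
    and conj: "\<And>q x. q \<in> carrier Q \<Longrightarrow> x \<in> carrier P \<Longrightarrow> \<phi>' q (\<sigma> x) = \<sigma> (\<phi> q x)"
  shows "G \<cong> H"
proof -
  interpret P: group P using G by (simp add: splits_def)
  interpret Q: group Q using G by (simp add: splits_def)
  interpret G: group G using G by (simp add: splits_def)
  interpret H: group H using H by (simp add: splits_def)
  interpret a: group_hom P G a using G by (simp add: splits_def group_hom_def group_hom_axioms_def)
  interpret b: group_hom Q G b using G by (simp add: splits_def group_hom_def group_hom_axioms_def)
  interpret a': group_hom P H a' using H
    by (simp add: splits_def group_hom_def group_hom_axioms_def)
  interpret b': group_hom Q H b' using H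
    by (simp add: splits_def group_hom_def group_hom_axioms_def)
  interpret \<sigma>: group_hom P P \<sigma> using P.auto_group_hom[OF s] .
  let ?I = "carrier P \<times> carrier Q"
  have \<phi>: "\<phi> q x \<in> carrier P" if "q \<in> carrier Q" "x \<in> carrier P" for q x
    using G homsD(3)[of \<phi> Q "AutoGroup P" q] autoD(2)[of "\<phi> q" P x] that by (auto simp: splits_def)
  have swap: "b q \<otimes>\<^bsub>G\<^esub> a x = a (\<phi> q x) \<otimes>\<^bsub>G\<^esub> b q" "b' q \<otimes>\<^bsub>H\<^esub> a' x = a' (\<phi>' q x) \<otimes>\<^bsub>H\<^esub> b' q"
    if "q \<in> carrier Q" "x \<in> carrier P" for q x
    using G H that by (auto simp: splits_def)
  have \<sigma>I: "(\<lambda>(x, q). (\<sigma> x, q)) ` ?I = ?I"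
    using autoD(4)[OF s] by (force simp: image_iff)
  show ?thesis
  proof (rule isoI_parametrized[where e = "\<lambda>(x, q). a x \<otimes>\<^bsub>G\<^esub> b q"
    and f = "\<lambda>(x, q). a' (\<sigma> x) \<otimes>\<^bsub>H\<^esub> b' q" and I = ?I])
    show "(\<lambda>(x, q). a x \<otimes>\<^bsub>G\<^esub> b q) ` ?I = carrier G" using G by (simp add: splits_def)
    have "(\<lambda>(x, q). a' (\<sigma> x) \<otimes>\<^bsub>H\<^esub> b' q) ` ?I = (\<lambda>(x, q). a' x \<otimes>\<^bsub>H\<^esub> b' q) ` (\<lambda>(x, q). (\<sigma> x, q)) ` ?I"
      by (simp add: image_image case_prod_beta)
    also have "\<dots> = carrier H" using H unfolding \<sigma>I by (simp add: splits_def)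
    finally show "(\<lambda>(x, q). a' (\<sigma> x) \<otimes>\<^bsub>H\<^esub> b' q) ` ?I = carrier H" .
    fix i j assume "i \<in> ?I" "j \<in> ?I"
    then obtain x q y r where i: "i = (x, q)" "x \<in> carrier P" "q \<in> carrier Q"
      and j: "j = (y, r)" "y \<in> carrier P" "r \<in> carrier Q"
      by auto
    have "a x \<otimes>\<^bsub>G\<^esub> b q = a y \<otimes>\<^bsub>G\<^esub> b r \<longleftrightarrow> (x, q) = (y, r)"
    proof -
      have "inj_on (\<lambda>(x, q). a x \<otimes>\<^bsub>G\<^esub> b q) ?I" using G by (simp add: splits_def)
      from inj_on_eq_iff[OF this, of "(x, q)" "(y, r)"] show ?thesis using i j by simp
    qed
    moreover have "a' (\<sigma> x) \<otimes>\<^bsub>H\<^esub> b' q = a' (\<sigma> y) \<otimes>\<^bsub>H\<^esub> b' r \<longleftrightarrow> (\<sigma> x, q) = (\<sigma> y, r)"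
    proof -
      have "inj_on (\<lambda>(x, q). a' x \<otimes>\<^bsub>H\<^esub> b' q) ?I" using H by (simp add: splits_def)
      from inj_on_eq_iff[OF this, of "(\<sigma> x, q)" "(\<sigma> y, r)"] show ?thesis using i j by simp
    qed
    moreover have "\<sigma> x = \<sigma> y \<longleftrightarrow> x = y" using inj_on_eq_iff[OF autoD(3)[OF s]] i j by simp
    ultimately show "(case i of (x, q) \<Rightarrow> a x \<otimes>\<^bsub>G\<^esub> b q) = (case j of (x, q) \<Rightarrow> a x \<otimes>\<^bsub>G\<^esub> b q) \<longleftrightarrow>
      (case i of (x, q) \<Rightarrow> a' (\<sigma> x) \<otimes>\<^bsub>H\<^esub> b' q) = (case j of (x, q) \<Rightarrow> a' (\<sigma> x) \<otimes>\<^bsub>H\<^esub> b' q)"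
      using i(1) j(1) by simp
    have "a (x \<otimes>\<^bsub>P\<^esub> \<phi> q y) \<otimes>\<^bsub>G\<^esub> b (q \<otimes>\<^bsub>Q\<^esub> r) = a x \<otimes>\<^bsub>G\<^esub> (a (\<phi> q y) \<otimes>\<^bsub>G\<^esub> b q) \<otimes>\<^bsub>G\<^esub> b r"
      using i j \<phi> by (simp add: G.m_assoc)
    also have "\<dots> = a x \<otimes>\<^bsub>G\<^esub> b q \<otimes>\<^bsub>G\<^esub> (a y \<otimes>\<^bsub>G\<^esub> b r)"
      using i j swap(1)[of q y] by (simp add: G.m_assoc flip: swap(1))
    finally have 1: "a (x \<otimes>\<^bsub>P\<^esub> \<phi> q y) \<otimes>\<^bsub>G\<^esub> b (q \<otimes>\<^bsub>Q\<^esub> r) = a x \<otimes>\<^bsub>G\<^esub> b q \<otimes>\<^bsub>G\<^esub> (a y \<otimes>\<^bsub>G\<^esub> b r)" .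
    have "a' (\<sigma> (x \<otimes>\<^bsub>P\<^esub> \<phi> q y)) \<otimes>\<^bsub>H\<^esub> b' (q \<otimes>\<^bsub>Q\<^esub> r)
        = a' (\<sigma> x) \<otimes>\<^bsub>H\<^esub> (a' (\<phi>' q (\<sigma> y)) \<otimes>\<^bsub>H\<^esub> b' q) \<otimes>\<^bsub>H\<^esub> b' r"
      using i j \<phi> conj[of q y] by (simp add: H.m_assoc)
    also have "a' (\<phi>' q (\<sigma> y)) \<otimes>\<^bsub>H\<^esub> b' q = b' q \<otimes>\<^bsub>H\<^esub> a' (\<sigma> y)" using swap(2)[of q "\<sigma> y"] i j by simp
    also have "a' (\<sigma> x) \<otimes>\<^bsub>H\<^esub> (b' q \<otimes>\<^bsub>H\<^esub> a' (\<sigma> y)) \<otimes>\<^bsub>H\<^esub> b' r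
        = a' (\<sigma> x) \<otimes>\<^bsub>H\<^esub> b' q \<otimes>\<^bsub>H\<^esub> (a' (\<sigma> y) \<otimes>\<^bsub>H\<^esub> b' r)"
      using i j by (simp add: H.m_assoc)
    finally show "\<exists>k\<in>?I. (case k of (x, q) \<Rightarrow> a x \<otimes>\<^bsub>G\<^esub> b q) =
        (case i of (x, q) \<Rightarrow> a x \<otimes>\<^bsub>G\<^esub> b q) \<otimes>\<^bsub>G\<^esub> (case j of (x, q) \<Rightarrow> a x \<otimes>\<^bsub>G\<^esub> b q) \<and>
        (case k of (x, q) \<Rightarrow> a' (\<sigma> x) \<otimes>\<^bsub>H\<^esub> b' q) =
        (case i of (x, q) \<Rightarrow> a' (\<sigma> x) \<otimes>\<^bsub>H\<^esub> b' q) \<otimes>\<^bsub>H\<^esub> (case j of (x, q) \<Rightarrow> a' (\<sigma> x) \<otimes>\<^bsub>H\<^esub> b' q)"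
      using 1 i j \<phi> by (intro bexI[of _ "(x \<otimes>\<^bsub>P\<^esub> \<phi> q y, q \<otimes>\<^bsub>Q\<^esub> r)"]) auto
  qed
qed

section \<open>Counting isomorphism classes\<close>

text \<open>The action is conjugation by \<open>b q\<close>, read in \<open>P0\<close> through
  \<open>a\<close>. The factors are given by arbitrary isomorphisms, so that different groups
  \<open>G\<close> can share the same \<open>P0\<close> and \<open>Q\<close>.\<close>

lemma (in group) complement_splits:
  assumes P: "P \<lhd> G" and K: "subgroup K G" and PK: "P \<inter> K = {\<one>}" "carrier G = P <#> K"
    and P0: "group P0" and Q: "group Q"
    and a: "a \<in> iso P0 (G\<lparr>carrier := P\<rparr>)" and b: "b \<in> iso Q (G\<lparr>carrier := K\<rparr>)"
  shows "\<exists>\<phi>. splits P0 Q G a b \<phi>"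
proof -
  interpret P: normal P G by fact
  interpret P0: group P0 by fact
  interpret Q: group Q by fact
  have ab: "a \<in> hom P0 (G\<lparr>carrier := P\<rparr>)" "bij_betw a (carrier P0) P"
    "b \<in> hom Q (G\<lparr>carrier := K\<rparr>)" "bij_betw b (carrier Q) K"
    using a b by (auto simp: iso_def)
  have aP: "a x \<in> P" if "x \<in> carrier P0" for x using ab(2) that by (auto simp: bij_betw_def)
  have bK: "b q \<in> K" if "q \<in> carrier Q" for q using ab(4) that by (auto simp: bij_betw_def)
  have KG: "K \<subseteq> carrier G" using subgroup.subset[OF K] .
  have homs: "a \<in> hom P0 G" "b \<in> hom Q G"
    using ab(1,3) P.subset KG by (auto simp: hom_def Pi_iff)
  interpret a: group_hom P0 G a using homs(1) by (simp add: group_hom_def group_hom_axioms_def)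
  interpret b: group_hom Q G b using homs(2) by (simp add: group_hom_def group_hom_axioms_def)
  have a_inj: "x = y" if "x \<in> carrier P0" "y \<in> carrier P0" "a x = a y" for x y
    using ab(2) that by (auto simp: bij_betw_def inj_on_def)
  define c where "c q x = b q \<otimes> a x \<otimes> inv (b q)" for q x
  have cP: "c q x \<in> P" if "q \<in> carrier Q" "x \<in> carrier P0" for q x
    unfolding c_def using P.inv_op_closed2[of "b q" "a x"] that aP by simp
  \<comment> \<open>Two kinds of extensionality: \<open>undefined\<close> outside
    \<open>carrier Q\<close> for \<open>homs\<close>, and a restriction to \<open>carrier P0\<close>
    for \<open>auto\<close>.\<close>
  define \<phi> where "\<phi> q = (if q \<in> carrier Q then (\<lambda>x\<in>carrier P0. inv_into (carrier P0) a (c q x)) else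
      undefined)" for q
  have \<phi>: "\<phi> q x \<in> carrier P0" "a (\<phi> q x) = c q x" if "q \<in> carrier Q" "x \<in> carrier P0" for q x
  proof -
    have "c q x \<in> a ` carrier P0" using cP[OF that] ab(2) by (simp add: bij_betw_def)
    then show "\<phi> q x \<in> carrier P0" "a (\<phi> q x) = c q x"
      using that by (auto simp: \<phi>_def inv_into_into f_inv_into_f)
  qed
  have \<phi>_one: "\<phi> \<one>\<^bsub>Q\<^esub> x = x" if "x \<in> carrier P0" for x
    using that \<phi>[of "\<one>\<^bsub>Q\<^esub>" x] by (intro a_inj) (auto simp: c_def)
  have \<phi>_mult: "\<phi> (q \<otimes>\<^bsub>Q\<^esub> r) x = \<phi> q (\<phi> r x)"
    if "q \<in> carrier Q" "r \<in> carrier Q" "x \<in> carrier P0" for q r x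
    using that \<phi>[of "q \<otimes>\<^bsub>Q\<^esub> r" x] \<phi>[of r x] \<phi>[of q "\<phi> r x"]
    by (intro a_inj) (auto simp: c_def m_assoc inv_mult_group)
  have \<phi>_hom: "\<phi> q (x \<otimes>\<^bsub>P0\<^esub> y) = \<phi> q x \<otimes>\<^bsub>P0\<^esub> \<phi> q y"
    if "q \<in> carrier Q" "x \<in> carrier P0" "y \<in> carrier P0" for q x y
    using that \<phi>[of q x] \<phi>[of q y] \<phi>[of q "x \<otimes>\<^bsub>P0\<^esub> y"]
    by (intro a_inj) (auto simp: c_def m_assoc)
  have \<phi>_auto: "\<phi> q \<in> auto P0" if q: "q \<in> carrier Q" for q
  proof -
    have "bij_betw (\<phi> q) (carrier P0) (carrier P0)"
    proof (rule bij_betwI[where g = "\<phi> (inv\<^bsub>Q\<^esub> q)"])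
      show "\<phi> (inv\<^bsub>Q\<^esub> q) (\<phi> q x) = x" if "x \<in> carrier P0" for x
        using \<phi>_mult[of "inv\<^bsub>Q\<^esub> q" q x] \<phi>_one that q by simp
      show "\<phi> q (\<phi> (inv\<^bsub>Q\<^esub> q) x) = x" if "x \<in> carrier P0" for x
        using \<phi>_mult[of q "inv\<^bsub>Q\<^esub> q" x] \<phi>_one that q by simp
    qed (use \<phi> q in auto)
    moreover have "\<phi> q \<in> hom P0 P0" using \<phi> \<phi>_hom q by (auto simp: hom_def)
    moreover have "\<phi> q \<in> extensional (carrier P0)" using q by (simp add: \<phi>_def)
    ultimately show ?thesis by (auto simp: auto_def Bij_def)
  qed
  interpret A: group "AutoGroup P0" by (rule P0.AutoGroup)
  have "\<phi> \<in> homs Q (AutoGroup P0)"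
  proof -
    have "\<phi> (q \<otimes>\<^bsub>Q\<^esub> r) = \<phi> q \<otimes>\<^bsub>AutoGroup P0\<^esub> \<phi> r" if "q \<in> carrier Q" "r \<in> carrier Q" for q r
      using \<phi>_auto that A.m_closed[of "\<phi> q" "\<phi> r"] \<phi>_mult
      by (intro auto_eqI[of _ P0]) (auto simp: AutoGroup_mult)
    then show ?thesis using \<phi>_auto by (auto simp: homs_def hom_def extensional_def \<phi>_def)
  qed
  moreover have "inj_on (\<lambda>(x, q). a x \<otimes> b q) (carrier P0 \<times> carrier Q)"
  proof (rule inj_onI, clarsimp)
    fix x q y r assume h: "x \<in> carrier P0" "q \<in> carrier Q" "y \<in> carrier P0" "r \<in> carrier Q"
      "a x \<otimes> b q = a y \<otimes> b r"
    have "inv (a y) \<otimes> (a x \<otimes> b q) \<otimes> inv (b q) = inv (a y) \<otimes> (a y \<otimes> b r) \<otimes> inv (b q)" using h(5)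
      by simp
    then have e: "inv (a y) \<otimes> a x = b r \<otimes> inv (b q)" using h(1-4) by (simp add: m_assoc)
    moreover have "inv (a y) \<otimes> a x \<in> P" "b r \<otimes> inv (b q) \<in> K"
      using aP bK h subgroup.m_closed[OF K] subgroup.m_inv_closed[OF K] by auto
    ultimately have "inv (a y) \<otimes> a x = \<one>" "b r \<otimes> inv (b q) = \<one>" using PK(1) by auto
    then have "a x = a y" "b r = b q" using h(1-4)
      by (metis a.hom_closed inv_closed inv_equality inv_inv, metis b.hom_closed inv_closed
        inv_equality inv_inv)
    then show "x = y \<and> q = r"
      using a_inj h ab(4) by (auto simp: bij_betw_def inj_on_def)
  qed
  moreover have "(\<lambda>(x, q). a x \<otimes> b q) ` (carrier P0 \<times> carrier Q) = carrier G"
  proof -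
    have "P = a ` carrier P0" "K = b ` carrier Q" using ab(2,4) by (auto simp: bij_betw_def)
    then show ?thesis unfolding PK(2) set_mult_def by force
  qed
  moreover have "b q \<otimes> a x = a (\<phi> q x) \<otimes> b q" if "x \<in> carrier P0" "q \<in> carrier Q" for x q
    using \<phi>[OF that(2,1)] that by (simp add: c_def m_assoc)
  ultimately have "splits P0 Q G a b \<phi>" using homs by (simp add: splits_def)
  then show ?thesis by blast
qed

text \<open>A bound on the number of isomorphism classes meeting \<open>X\<close>, given by
  representatives. It makes sense for any family of groups and is additive over unions, so families
  can be split without forming quotients.\<close>

definition iso_bound :: "nat monoid set \<Rightarrow> nat \<Rightarrow> bool"
  where "iso_bound X B \<longleftrightarrow> (\<exists>C\<subseteq>X. finite C \<and> card C \<le> B \<and> (\<forall>G\<in>X. \<exists>H\<in>C. G \<cong> H))"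

lemma iso_bound_mono: "iso_bound X B \<Longrightarrow> B \<le> B' \<Longrightarrow> iso_bound X B'"
  unfolding iso_bound_def using order_trans by blast

lemma iso_bound_invariant:
  assumes "finite D" "card D \<le> B" "\<And>G. G \<in> X \<Longrightarrow> f G \<in> D"
    and "\<And>G H. G \<in> X \<Longrightarrow> H \<in> X \<Longrightarrow> f G = f H \<Longrightarrow> G \<cong> H"
  shows "iso_bound X B"
proof -
  define C where "C = inv_into X f ` f ` X"
  have fin: "finite (f ` X)" using assms(1,3) by (meson finite_subset image_subsetI)
  have "card C \<le> card (f ` X)" unfolding C_def by (rule card_image_le[OF fin])
  also have "\<dots> \<le> B" using card_mono[OF assms(1), of "f ` X"] assms(2,3) by fastforce
  finally have "card C \<le> B" .
  moreover have "C \<subseteq> X" by (auto simp: C_def inv_into_into)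
  moreover have "\<exists>H\<in>C. G \<cong> H" if "G \<in> X" for G
    using assms(4)[OF that inv_into_into[of "f G" f X]] that by (auto simp: C_def f_inv_into_f)
  moreover have "finite C" using fin by (simp add: C_def)
  ultimately show ?thesis unfolding iso_bound_def by blast
qed

lemma iso_bound_UN:
  assumes "finite I" "\<And>i. i \<in> I \<Longrightarrow> iso_bound (X i) B"
  shows "iso_bound (\<Union>i\<in>I. X i) (card I * B)"
proof -
  have "\<forall>i\<in>I. \<exists>C. C \<subseteq> X i \<and> finite C \<and> card C \<le> B \<and> (\<forall>G\<in>X i. \<exists>H\<in>C. G \<cong> H)"
    using assms(2) unfolding iso_bound_def by simp
  from bchoice[OF this] obtain C
    where C: "\<forall>i\<in>I. C i \<subseteq> X i \<and> finite (C i) \<and> card (C i) \<le> B \<and> (\<forall>G\<in>X i. \<exists>H\<in>C i. G \<cong> H)" ..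
  have "card (\<Union>i\<in>I. C i) \<le> (\<Sum>i\<in>I. card (C i))" by (rule card_UN_le[OF assms(1)])
  also have "\<dots> \<le> card I * B" using sum_bounded_above[of I "\<lambda>i. card (C i)" B] C by simp
  finally have "card (\<Union>i\<in>I. C i) \<le> card I * B" .
  moreover have "(\<Union>i\<in>I. C i) \<subseteq> (\<Union>i\<in>I. X i)" using C by blast
  moreover have "finite (\<Union>i\<in>I. C i)" using C assms(1) by simp
  moreover have "\<forall>G\<in>\<Union>i\<in>I. X i. \<exists>H\<in>\<Union>i\<in>I. C i. G \<cong> H" using C by blast
  ultimately show ?thesis unfolding iso_bound_def by blast
qed

lemma iso_bound_Un:
  assumes "iso_bound X A" "iso_bound Y B"
  shows "iso_bound (X \<union> Y) (A + B)"
proof -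
  obtain C D where "C \<subseteq> X" "finite C" "card C \<le> A" "\<forall>G\<in>X. \<exists>H\<in>C. G \<cong> H"
    "D \<subseteq> Y" "finite D" "card D \<le> B" "\<forall>G\<in>Y. \<exists>H\<in>D. G \<cong> H"
    using assms by (auto simp: iso_bound_def)
  then show ?thesis
    unfolding iso_bound_def using card_Un_le[of C D] by (intro exI[of _ "C \<union> D"]) auto
qed

lemma iso_bound_num_solvable_groups:
  assumes "iso_bound (solvable_groups_of_order n) B"
  shows "num_solvable_groups n \<le> B"
proof -
  let ?S = "solvable_groups_of_order n"
  let ?R = "group_iso_rel ?S"
  obtain C where C: "C \<subseteq> ?S" "finite C" "card C \<le> B" "\<forall>G\<in>?S. \<exists>H\<in>C. G \<cong> H"
    using assms by (auto simp: iso_bound_def)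
  have "?S // ?R \<subseteq> (\<lambda>H. ?R `` {H}) ` C"
  proof
    fix c assume "c \<in> ?S // ?R"
    then obtain G where G: "G \<in> ?S" "c = ?R `` {G}" by (auto elim: quotientE)
    then obtain H where H: "H \<in> C" "G \<cong> H" using C(4) by blast
    then have "(G, H) \<in> ?R" using G(1) C(1) by (auto simp: group_iso_rel_def)
    then have "c = ?R `` {H}" using equiv_class_eq[OF equiv_group_iso_rel] G(2) by blast
    then show "c \<in> (\<lambda>H. ?R `` {H}) ` C" using H(1) by blast
  qed
  then have "card (?S // ?R) \<le> card C" using surj_card_le[OF C(2)] by blast
  then show ?thesis using C(3) by (simp add: num_solvable_groups_def)
qed

text \<open>The action itself is the invariant: groups with the same action are isomorphic by
  \<open>splits_iso\<close> with the identity. For abelian automorphism groups counting actions is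
  good enough.\<close>

lemma iso_bound_splits_comm:
  assumes fin: "finite (carrier P)" "comm_group (AutoGroup P)" "order (AutoGroup P) \<le> c"
    and Q: "group Q" "finite (carrier Q)" "cube_free (order Q)"
    and X: "\<And>G. G \<in> X \<Longrightarrow> \<exists>a b \<phi>. splits P Q G a b \<phi>"
  shows "iso_bound X (c ^ 2)"
proof -
  define F where "F G = (SOME \<phi>. \<exists>a b. splits P Q G a b \<phi>)" for G :: "nat monoid"
  have f: "\<exists>a b. splits P Q G a b (F G)" if "G \<in> X" for G
    unfolding F_def using X[OF that] by (intro someI_ex[of "\<lambda>\<phi>. \<exists>a b. splits P Q G a b \<phi>"]) blast
  show ?thesis
  proof (rule iso_bound_invariant[where D = "homs Q (AutoGroup P)" and f = F])
  have fA: "finite (carrier (AutoGroup P))" using finite_auto[OF fin(1)] by simp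
  show "finite (homs Q (AutoGroup P))" using finite_homs[OF Q(2) fA] .
  have "card (homs Q (AutoGroup P)) \<le> order (AutoGroup P) ^ 2"
    using card_homs_comm_le[OF Q fin(2) fA] .
  also have "\<dots> \<le> c ^ 2" using fin(3) by (rule power_mono) simp
  finally show "card (homs Q (AutoGroup P)) \<le> c ^ 2" .
  show "F G \<in> homs Q (AutoGroup P)" if "G \<in> X" for G
    using f[OF that] unfolding splits_def by blast
  fix G H assume GH: "G \<in> X" "H \<in> X" "F G = F H"
  obtain a b where "splits P Q G a b (F G)" using f[OF GH(1)] by blast
  moreover obtain a' b' where "splits P Q H a' b' (F H)" using f[OF GH(2)] by blast
  ultimately obtain \<phi> where s: "splits P Q G a b \<phi>" "splits P Q H a' b' \<phi>" using GH(3) by simp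
  interpret P: group P using s(1) by (simp add: splits_def)
  have "\<phi> q x \<in> carrier P" if "q \<in> carrier Q" "x \<in> carrier P" for q x
    using s(1) homsD(3)[of \<phi> Q "AutoGroup P" q] autoD(2)[of "\<phi> q" P x] that
    by (auto simp: splits_def)
  then show "G \<cong> H" by (intro splits_iso[OF s P.id_in_auto]) auto
  qed
qed

text \<open>The invariant is the orbit of the action; an automorphism of \<open>P\<close>
  conjugating one action to another is the intertwiner that \<open>splits_iso\<close> asks
  for.\<close>

lemma iso_bound_splits_orbits:
  assumes fin: "finite (carrier P)" and Q: "group Q" "finite (carrier Q)"
    and bd: "card (orbits (AutoGroup P) (homs Q (AutoGroup P)) (conj_homs Q (AutoGroup P))) \<le> B"
    and X: "\<And>G. G \<in> X \<Longrightarrow> \<exists>a b \<phi>. splits P Q G a b \<phi>"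
  shows "iso_bound X B"
proof (cases "X = {}")
  case True
  then show ?thesis by (simp add: iso_bound_def)
next
  case False
  then obtain G0 :: "nat monoid" and a b \<phi> where "splits P Q G0 a b \<phi>" using X by blast
  then interpret P: group P by (simp add: splits_def)
  interpret A: group "AutoGroup P" by (rule P.AutoGroup)
  interpret act: group_action "AutoGroup P" "homs Q (AutoGroup P)" "conj_homs Q (AutoGroup P)"
    using A.conj_action_homs[OF Q(1)] .
  define F where "F G = (SOME \<phi>. \<exists>a b. splits P Q G a b \<phi>)" for G :: "nat monoid"
  have f: "\<exists>a b. splits P Q G a b (F G)" if "G \<in> X" for G
    unfolding F_def using X[OF that] by (intro someI_ex[of "\<lambda>\<phi>. \<exists>a b. splits P Q G a b \<phi>"]) blast
  let ?o = "orbit (AutoGroup P) (conj_homs Q (AutoGroup P))"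
  show ?thesis
  proof (rule iso_bound_invariant[OF _ bd, where f = "\<lambda>G. ?o (F G)"])
    have fA: "finite (carrier (AutoGroup P))" using finite_auto[OF fin(1)] by simp
    then show "finite (orbits (AutoGroup P) (homs Q (AutoGroup P)) (conj_homs Q (AutoGroup P)))"
      using finite_homs[OF Q(2) fA] by (simp add: orbits_def)
    show "?o (F G) \<in> orbits (AutoGroup P) (homs Q (AutoGroup P)) (conj_homs Q (AutoGroup P))"
      if "G \<in> X" for G using f[OF that] unfolding splits_def orbits_def by blast
    fix G H assume GH: "G \<in> X" "H \<in> X" "?o (F G) = ?o (F H)"
    obtain a b where "splits P Q G a b (F G)" using f[OF GH(1)] by blast
    moreover obtain a' b' where "splits P Q H a' b' (F H)" using f[OF GH(2)] by blast
    ultimately obtain \<phi> \<psi> where s: "splits P Q G a b \<phi>" "splits P Q H a' b' \<psi>" "?o \<phi> = ?o \<psi>"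
      using GH(3) by blast
    have h: "\<phi> \<in> homs Q (AutoGroup P)" "\<psi> \<in> homs Q (AutoGroup P)" using s by (auto simp: splits_def)
    have "\<psi> \<in> ?o \<phi>" using act.orbit_refl[OF h(2)] s(3) by simp
    then obtain g where g: "g \<in> auto P" "\<psi> = conj_homs Q (AutoGroup P) g \<phi>"
      by (auto simp: orbit_def)
    have "\<psi> q (g x) = g (\<phi> q x)" if "q \<in> carrier Q" "x \<in> carrier P" for q x
    proof -
      have \<phi>q: "\<phi> q \<in> auto P" using homsD(3)[OF h(1) that(1)] by simp
      have gi: "inv\<^bsub>AutoGroup P\<^esub> g \<in> auto P" "(inv\<^bsub>AutoGroup P\<^esub> g) (g x) = x"
        using P.AutoGroup_inv[OF g(1) that(2)] by auto
      have "\<psi> q = g \<otimes>\<^bsub>AutoGroup P\<^esub> \<phi> q \<otimes>\<^bsub>AutoGroup P\<^esub> inv\<^bsub>AutoGroup P\<^esub> g" using g(2) h(1) that(1)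
        by simp
      then show ?thesis
        using g(1) \<phi>q gi A.m_closed[of g "\<phi> q"] that autoD(2)[OF g(1) that(2)]
        by (simp add: AutoGroup_mult)
    qed
    then show "G \<cong> H" using splits_iso[OF s(1,2) g(1)] by blast
  qed
qed

text \<open>The predicate \<open>T\<close> is the isomorphism type of the normal factor; it is used
  for being cyclic or not, which settles the type for the orders p and p^2.\<close>

definition split_class :: "nat \<Rightarrow> nat monoid \<Rightarrow> (nat monoid \<Rightarrow> bool) \<Rightarrow> nat monoid set"
  where "split_class r Q T = {G. group G \<and> (\<exists>P K. P \<lhd> G \<and> subgroup K G \<and> P \<inter> K = {\<one>\<^bsub>G\<^esub>} \<and>
    carrier G = P <#>\<^bsub>G\<^esub> K \<and> card P = r \<and> T (G\<lparr>carrier := P\<rparr>) \<and> Q \<cong> G\<lparr>carrier := K\<rparr>)}"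

text \<open>The normal subgroup of a single member of \<open>X\<close> serves as a common model
  \<open>P\<close>, because order and \<open>T\<close> determine it up to isomorphism.\<close>

lemma split_class_splits:
  assumes Q: "group Q" and X: "X \<subseteq> split_class r Q T" "X \<noteq> {}" and r: "r > 0"
    and T: "\<And>P P'. group P \<Longrightarrow> group P' \<Longrightarrow> order P = r \<Longrightarrow> order P' = r \<Longrightarrow> T P \<Longrightarrow> T P' \<Longrightarrow> P \<cong> P'"
  obtains P where "group P" "order P = r" "T P" "\<And>G. G \<in> X \<Longrightarrow> \<exists>a b \<phi>. splits P Q G a b \<phi>"
proof -
  have d: "\<exists>P K. P \<lhd> G \<and> subgroup K G \<and> P \<inter> K = {\<one>\<^bsub>G\<^esub>} \<and> carrier G = P <#>\<^bsub>G\<^esub> K \<and> card P = r \<and>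
      T (G\<lparr>carrier := P\<rparr>) \<and> Q \<cong> G\<lparr>carrier := K\<rparr> \<and> group (G\<lparr>carrier := P\<rparr>)" if "G \<in> X" for G
  proof -
    have G: "G \<in> split_class r Q T" using that X(1) by blast
    then have "group G" by (simp add: split_class_def)
    moreover obtain P K where "P \<lhd> G" "subgroup K G" "P \<inter> K = {\<one>\<^bsub>G\<^esub>}" "carrier G = P <#>\<^bsub>G\<^esub> K"
      "card P = r"
      "T (G\<lparr>carrier := P\<rparr>)" "Q \<cong> G\<lparr>carrier := K\<rparr>"
      using G unfolding split_class_def by blast
    moreover from this have "group (G\<lparr>carrier := P\<rparr>)"
      using group.subgroup_imp_group[OF \<open>group G\<close> normal_imp_subgroup] by blast
    ultimately show ?thesis by blast
  qed
  obtain G0 where "G0 \<in> X" using X(2) by blast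
  then obtain P0 where P0: "group (G0\<lparr>carrier := P0\<rparr>)" "card P0 = r" "T (G0\<lparr>carrier := P0\<rparr>)" using d
    by blast
  show ?thesis
  proof (rule that[of "G0\<lparr>carrier := P0\<rparr>"])
    show "order (G0\<lparr>carrier := P0\<rparr>) = r" using P0(2) by (simp add: order_def)
    fix G assume G: "G \<in> X"
    then obtain P K where PK: "P \<lhd> G" "subgroup K G" "P \<inter> K = {\<one>\<^bsub>G\<^esub>}" "carrier G = P <#>\<^bsub>G\<^esub> K"
      "card P = r"
      "T (G\<lparr>carrier := P\<rparr>)" "Q \<cong> G\<lparr>carrier := K\<rparr>" "group (G\<lparr>carrier := P\<rparr>)" using d by blast
    have GG: "group G" using G X(1) by (auto simp: split_class_def)
    have "G0\<lparr>carrier := P0\<rparr> \<cong> G\<lparr>carrier := P\<rparr>"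
      using T[OF P0(1) PK(8) _ _ P0(3) PK(6)] P0(2) PK(5) by (simp add: order_def)
    then show "\<exists>a b \<phi>. splits (G0\<lparr>carrier := P0\<rparr>) Q G a b \<phi>"
      using group.complement_splits[OF GG PK(1-4) P0(1) Q] PK(7) unfolding is_iso_def by blast
  qed (use P0 in auto)
qed

text \<open>Serves \<open>r = p\<close> and cyclic \<open>P\<close> of order p^2 alike: the
  automorphism group is abelian of order at most r - 1.\<close>

lemma iso_bound_split_class_cyclic:
  assumes Q: "group Q" "finite (carrier Q)" "cube_free (order Q)" and r: "r > 1"
    and X: "X \<subseteq> split_class r Q cyclic"
  shows "iso_bound X ((r - 1) ^ 2)"
proof (cases "X = {}")
  case True then show ?thesis by (simp add: iso_bound_def)
next
  case False
  have fin: "finite (carrier P)" if "group P" "order P = r" for P :: "nat monoid"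
    using that r monoid.order_gt_0_iff_finite[OF group.is_monoid[OF that(1)]] by simp
  obtain P :: "nat monoid" where P: "group P" "order P = r" "cyclic P"
    "\<And>G. G \<in> X \<Longrightarrow> \<exists>a b \<phi>. splits P Q G a b \<phi>"
  proof (rule split_class_splits[OF Q(1) X False])
    show "P \<cong> P'" if "group P" "group P'" "order P = r" "order P' = r" "cyclic P" "cyclic P'"
      for P P' :: "nat monoid"
      using cyclic_iso[OF that(1) fin[OF that(1,3)] that(5,2) fin[OF that(2,4)] that(6)] that(3,4)
      by simp
  qed (use r in simp, blast)
  interpret P: group P by fact
  obtain a where a: "a \<in> carrier P" "\<And>x. x \<in> carrier P \<Longrightarrow> \<exists>k::int. x = a [^]\<^bsub>P\<^esub> k"
    using P(3) by (auto simp: cyclic_def)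
  have A: "comm_group (AutoGroup P)" "order (AutoGroup P) \<le> r - 1"
    using P.AutoGroup_cyclic[OF fin[OF P(1,2)] a] P(2) r by auto
  show ?thesis using iso_bound_splits_comm[OF fin[OF P(1,2)] A Q P(4)] .
qed

lemma iso_bound_split_class_noncyclic:
  assumes Q: "group Q" "finite (carrier Q)" "cube_free (order Q)" "solvable Q"
    and p: "prime p" "coprime p (order Q)"
    and X: "X \<subseteq> split_class (p ^ 2) Q (\<lambda>P. \<not> cyclic P)"
  shows "iso_bound X ((p - 1) ^ 2 + 4 * (p - 1) * (p ^ 2 - 1) ^ 3 + (p ^ 2 - 1) ^ 2)"
proof (cases "X = {}")
  case True then show ?thesis by (simp add: iso_bound_def)
next
  case False
  have r2: "rank_two P p" if "group P" "order P = p ^ 2" "\<not> cyclic P" for P :: "nat monoid"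
    using group.cyclic_or_rank_two[OF that(1) p(1) that(2,3)] .
  have "p ^ 2 > 0" using prime_gt_0_nat[OF p(1)] by simp
  then obtain P :: "nat monoid" where P: "group P" "order P = p ^ 2" "\<not> cyclic P"
    "\<And>G. G \<in> X \<Longrightarrow> \<exists>a b \<phi>. splits P Q G a b \<phi>"
  proof (rule split_class_splits[OF Q(1) X False])
    show "P \<cong> P'" if "group P" "group P'" "order P = p ^ 2" "order P' = p ^ 2" "\<not> cyclic P"
      "\<not> cyclic P'"
      for P P' :: "nat monoid"
      using rank_two_iso[OF r2[OF that(1,3,5)] r2[OF that(2,4,6)]] .
  qed blast
  interpret P: rank_two P p using r2[OF P(1-3)] .
  show ?thesis
    by (rule iso_bound_splits_orbits[OF P.finite_carrier Q(1,2) P.card_orbits_AutoGroup_le[OF Q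
      p(2)] P(4)])
qed

text \<open>For \<open>a = 2\<close>, the first summand accounts for cyclic \<open>P\<close> and the others for elementary abelian \<open>P\<close>.\<close>
definition sylow_factor :: "nat \<Rightarrow> nat \<Rightarrow> nat"
  where "sylow_factor p a = (if a = 1 then (p - 1) ^ 2
    else (p ^ 2 - 1) ^ 2 + ((p - 1) ^ 2 + 4 * (p - 1) * (p ^ 2 - 1) ^ 3 + (p ^ 2 - 1) ^ 2))"

text \<open>A complement of \<open>P\<close> is a solvable group of order m and hence isomorphic to
  one of at most \<open>B\<close> representatives \<open>Q\<close>. For each \<open>Q\<close> the
  groups are sorted by whether \<open>P\<close> is cyclic; a normal subgroup of prime order always
  is.\<close>

lemma iso_bound_normal_sylow:
  assumes cf: "cube_free n" "n > 0" and p: "prime p" and a: "a = 1 \<or> a = 2"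
    and n: "n = p ^ a * m" "coprime p m" and B: "iso_bound (solvable_groups_of_order m) B"
  shows "iso_bound {G \<in> solvable_groups_of_order n. \<exists>P. P \<lhd> G \<and> card P
      = p ^ a} (B * sylow_factor p a)"
proof -
  obtain C where C: "C \<subseteq> solvable_groups_of_order m" "finite C" "card C \<le> B"
    "\<forall>G\<in>solvable_groups_of_order m. \<exists>H\<in>C. G \<cong> H"
    using B by (auto simp: iso_bound_def)
  define X where "X Q = {G \<in> solvable_groups_of_order n. G \<in> split_class (p ^ a) Q cyclic}
    \<union> {G \<in> solvable_groups_of_order n. G \<in> split_class (p ^ a) Q (\<lambda>P. \<not> cyclic P)}" for Q
  have r1: "p ^ a > 1" using prime_gt_1_nat[OF p] a one_less_power[of p a] by auto
  have "{G \<in> solvable_groups_of_order n. \<exists>P. P \<lhd> G \<and> card P = p ^ a} = (\<Union>Q\<in>C. X Q)"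
  proof
    show "(\<Union>Q\<in>C. X Q) \<subseteq> {G \<in> solvable_groups_of_order n. \<exists>P. P \<lhd> G \<and> card P = p ^ a}"
      by (auto simp: X_def split_class_def)
    show "{G \<in> solvable_groups_of_order n. \<exists>P. P \<lhd> G \<and> card P = p ^ a} \<subseteq> (\<Union>Q\<in>C. X Q)"
    proof
      fix G assume "G \<in> {G \<in> solvable_groups_of_order n. \<exists>P. P \<lhd> G \<and> card P = p ^ a}"
      then obtain P where G: "G \<in> solvable_groups_of_order n" and P: "P \<lhd> G" "card P = p ^ a"
        by blast
      have GG: "group G" "finite (carrier G)" "order G = n" "solvable G"
        using G by (auto simp: solvable_groups_of_order_def)
      interpret group G by fact
      have PG: "subgroup P G" using P(1) by (rule normal_imp_subgroup)
      interpret PP: group "G\<lparr>carrier := P\<rparr>" using PG by (rule subgroup_imp_group)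
      have comm: "x \<otimes>\<^bsub>G\<^esub> y = y \<otimes>\<^bsub>G\<^esub> x" if xy: "x \<in> P" "y \<in> P" for x y
        using a
      proof
        assume "a = 1"
        then have "cyclic (G\<lparr>carrier := P\<rparr>)" using PP.cyclic_prime_order[OF p] P(2)
          by (simp add: order_def)
        then obtain c where c: "c \<in> P" "\<And>x. x \<in> P \<Longrightarrow> \<exists>k::int. x = c [^]\<^bsub>G\<lparr>carrier := P\<rparr>\<^esub> k"
          by (auto simp: cyclic_def)
        obtain k :: int where k: "x = c [^]\<^bsub>G\<lparr>carrier := P\<rparr>\<^esub> k" using c(2)[OF xy(1)] by blast
        obtain l :: int where "y = c [^]\<^bsub>G\<lparr>carrier := P\<rparr>\<^esub> l" using c(2)[OF xy(2)] by blast
        with k have "x \<otimes>\<^bsub>G\<lparr>carrier := P\<rparr>\<^esub> y = y \<otimes>\<^bsub>G\<lparr>carrier := P\<rparr>\<^esub> x"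
          using PP.int_pow_mult[of c k l] PP.int_pow_mult[of c l k] c(1) by (simp add: add.commute)
        then show ?thesis by simp
      next
        assume "a = 2"
        then show ?thesis using PP.order_prime_square_comm[OF p, of x y] xy P(2)
          by (simp add: order_def)
      qed
      have ord: "order G = card P * m" using GG(3) n(1) P(2) by simp
      have "coprime (card P) m" using P(2) n(2) by simp
      then obtain K where K: "subgroup K G" "card K = m" "P \<inter> K = {\<one>\<^bsub>G\<^esub>}" "carrier G = P <#>\<^bsub>G\<^esub> K"
        using abelian_normal_complement[OF P(1) GG(2) comm ord] by blast
      have KK: "group (G\<lparr>carrier := K\<rparr>)" using K(1) by (rule subgroup_imp_group)
      have "solvable (G\<lparr>carrier := K\<rparr>)"
        using group_hom.inj_hom_imp_solvable[of
          "G\<lparr>carrier := K\<rparr>" G id] canonical_inj_is_hom[OF K(1)] GG(4)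
        by simp
      then have "G\<lparr>carrier := K\<rparr> \<in> solvable_groups_of_order m"
        using KK K(2) GG(2) subgroup.subset[OF K(1)] finite_subset
        by (auto simp: solvable_groups_of_order_def order_def)
      then obtain Q where Q: "Q \<in> C" "G\<lparr>carrier := K\<rparr> \<cong> Q" using C(4) by blast
      have "Q \<cong> G\<lparr>carrier := K\<rparr>" using group.iso_sym[OF KK Q(2)] .
      then have "G \<in> split_class (p ^ a) Q cyclic \<or> G \<in> split_class (p ^ a) Q (\<lambda>P. \<not> cyclic P)"
        using GG(1) P K unfolding split_class_def by blast
      then have "G \<in> X Q" using G by (auto simp: X_def)
      then show "G \<in> (\<Union>Q\<in>C. X Q)" using Q(1) by blast
    qed
  qed
  moreover have "iso_bound (X Q) (sylow_factor p a)" if "Q \<in> C" for Q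
  proof -
    have Q: "group Q" "finite (carrier Q)" "order Q = m" "solvable Q"
      using C(1) that by (auto simp: solvable_groups_of_order_def)
    have cfQ: "cube_free (order Q)" using cube_free_dvd[OF cf(1)] n(1) Q(3) by simp
    let ?Y = "{G \<in> solvable_groups_of_order n. G \<in> split_class (p ^ a) Q cyclic}"
    let ?Z = "{G \<in> solvable_groups_of_order n. G \<in> split_class (p ^ a) Q (\<lambda>P. \<not> cyclic P)}"
    have Y: "iso_bound ?Y ((p ^ a - 1) ^ 2)"
      by (rule iso_bound_split_class_cyclic[OF Q(1,2) cfQ r1]) blast
    show ?thesis using a
    proof
      assume a1: "a = 1"
      have "?Z = {}"
      proof -
        have "False" if G: "G \<in> split_class (p ^ a) Q (\<lambda>P. \<not> cyclic P)" for G
        proof -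
          obtain P where P: "group G" "P \<lhd> G" "card P = p" "\<not> cyclic (G\<lparr>carrier := P\<rparr>)"
            using G a1 by (auto simp: split_class_def)
          have "group (G\<lparr>carrier := P\<rparr>)"
            using group.subgroup_imp_group[OF P(1) normal_imp_subgroup[OF P(2)]] .
          then show False using group.cyclic_prime_order[of "G\<lparr>carrier := P\<rparr>" p] p P(3,4)
            by (simp add: order_def)
        qed
        then show ?thesis by blast
      qed
      then have "X Q = ?Y" by (simp only: X_def Un_empty_right)
      then show ?thesis using Y a1 by (simp add: sylow_factor_def)
    next
      assume a2: "a = 2"
      have Z: "iso_bound ?Z ((p - 1) ^ 2 + 4 * (p - 1) * (p ^ 2 - 1) ^ 3 + (p ^ 2 - 1) ^ 2)"
        using n(2) Q(3) a2 by (intro iso_bound_split_class_noncyclic[OF Q(1,2) cfQ Q(4) p]) auto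
      have "sylow_factor p a = (p ^ a - 1) ^ 2 + ((p - 1) ^ 2 + 4 * (p - 1) * (p ^ 2 - 1) ^ 3
          + (p ^ 2 - 1) ^ 2)"
        unfolding sylow_factor_def using a2 by (subst if_not_P) simp_all
      then show ?thesis unfolding X_def using iso_bound_Un[OF Y Z] by (simp only:)
    qed
  qed
  ultimately have "iso_bound {G \<in> solvable_groups_of_order n. \<exists>P. P \<lhd> G \<and> card P
      = p ^ a} (card C * sylow_factor p a)"
    using iso_bound_UN[OF C(2), of X] by simp
  then show ?thesis using C(3) by (elim iso_bound_mono) (simp add: mult_right_mono)
qed

text \<open>For a = 2 and p \<ge> 4, one factor p absorbs the 4, so the leading term is at most p (p
  - 1) p^6 = p^8 - p^7, and the other three terms total at most 3 p^4 \<le> p^7. For p = 2 and p = 3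
  the values are 127 \<le> 256 and 4228 \<le> 6561.\<close>

lemma sylow_factor_le:
  assumes p: "p > 1" and a: "a = 1 \<or> a = 2"
  shows "sylow_factor p a \<le> (p ^ a) ^ (2 * a)"
  using a
proof
  assume "a = 1"
  then show ?thesis by (simp add: sylow_factor_def power_mono)
next
  assume a2: "a = 2"
  have main: "(p ^ 2 - 1) ^ 2 + ((p - 1) ^ 2 + 4 * (p - 1) * (p ^ 2 - 1) ^ 3 + (p ^ 2 - 1) ^ 2)
      \<le> p ^ 8"
  proof (cases "p \<ge> 4")
    case True
    have "(p ^ 2 - 1) ^ 2 \<le> (p ^ 2) ^ 2" by (rule power_mono) simp_all
    then have 1: "(p ^ 2 - 1) ^ 2 \<le> p ^ 4" by (simp flip: power_mult)
    have "(p ^ 2 - 1) ^ 3 \<le> (p ^ 2) ^ 3" by (rule power_mono) simp_all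
    then have 2: "(p ^ 2 - 1) ^ 3 \<le> p ^ 6" by (simp flip: power_mult)
    have "4 * (p - 1) * (p ^ 2 - 1) ^ 3 \<le> p * (p - 1) * p ^ 6"
      using True 2 by (intro mult_le_mono) auto
    also have "p * (p - 1) * p ^ 6 = p ^ 8 - p ^ 7"
      by (simp add: algebra_simps eval_nat_numeral)
    finally have 3: "4 * (p - 1) * (p ^ 2 - 1) ^ 3 \<le> p ^ 8 - p ^ 7" .
    have "(p - 1) ^ 2 \<le> p ^ 2" by (rule power_mono) simp_all
    also have "p ^ 2 \<le> p ^ 4" using p by (intro power_increasing) auto
    finally have 4: "(p - 1) ^ 2 \<le> p ^ 4" .
    have "3 * p ^ 4 \<le> p ^ 3 * p ^ 4"
    proof (rule mult_le_mono1)
      have "p ^ 1 \<le> p ^ 3" using p by (intro power_increasing) auto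
      then show "3 \<le> p ^ 3" using True by simp
    qed
    also have "p ^ 3 * p ^ 4 = p ^ 7" by (simp flip: power_add)
    finally have 5: "3 * p ^ 4 \<le> p ^ 7" .
    have "p ^ 7 \<le> p ^ 8" using p by (intro power_increasing) auto
    then show ?thesis using 1 3 4 5 by linarith
  next
    case False
    then have "p = 2 \<or> p = 3" using p by linarith
    then show ?thesis by auto
  qed
  have "(p ^ a) ^ (2 * a) = p ^ 8" using a2 by (simp flip: power_mult)
  then show ?thesis using main a2 by (simp only: sylow_factor_def) simp
qed

section \<open>Exceptional orders and the induction\<close>

lemma iso_bound_trivial: "iso_bound (solvable_groups_of_order 1) 1"
proof (rule iso_bound_invariant[where D = "{()}" and f = "\<lambda>_. ()"])
  fix G H assume "G \<in> solvable_groups_of_order 1" "H \<in> solvable_groups_of_order 1"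
  then have G: "group G" "order G = 1" and H: "group H" "order H = 1"
    by (auto simp: solvable_groups_of_order_def)
  interpret G: group G by fact
  interpret H: group H by fact
  have "carrier G = {\<one>\<^bsub>G\<^esub>}" "carrier H = {\<one>\<^bsub>H\<^esub>}"
    using G.order_one_triv_iff H.order_one_triv_iff G(2) H(2) by auto
  then show "G \<cong> H"
    by (intro isoI_parametrized[where I = "{()}" and e = "\<lambda>_. \<one>\<^bsub>G\<^esub>" and f = "\<lambda>_. \<one>\<^bsub>H\<^esub>"]) auto
qed auto

lemma iso_bound_prime_power:
  assumes p: "prime p" and a: "a = 1 \<or> a = 2"
  shows "iso_bound (solvable_groups_of_order (p ^ a)) (sylow_factor p a)"
proof -
  have cf: "cube_free (p ^ a)"
    unfolding cube_free_def
  proof (intro allI impI notI)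
    fix q :: nat assume q: "prime q" "q ^ 3 dvd p ^ a"
    then have "q dvd p ^ a" by (metis dvd_power dvd_trans zero_less_numeral)
    then have "q = p" using q(1) p by (meson prime_dvd_power primes_dvd_imp_eq)
    then have "3 \<le> a" using q(2) p by (metis not_prime_unit power_dvd_imp_le prime_gt_1_nat)
    then show False using a by auto
  qed
  have "{G \<in> solvable_groups_of_order (p ^ a). \<exists>P. P \<lhd> G \<and> card P = p ^ a}
      = solvable_groups_of_order (p ^ a)"
    using group.normal_self by (fastforce simp: solvable_groups_of_order_def order_def)
  moreover have "p ^ a > 0" using prime_gt_0_nat[OF p] by simp
  ultimately show ?thesis
    using iso_bound_normal_sylow[OF cf _ p a, of 1 1] iso_bound_trivial by simp
qed

text \<open>Only 2 and 3 occur, each at most squared, so n divides 36, and it is a multiple of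
  12.\<close>

lemma four_times_prime_power_3:
  fixes n :: nat
  assumes n0: "n > 0" and cf: "cube_free n" and three: "3 dvd n" and four: "4 dvd n"
    and le3: "\<And>q. prime q \<Longrightarrow> q dvd n \<Longrightarrow> q \<le> 3"
  shows "n = 12 \<or> n = 36"
proof -
  have "n dvd 36"
  proof (rule multiplicity_le_imp_dvd)
    fix q :: nat assume q: "prime q"
    show "multiplicity q n \<le> multiplicity q 36"
    proof (cases "q dvd n")
      case True
      then have "q = 2 \<or> q = 3" using le3[OF q True] prime_ge_2_nat[OF q] by linarith
      then have "q ^ 2 dvd 36" by auto
      then have "2 \<le> multiplicity q 36" using q by (intro multiplicity_geI) auto
      then show ?thesis using cube_free_multiplicity_le[OF cf n0 q] by linarith
    qed (simp add: not_dvd_imp_multiplicity_0)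
  qed (use n0 in simp)
  have "12 dvd n" using three four by presburger
  then obtain k where "n = 12 * k" by blast
  moreover obtain l where "36 = n * l" using \<open>n dvd 36\<close> by blast
  ultimately have "k * l = 3" by simp
  then have "k dvd 3" by (metis dvd_triv_left)
  then have "k = 1 \<or> k = 3" by (simp add: prime_nat_iff[of 3, simplified])
  then show ?thesis using \<open>n = 12 * k\<close> by auto
qed

text \<open>Groups with a normal Sylow 3-subgroup and groups with a normal Sylow 2-subgroup are
  counted separately, with the same bound for both. The sums are 2 * 127 * 4 = 1016 \<le> 12^4 and 2
  * 127 * 4228 = 1073912 \<le> 36^4.\<close>

lemma iso_bound_four_times_3_power:
  assumes n: "n = 4 * 3 ^ a" and a: "a = 1 \<or> a = 2"
    and S: "\<And>G. G \<in> solvable_groups_of_order n \<Longrightarrow> \<exists>P. P \<lhd> G \<and> (card P = 3 ^ a \<or> card P = 4)"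
    and cf: "cube_free n"
  shows "iso_bound (solvable_groups_of_order n) (n ^ 4)"
proof -
  have n0: "n > 0" using n by simp
  let ?S = "\<lambda>r. {G \<in> solvable_groups_of_order n. \<exists>P. P \<lhd> G \<and> card P = r}"
  have p3: "prime (3::nat)" by simp
  have "coprime (3::nat) 4" by (simp add: coprime_iff_gcd_eq_1 gcd_non_0_nat)
  moreover have "coprime (2::nat) 3" by (simp add: coprime_iff_gcd_eq_1 gcd_non_0_nat)
  ultimately have c: "coprime (3::nat) 4" "coprime (2::nat) (3 ^ a)" by auto
  have "iso_bound (solvable_groups_of_order 4) (sylow_factor 2 2)"
    using iso_bound_prime_power[OF two_is_prime_nat, of 2] by simp
  then have 1: "iso_bound (?S (3 ^ a)) (sylow_factor 2 2 * sylow_factor 3 a)"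
    using n c(1) by (intro iso_bound_normal_sylow[OF cf n0 p3 a]) auto
  have "iso_bound (?S (2 ^ 2)) (sylow_factor 3 a * sylow_factor 2 2)"
    using n c(2) iso_bound_prime_power[OF p3 a]
    by (intro iso_bound_normal_sylow[OF cf n0 two_is_prime_nat]) auto
  from iso_bound_Un[OF 1 this]
  moreover have "?S (3 ^ a) \<union> ?S (2 ^ 2) = solvable_groups_of_order n"
  proof -
    have "(2::nat) ^ 2 = 4" by simp
    then show ?thesis using S by (simp only:) blast
  qed
  ultimately have "iso_bound (solvable_groups_of_order n) (sylow_factor 2 2 * sylow_factor 3 a
      + sylow_factor 3 a * sylow_factor 2 2)"
    by (simp only:)
  moreover have "sylow_factor 2 2 * sylow_factor 3 a + sylow_factor 3 a * sylow_factor 2 2 \<le> n ^ 4"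
    using a n by (auto simp: sylow_factor_def)
  ultimately show ?thesis by (rule iso_bound_mono)
qed

text \<open>The parameter e stands for any bound on the prime exponents of n, so it carries over to
  m unchanged. The bounds then multiply, since n^(2 e) is the product of m^(2 e) and (p^a)^(2
  e).\<close>

lemma iso_bound_cube_free:
  assumes "n > 0" "e \<le> 2" "\<And>p. prime p \<Longrightarrow> multiplicity p n \<le> e"
  shows "iso_bound (solvable_groups_of_order n) (n ^ (2 * e))"
  using assms
proof (induction n rule: less_induct)
  case (less n)
  have cf: "cube_free n"
    unfolding cube_free_def
  proof (intro allI impI notI)
    fix p :: nat assume p: "prime p" "p ^ 3 dvd n"
    then have "3 \<le> multiplicity p n" using less.prems(1) by (intro multiplicity_geI) auto
    then show False using less.prems(2) less.prems(3)[OF p(1)] by linarith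
  qed
  show ?case
  proof (cases "n = 1")
    case True
    then show ?thesis using iso_bound_trivial by simp
  next
    case False
    let ?F = "prime_factors n"
    define p where "p = Max ?F"
    have "?F \<noteq> {}" using prime_factor_nat[OF False] less.prems(1) by (auto simp: prime_factors_dvd)
    then have "p \<in> ?F" unfolding p_def by (intro Max_in) auto
    then have p: "prime p" "p dvd n" by (auto simp: prime_factors_dvd)
    have max: "q \<le> p" if "prime q" "q dvd n" for q
      unfolding p_def using that less.prems(1) by (intro Max_ge) (auto simp: prime_factors_dvd)
    have p1: "p > 1" using prime_gt_1_nat[OF p(1)] .
    define a where "a = multiplicity p n"
    have "a \<ge> 1" unfolding a_def using p less.prems(1) by (intro multiplicity_geI) auto
    then have a: "a = 1 \<or> a = 2" "a \<le> e"
      using less.prems(2) less.prems(3)[OF p(1)] by (auto simp: a_def)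
    have "n \<noteq> 0" "\<not> is_unit p" using less.prems(1) p(1) by auto
    then obtain m where m: "n = p ^ a * m" "\<not> p dvd m"
      unfolding a_def by (rule multiplicity_decompose'[of n p])
    have cop: "coprime p m" using prime_imp_coprime[OF p(1) m(2)] .
    have m0: "m > 0" using m(1) less.prems(1) by (cases m) auto
    have "p ^ a > 1" using one_less_power[OF p1] a(1) by auto
    then have mn: "m < n" using m(1) m0 by simp
    have tower: "(\<exists>P. P \<lhd> G \<and> card P = p ^ a) \<or> p = 3 \<and> 4 dvd n \<and> (\<exists>P. P \<lhd> G \<and> card P = 4)"
      if "G \<in> solvable_groups_of_order n" for G
      unfolding a_def using normal_sylow_largest_prime[OF that cf p max] .
    show ?thesis
    proof (cases "p = 3 \<and> 4 dvd n")
      case True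
      \<comment> \<open>As 4 divides n, the exponent e must be 2, so the bound to be met is
        n^4.\<close>
      have "2 ^ 2 dvd n" using True by simp
      then have "2 \<le> multiplicity 2 n" using less.prems(1) by (intro multiplicity_geI) auto
      then have e: "e = 2" using less.prems(2) less.prems(3)[OF two_is_prime_nat] by linarith
      have "n = 12 \<or> n = 36"
        using four_times_prime_power_3[OF less.prems(1) cf] p True max by blast
      then have n4: "n = 4 * 3 ^ a"
      proof
        assume n: "n = 12"
        then have "\<not> 9 dvd n" by simp
        then have "a \<noteq> 2" using m(1) True by (auto elim!: dvdE)
        then show ?thesis using a(1) n by simp
      next
        assume n: "n = 36"
        have "a \<noteq> 1"
        proof
          assume "a = 1"
          then have "m = 12" using m(1) n True by simp
          then show False using m(2) True by simp
        qed
        then show ?thesis using a(1) n by simp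
      qed
      have "iso_bound (solvable_groups_of_order n) (n ^ 4)"
        using tower True by (intro iso_bound_four_times_3_power[OF n4 a(1) _ cf]) blast
      then show ?thesis using e by simp
    next
      case False
      have IH: "iso_bound (solvable_groups_of_order m) (m ^ (2 * e))"
      proof (rule less.IH[OF mn m0 less.prems(2)])
        fix q :: nat assume q: "prime q"
        have "multiplicity q m \<le> multiplicity q n" using m(1) less.prems(1)
          by (intro dvd_imp_multiplicity_le) auto
        then show "multiplicity q m \<le> e" using less.prems(3)[OF q] by linarith
      qed
      have "{G \<in> solvable_groups_of_order n. \<exists>P. P \<lhd> G \<and> card P = p ^ a}
          = solvable_groups_of_order n"
        using tower False by blast
      then have "iso_bound (solvable_groups_of_order n) (m ^ (2 * e) * sylow_factor p a)"
        using iso_bound_normal_sylow[OF cf less.prems(1) p(1) a(1) m(1) cop IH] by simp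
      moreover have "m ^ (2 * e) * sylow_factor p a \<le> n ^ (2 * e)"
      proof -
        have "sylow_factor p a \<le> (p ^ a) ^ (2 * a)" using sylow_factor_le[OF p1 a(1)] .
        also have "\<dots> \<le> (p ^ a) ^ (2 * e)" using a(2) \<open>p ^ a > 1\<close> by (intro power_increasing) auto
        finally show ?thesis unfolding m(1) power_mult_distrib by (simp add: mult.commute)
      qed
      ultimately show ?thesis by (rule iso_bound_mono)
    qed
  qed
qed

theorem theorem1p2:
  fixes n :: nat
  assumes "n > 0" and "cube_free n"
  shows "num_solvable_groups n \<le> n ^ (2 * max_prime_exponent n)"
proof (rule iso_bound_num_solvable_groups, rule iso_bound_cube_free[OF assms(1)])
  let ?M = "{multiplicity p n | p. prime p}"
  have fin: "finite ?M" using finite_multiplicities[OF assms(1)] .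
  show "multiplicity p n \<le> max_prime_exponent n" if "prime p" for p
    unfolding max_prime_exponent_def using that by (intro Max_ge[OF fin]) blast
  \<comment> \<open>The maximum of a nonempty finite set is attained, so it is a multiplicity and
    hence at most 2.\<close>
  have "?M \<noteq> {}" using two_is_prime_nat by blast
  then have "max_prime_exponent n \<in> ?M" unfolding max_prime_exponent_def by (rule Max_in[OF fin])
  then show "max_prime_exponent n \<le> 2" using cube_free_multiplicity_le[OF assms(2,1)] by auto
qed

end
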